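(* Let $\mathcal{M}=\{\mathbb{M}^{(p)}: p>0\}$ be a weight matrix (the sequences $\mathbb{M}^{(p)}$ are not assumed to be log-convex) and let $0<\alpha\le 1$ be such that $\lim_{j\to+\infty}\big(j^{(1-\alpha)j}M^{(p)}_j\big)^{1/j}=\infty$ for all $p>0$. Let $\mathcal{M}^{\alpha}=\{\mathbb{M}^{(p,\alpha)}:p>0\}$ be the weight matrix given by $M^{(p,\alpha)}_j=j^{(\alpha-1)j}\big(\overline{\mathbb{G}}^{1-\alpha}\mathbb{M}^{(p)}\big)^{\mathrm{lc}}_j$, $j\in\mathbb{N}_0$. Then the following assertions are equivalent: (a) The matrix $\mathcal{M}^{\alpha}$ satisfies $(\mathcal{M}_{\{\mathrm{rai}\}})$. (b) The class $\mathcal{A}_{\{\mathcal{M}\}}(S_\alpha)$ is holomorphically closed. (c) The class $\mathcal{A}_{\{\mathcal{M}\}}(S_\alpha)$ is inverse-closed. If in addition $\mathcal{M}$ satisfies $(\mathcal{M}_{\{C^\omega\}})$ and $\mathcal{M}^\alpha$ satisfies $(\mathcal{M}_{\{\mathrm{dc}\}})$, then (a), (b), (c) are also equivalent to each of: (d) The class $\mathcal{A}_{\{\mathcal{M}\}}(S_\alpha)$ is closed under composition. (e) The matrix $\mathcal{M}^\alpha$ satisfies $(\mathcal{M}_{\{\mathrm{FdB}\}})$.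
   Context: $\mathbb{N}_0=\{0,1,2,\dots\}$, $\mathbb{N}=\{1,2,\dots\}$, $0^0:=1$. A weight matrix is a family $\mathcal{M}=\{\mathbb{M}^{(p)}=(M^{(p)}_j)_{j\in\mathbb{N}_0}:p>0\}$ of sequences of positive reals with $M^{(p)}_0=1$ for all $p$ and $M^{(p)}_j\le M^{(q)}_j$ for all $j$ whenever $p\le q$. Write $\check M^{(p)}_j:=M^{(p)}_j/j!$. For $a\in\mathbb{R}$, $\overline{\mathbb{G}}^a:=(j^{ja})_{j\in\mathbb{N}_0}$; products of sequences are termwise. A sequence is log-convex if $M_j^2\le M_{j-1}M_{j+1}$ for all $j\ge1$. If $\lim_j M_j^{1/j}=\infty$, $\mathbb{M}^{\mathrm{lc}}$ denotes the log-convex minorant of $\mathbb{M}$, i.e. the largest log-convex sequence that is termwise $\le\mathbb{M}$. For sequences, $\mathbb{M}\preceq\mathbb{L}$ means there are $A,B>0$ with $M_j\le AB^jL_j$ for all $j\in\mathbb{N}_0$. Conditions on a weight matrix $\mathcal{M}$ (indices in $(0,\infty)$): - $(\mathcal{M}_{\{C^\omega\}})$: there is $p$ with $\liminf_{j\to\infty}(\check M^{(p)}_j)^{1/j}>0$. - $(\mathcal{M}_{\{\mathrm{rai}\}})$: $\forall p\ \exists C>0\ \exists q\ \forall 1\le j\le k$: $(\check M^{(p)}_j)^{1/j}\le C(\check M^{(q)}_k)^{1/k}$. - $(\mathcal{M}_{\{\mathrm{dc}\}})$: $\forall p\ \exists C>0\ \exists q\ \forall j\in\mathbb{N}_0$: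 $M^{(p)}_{j+1}\le C^{j+1}M^{(q)}_j$. - $(\mathcal{M}_{\{\mathrm{FdB}\}})$: $\forall p\ \exists q$: $(\check{\mathbb{M}}^{(p)})^\circ\preceq\check{\mathbb{M}}^{(q)}$, where for a sequence $\check{\mathbb{M}}$ one sets $\check M^\circ_0:=1$ and $\check M^\circ_k:=\max\{\check M_\ell\check M_{j_1}\cdots\check M_{j_\ell}: \ell\in\mathbb{N},\ j_i\in\mathbb{N},\ \sum_{i=1}^\ell j_i=k\}$ for $k\ge1$. Sectors: $\mathcal{R}$ is the Riemann surface of the logarithm and, for $\alpha>0$, $S_\alpha:=\{z\in\mathcal{R}:|\arg z|<\alpha\pi/2\}$; derivatives of functions on $S_\alpha$ are taken with respect to the coordinate $z$. $\mathcal{H}(\cdot)$ denotes holomorphic functions. For a positive sequence $\mathbb{M}$, $\mathcal{A}_{\{\mathbb{M}\}}(S)$ is the set of $f\in\mathcal{H}(S)$ for which there is $h>0$ with $\sup_{z\in S,j\in\mathbb{N}_0}\frac{|f^{(j)}(z)|}{h^jM_j}<\infty$, and $\mathcal{A}_{\{\mathcal{M}\}}(S):=\bigcup_{p>0}\mathcal{A}_{\{\mathbb{M}^{(p)}\}}(S)$. For $U\subseteq\mathbb{C}$ open, $\mathcal{H}_{\{\mathcal{M}\}}(U)$ is the set of $g\in\mathcal{H}(U)$ such that for each compact $K\subset U$ there are $p,h>0$ with $\sup_{z\in K,j\in\mathbb{N}_0}\frac{|g^{(j)}(z)|}{h^jM^{(p)}_j}<\infty$. The class $\mathcal{A}_{\{\mathcal{M}\}}(S_\alpha)$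 is: - holomorphically closed if $g\circ f\in\mathcal{A}_{\{\mathcal{M}\}}(S_\alpha)$ for all $f\in\mathcal{A}_{\{\mathcal{M}\}}(S_\alpha)$ and all $g\in\mathcal{H}(U)$ with $U\subseteq\mathbb{C}$ open containing the closure of the range of $f$; - inverse-closed if $1/f\in\mathcal{A}_{\{\mathcal{M}\}}(S_\alpha)$ for all $f\in\mathcal{A}_{\{\mathcal{M}\}}(S_\alpha)$ with $\inf_{z\in S_\alpha}|f(z)|>0$; - closed under composition if $g\circ f\in\mathcal{A}_{\{\mathcal{M}\}}(S_\alpha)$ for all $f\in\mathcal{A}_{\{\mathcal{M}\}}(S_\alpha)$ and all $g\in\mathcal{H}_{\{\mathcal{M}\}}(U)$ with $U\subseteq\mathbb{C}$ open containing the closure of the range of $f$. *)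

theory Defs
  imports "HOL-Complex_Analysis.Complex_Analysis"
begin

section \<open>Weight sequences and weight matrices\<close>

text \<open>A family of sequences indexed by positive reals is a total function
  of type \<open>real \<Rightarrow> nat \<Rightarrow> real\<close> of which only the values at indices \<open>p > 0\<close> are ever used.\<close>

type_synonym weight_family = "real \<Rightarrow> nat \<Rightarrow> real"

definition weight_matrix :: "weight_family \<Rightarrow> bool" where
  "weight_matrix M \<longleftrightarrow>
     (\<forall>p>0. M p 0 = 1 \<and> (\<forall>j. M p j > 0)) \<and>
     (\<forall>p q j. 0 < p \<longrightarrow> p \<le> q \<longrightarrow> M p j \<le> M q j)"

definition check_seq :: "(nat \<Rightarrow> real) \<Rightarrow> nat \<Rightarrow> real" where
  "check_seq M j = M j / fact j"

text \<open>The sequence \<open>j\<^bsup>ja\<^esup>\<close>. The convention \<open>0\<^sup>0 = 1\<close> has to be imposed by hand,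
  because \<open>0 powr 0 = 0\<close>.\<close>

definition gevrey_seq :: "real \<Rightarrow> nat \<Rightarrow> real" where
  "gevrey_seq a j = (if j = 0 then 1 else real j powr (real j * a))"

definition log_convex :: "(nat \<Rightarrow> real) \<Rightarrow> bool" where
  "log_convex M \<longleftrightarrow> (\<forall>j\<ge>1. (M j)\<^sup>2 \<le> M (j - 1) * M (j + 1))"

text \<open>The largest (in the pointwise order on functions) log-convex sequence of positive reals
  below \<open>M\<close>; \<open>log_convex_minorant_props\<close> below shows that it exists if \<open>root j (M j)\<close>
  tends to infinity.\<close>

definition log_convex_minorant :: "(nat \<Rightarrow> real) \<Rightarrow> nat \<Rightarrow> real" where
  "log_convex_minorant M =
     (GREATEST L. log_convex L \<and> (\<forall>j. L j > 0) \<and> (\<forall>j. L j \<le> M j))"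

definition seq_preceq :: "(nat \<Rightarrow> real) \<Rightarrow> (nat \<Rightarrow> real) \<Rightarrow> bool" where
  "seq_preceq M L \<longleftrightarrow> (\<exists>A>0. \<exists>B>0. \<forall>j. M j \<le> A * B ^ j * L j)"

definition fdb_circ :: "(nat \<Rightarrow> real) \<Rightarrow> nat \<Rightarrow> real" where
  "fdb_circ m k =
     (if k = 0 then 1
      else Max {m (length js) * (\<Prod>j\<leftarrow>js. m j) |js.
                  js \<noteq> [] \<and> (\<forall>j\<in>set js. 1 \<le> j) \<and> sum_list js = k})"

definition matrix_alpha :: "real \<Rightarrow> weight_family \<Rightarrow> weight_family" where
  "matrix_alpha \<alpha> M p j =
     gevrey_seq (\<alpha> - 1) j * log_convex_minorant (\<lambda>i. gevrey_seq (1 - \<alpha>) i * M p i) j"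


section \<open>Conditions on weight matrices\<close>

definition cond_Comega :: "weight_family \<Rightarrow> bool" where
  "cond_Comega M \<longleftrightarrow> (\<exists>p>0. liminf (\<lambda>j. ereal (root j (check_seq (M p) j))) > 0)"

definition cond_rai :: "weight_family \<Rightarrow> bool" where
  "cond_rai M \<longleftrightarrow>
     (\<forall>p>0. \<exists>C>0. \<exists>q>0. \<forall>j k. 1 \<le> j \<longrightarrow> j \<le> k \<longrightarrow>
        root j (check_seq (M p) j) \<le> C * root k (check_seq (M q) k))"

definition cond_dc :: "weight_family \<Rightarrow> bool" where
  "cond_dc M \<longleftrightarrow> (\<forall>p>0. \<exists>C>0. \<exists>q>0. \<forall>j. M p (j + 1) \<le> C ^ (j + 1) * M q j)"

definition cond_FdB :: "weight_family \<Rightarrow> bool" where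
  "cond_FdB M \<longleftrightarrow>
     (\<forall>p>0. \<exists>q>0. seq_preceq (fdb_circ (check_seq (M p))) (check_seq (M q)))"


section \<open>Function classes\<close>

text \<open>For \<open>0 < \<alpha> \<le> 1\<close> the coordinate \<open>z\<close> maps the sector of opening \<open>\<alpha> * pi\<close> of the Riemann
  surface of the logarithm injectively onto this open subset of the right half plane, so
  holomorphic functions and their derivatives with respect to \<open>z\<close> are the usual ones there.
  The point \<open>0\<close> is excluded explicitly because \<open>Arg 0 = 0\<close>.\<close>

definition sector :: "real \<Rightarrow> complex set" where
  "sector \<alpha> = {z. z \<noteq> 0 \<and> \<bar>Arg z\<bar> < \<alpha> * pi / 2}"

text \<open>Functions on \<open>S\<close> are total functions whose values off \<open>S\<close> are irrelevant. This is
  compatible with iterated \<open>deriv\<close> because the domain of holomorphy is always open: \<open>X\<close> below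
  is either that domain itself or a compact subset of it.\<close>

definition ud_bounded_on ::
    "complex set \<Rightarrow> real \<Rightarrow> (nat \<Rightarrow> real) \<Rightarrow> (complex \<Rightarrow> complex) \<Rightarrow> bool" where
  "ud_bounded_on X h M f \<longleftrightarrow>
     bdd_above {norm ((deriv ^^ j) f z) / (h ^ j * M j) |z j. z \<in> X}"

definition A_class :: "(nat \<Rightarrow> real) \<Rightarrow> complex set \<Rightarrow> (complex \<Rightarrow> complex) set" where
  "A_class M S = {f. f holomorphic_on S \<and> (\<exists>h>0. ud_bounded_on S h M f)}"

definition A_matrix_class :: "weight_family \<Rightarrow> complex set \<Rightarrow> (complex \<Rightarrow> complex) set" where
  "A_matrix_class M S = (\<Union>p\<in>{0<..}. A_class (M p) S)"

definition H_matrix_class :: "weight_family \<Rightarrow> complex set \<Rightarrow> (complex \<Rightarrow> complex) set" where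
  "H_matrix_class M U =
     {g. g holomorphic_on U \<and>
         (\<forall>K. compact K \<longrightarrow> K \<subseteq> U \<longrightarrow> (\<exists>p>0. \<exists>h>0. ud_bounded_on K h (M p) g))}"

definition holomorphically_closed :: "weight_family \<Rightarrow> complex set \<Rightarrow> bool" where
  "holomorphically_closed M S \<longleftrightarrow>
     (\<forall>f \<in> A_matrix_class M S. \<forall>U g.
        open U \<longrightarrow> closure (f ` S) \<subseteq> U \<longrightarrow> g holomorphic_on U \<longrightarrow> g \<circ> f \<in> A_matrix_class M S)"

definition inverse_closed :: "weight_family \<Rightarrow> complex set \<Rightarrow> bool" where
  "inverse_closed M S \<longleftrightarrow>
     (\<forall>f \<in> A_matrix_class M S.
        (INF z\<in>S. norm (f z)) > 0 \<longrightarrow> (\<lambda>z. 1 / f z) \<in> A_matrix_class M S)"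

definition closed_under_composition :: "weight_family \<Rightarrow> complex set \<Rightarrow> bool" where
  "closed_under_composition M S \<longleftrightarrow>
     (\<forall>f \<in> A_matrix_class M S. \<forall>U. \<forall>g \<in> H_matrix_class M U.
        open U \<longrightarrow> closure (f ` S) \<subseteq> U \<longrightarrow> g \<circ> f \<in> A_matrix_class M S)"


section \<open>Well-definedness of the minorant, the maximum and the matrix\<close>

lemma log_convex_minorant_props:
  assumes pos: "\<And>j. M j > 0"
    and lim: "filterlim (\<lambda>j. root j (M j)) at_top sequentially"
  shows "log_convex (log_convex_minorant M)"
    and "log_convex_minorant M j > 0"
    and "log_convex_minorant M j \<le> M j"
    and "\<And>L. log_convex L \<Longrightarrow> (\<And>j. L j > 0) \<Longrightarrow> (\<And>j. L j \<le> M j)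
            \<Longrightarrow> L j \<le> log_convex_minorant M j"
proof -
  define P where "P = (\<lambda>L. log_convex L \<and> (\<forall>j. L j > 0) \<and> (\<forall>j. L j \<le> M j))"
  define T where "T = (\<lambda>j. SUP L\<in>Collect P. L j)"
  have "\<exists>c>0. \<forall>j. c \<le> M j"
  proof -
    have "eventually (\<lambda>j. root j (M j) \<ge> 1) sequentially"
      using lim by (auto simp: filterlim_at_top)
    then obtain N where N: "\<And>j. j \<ge> N \<Longrightarrow> root j (M j) \<ge> 1"
      by (auto simp: eventually_sequentially)
    have big: "M j \<ge> 1" if "j \<ge> max N 1" for j
      using N[of j] that real_root_ge_1_iff[of j "M j"] by simp
    define c where "c = Min (insert 1 (M ` {..max N 1}))"
    have "c > 0" using pos by (auto simp: c_def)
    moreover have "c \<le> M j" for j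
    proof (cases "j \<le> max N 1")
      case True
      then show ?thesis unfolding c_def by (intro Min_le) auto
    next
      case False
      have "c \<le> 1" unfolding c_def by (intro Min_le) auto
      moreover have "1 \<le> M j" using False by (intro big) linarith
      ultimately show ?thesis by linarith
    qed
    ultimately show ?thesis by blast
  qed
  then obtain c where "c > 0" "\<And>j. c \<le> M j" by blast
  then have Pc: "P (\<lambda>_. c)"
    by (simp add: P_def log_convex_def power2_eq_square)
  have bdd: "bdd_above ((\<lambda>L. L j) ` Collect P)" for j
    by (rule bdd_aboveI[of _ "M j"]) (auto simp: P_def)
  have up: "L j \<le> T j" if "P L" for L j
    unfolding T_def using that bdd by (intro cSUP_upper) auto
  have Tpos: "T j > 0" for j
    using up[OF Pc, of j] \<open>c > 0\<close> by linarith
  have least: "T j \<le> B" if "\<And>L. P L \<Longrightarrow> L j \<le> B" for j B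
    unfolding T_def using Pc that by (intro cSUP_least) auto
  have TM: "T j \<le> M j" for j
    by (rule least) (simp add: P_def)
  have Tlc: "(T j)\<^sup>2 \<le> T (j - 1) * T (j + 1)" if "j \<ge> 1" for j
  proof -
    have "L j \<le> sqrt (T (j - 1) * T (j + 1))" if "P L" for L
    proof (rule real_le_rsqrt)
      have "(L j)\<^sup>2 \<le> L (j - 1) * L (j + 1)"
        using \<open>P L\<close> \<open>j \<ge> 1\<close> by (auto simp: P_def log_convex_def)
      also have "\<dots> \<le> T (j - 1) * T (j + 1)"
        using \<open>P L\<close> up[OF \<open>P L\<close>] less_imp_le[OF Tpos]
        by (intro mult_mono) (auto simp: P_def intro: less_imp_le)
      finally show "(L j)\<^sup>2 \<le> T (j - 1) * T (j + 1)" .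
    qed
    then have "T j \<le> sqrt (T (j - 1) * T (j + 1))"
      by (rule least)
    then have "(T j)\<^sup>2 \<le> (sqrt (T (j - 1) * T (j + 1)))\<^sup>2"
      using Tpos[of j] by (intro power_mono) auto
    then show ?thesis using Tpos[of "j - 1"] Tpos[of "j + 1"] by simp
  qed
  have PT: "P T" using Tlc Tpos TM by (simp add: P_def log_convex_def)
  have "log_convex_minorant M = T"
    unfolding log_convex_minorant_def P_def[symmetric]
    by (rule Greatest_equality) (use PT up in \<open>auto simp: P_def le_fun_def\<close>)
  then show "log_convex (log_convex_minorant M)" "log_convex_minorant M j > 0"
    "log_convex_minorant M j \<le> M j"
    "\<And>L. log_convex L \<Longrightarrow> (\<And>j. L j > 0) \<Longrightarrow> (\<And>j. L j \<le> M j)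
            \<Longrightarrow> L j \<le> log_convex_minorant M j"
    using PT up by (auto simp: P_def)
qed

lemma fdb_circ_wf:
  fixes m :: "nat \<Rightarrow> real"
  assumes "k \<ge> 1"
  defines "X \<equiv> {m (length js) * (\<Prod>j\<leftarrow>js. m j) |js.
                  js \<noteq> [] \<and> (\<forall>j\<in>set js. 1 \<le> j) \<and> sum_list js = k}"
  shows "finite X" and "X \<noteq> {}"
proof -
  let ?J = "{js :: nat list. js \<noteq> [] \<and> (\<forall>j\<in>set js. 1 \<le> j) \<and> sum_list js = k}"
  have "length js \<le> sum_list js" if "\<forall>j\<in>set js. 1 \<le> j" for js :: "nat list"
    using that by (induction js) auto
  then have "?J \<subseteq> {js. set js \<subseteq> {..k} \<and> length js \<le> k}"
    using member_le_sum_list by fastforce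
  then have "finite ?J"
    by (rule finite_subset) (rule finite_lists_length_le, simp)
  moreover have "X = (\<lambda>js. m (length js) * (\<Prod>j\<leftarrow>js. m j)) ` ?J"
    unfolding X_def by blast
  moreover have "[k] \<in> ?J" using assms(1) by simp
  ultimately show "finite X" "X \<noteq> {}" by blast+
qed

lemma weight_matrix_matrix_alpha:
  assumes wm: "weight_matrix M"
    and lim: "\<And>p. p > 0 \<Longrightarrow>
           filterlim (\<lambda>j. root j (gevrey_seq (1 - \<alpha>) j * M p j)) at_top sequentially"
  shows "weight_matrix (matrix_alpha \<alpha> M)"
proof -
  let ?N = "\<lambda>p i. gevrey_seq (1 - \<alpha>) i * M p i"
  have g: "gevrey_seq a j > 0" for a j by (simp add: gevrey_seq_def)
  have pos: "?N p j > 0" if "p > 0" for p j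
    using wm that g by (simp add: weight_matrix_def)
  note props = log_convex_minorant_props[OF pos lim]
  have zero: "log_convex_minorant (?N p) 0 = 1" if "p > 0" for p
  proof -
    define L where "L = (log_convex_minorant (?N p))(0 := 1)"
    have N0: "?N p 0 = 1" using wm that by (simp add: weight_matrix_def gevrey_seq_def)
    have le1: "log_convex_minorant (?N p) 0 \<le> 1" using props(3)[OF that that, of 0] N0 by simp
    have "log_convex L" unfolding log_convex_def
    proof (intro allI impI)
      fix j :: nat assume "1 \<le> j"
      let ?m = "log_convex_minorant (?N p)"
      have "(L j)\<^sup>2 = (?m j)\<^sup>2" using \<open>1 \<le> j\<close> by (simp add: L_def)
      also have "\<dots> \<le> ?m (j - 1) * ?m (j + 1)"
        using props(1)[OF that that] \<open>1 \<le> j\<close> unfolding log_convex_def by blast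
      also have "\<dots> \<le> L (j - 1) * L (j + 1)"
        using props(2)[OF that that, of "j + 1"]
          props(2)[OF that that, of "j - 1"] le1 by (intro mult_mono) (auto simp: L_def)
      finally show "(L j)\<^sup>2 \<le> L (j - 1) * L (j + 1)" .
    qed
    moreover have "L j > 0" "L j \<le> ?N p j" for j
      using props(2,3)[OF that that, of j] N0 by (auto simp: L_def)
    ultimately have "L 0 \<le> log_convex_minorant (?N p) 0"
      using props(4)[OF that that, of L 0] by blast
    with le1 show ?thesis by (simp add: L_def)
  qed
  have mono: "log_convex_minorant (?N p) j \<le> log_convex_minorant (?N q) j"
    if "0 < p" "p \<le> q" for p q j
  proof -
    have "?N p i \<le> ?N q i" for i
      using wm that g[of "1 - \<alpha>" i] by (simp add: weight_matrix_def)
    then have "log_convex_minorant (?N p) i \<le> ?N q i" for i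
      using props(3)[OF \<open>0 < p\<close> \<open>0 < p\<close>, of i] order_trans by blast
    moreover have "q > 0" using that by simp
    ultimately show ?thesis
      using props(4)[of q "log_convex_minorant (?N p)" j] props(1,2)[OF \<open>0 < p\<close> \<open>0 < p\<close>] by blast
  qed
  show ?thesis
    unfolding weight_matrix_def matrix_alpha_def
    using zero mono props(2) g by (auto simp: gevrey_seq_def intro!: mult_left_mono)
qed

end

(* On the sector, Landau-Kolmogorov inequalities hold with constants governed by j^(j(1-alpha)): the Taylor
   polynomial of f at a point w is bounded on a lens with corner w, and the Bernstein-Walsh inequality for the
   lens bounds its coefficients. Hence the class of M coincides with the class of M^alpha. A superposition of
   dilates of exp(-z), or for alpha < 1 of a Mittag-Leffler type function, gives an element f of the class of
   M^(p) whose derivatives at the vertex have alternating signs and size at least M^(p,alpha)_j up to geometric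
   factors. All Taylor coefficients of 1/(c - f) at the vertex then add up without cancellation, so that
   inverse-closedness forces (rai); conversely (rai) is what the formula of Faa di Bruno needs. Under (C^omega)
   the functions g admitted in (d) are all the holomorphic ones, which turns (d) into (b), and (dc) gives (FdB)
   from (rai) by lowering the orders of the inner factors. *)

theory Submission
  imports Defs "HOL-Probability.Sinc_Integral" "HOL-Real_Asymp.Real_Asymp"
begin

section \<open>The closed sector\<close>

text \<open>The exponent 1 - \<alpha> stems from the exterior angle (2 - \<alpha>) * pi of the
  sector. At the corner the Green function of the complement of the lens is of order |z| powr (1 /
  (2 - \<alpha>)), so on a circle of radius (k / n) powr (2 - \<alpha>), up to a constant, a
  normalised polynomial of degree below n is at most exp (3 * k). Cauchy's estimate on this circle
  loses (n / k) powr ((2 - \<alpha>) * k), and the factorials give back (n / k) ^ k. What remains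
  depends on n, and a comparison of arbitrary orders l < k < n cannot afford that. It is paid for by
  the gap in the convexity of x * ln x once the sequences are multiplied by j^(j(1-\<alpha>)), which
  is why the convex minorant is taken after this multiplication. The same exponent 2 - \<alpha>
  enters the kernel exp t / (t powr (2 - \<alpha>) + z) ^ n, whose integral at the vertex is a
  reciprocal value of the Gamma function. Reciprocals give lower bounds only at the multiples of an
  index; this suffices for (rai) because the roots that occur there lose at most a bounded factor
  between i and 2 * i.\<close>

definition csector :: "real \<Rightarrow> complex set" where
  "csector \<alpha> = {z. \<bar>Im z\<bar> * cos (\<alpha> * pi / 2) \<le> Re z * sin (\<alpha> * pi / 2)}"

lemma sin_cos_half_angle:
  assumes "0 < \<alpha>" "\<alpha> \<le> 1"
  shows "sin (\<alpha> * pi / 2) > 0" "cos (\<alpha> * pi / 2) \<ge> 0"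
proof -
  have "0 < \<alpha> * pi / 2" "\<alpha> * pi / 2 \<le> pi / 2" using assms by auto
  with pi_gt_zero show "sin (\<alpha> * pi / 2) > 0" "cos (\<alpha> * pi / 2) \<ge> 0"
    by (intro sin_gt_zero cos_ge_zero; linarith)+
qed

section \<open>Polar and Cartesian descriptions of the sectors\<close>

lemma Re_Im_polar: "Re z = norm z * cos (Arg z)" "Im z = norm z * sin (Arg z)"
proof -
  have "z = rcis (norm z) (Arg z)" by (simp add: rcis_cmod_Arg)
  then show "Re z = norm z * cos (Arg z)" "Im z = norm z * sin (Arg z)"
    by (metis Re_rcis, metis Im_rcis)
qed

lemma abs_sin_eq: "\<bar>t\<bar> \<le> pi \<Longrightarrow> \<bar>sin t\<bar> = sin \<bar>t\<bar>" for t :: real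
  using sin_ge_zero[of t] sin_ge_zero[of "-t"] by (cases "t \<ge> 0") auto

text \<open>By the addition theorem the inequality says \<open>sin (a - \<bar>t\<bar>) > 0\<close>,
  and \<open>a - \<bar>t\<bar>\<close> stays in a range where the sine has the sign of its
  argument.\<close>

lemma sin_diff_abs_pos_iff:
  assumes "0 < a" "a \<le> pi / 2" "\<bar>t\<bar> \<le> pi"
  shows "\<bar>sin t\<bar> * cos a < cos t * sin a \<longleftrightarrow> \<bar>t\<bar> < a"
proof -
  have 1: "sin \<bar>t\<bar> = \<bar>sin t\<bar>" by (rule abs_sin_eq[OF assms(3), symmetric])
  have "\<bar>sin t\<bar> * cos a < cos t * sin a \<longleftrightarrow> sin (a - \<bar>t\<bar>) > 0"
    using 1 by (simp add: sin_diff algebra_simps)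
  also have "\<dots> \<longleftrightarrow> \<bar>t\<bar> < a"
  proof
    assume "\<bar>t\<bar> < a"
    then show "sin (a - \<bar>t\<bar>) > 0" using assms by (intro sin_gt_zero) auto
  next
    assume s: "sin (a - \<bar>t\<bar>) > 0"
    show "\<bar>t\<bar> < a"
    proof (rule ccontr)
      assume "\<not> \<bar>t\<bar> < a"
      then have "sin (\<bar>t\<bar> - a) \<ge> 0" using assms by (intro sin_ge_zero) auto
      then show False using s sin_minus[of "a - \<bar>t\<bar>"] by simp
    qed
  qed
  finally show ?thesis .
qed

text \<open>Multiplying the trigonometric criterion by \<open>norm z\<close> removes
  \<open>Arg\<close>: the sector is an intersection of two open half planes.\<close>

lemma sector_iff:
  assumes "0 < \<alpha>" "\<alpha> \<le> 1"
  shows "z \<in> sector \<alpha> \<longleftrightarrow> \<bar>Im z\<bar> * cos (\<alpha> * pi / 2) < Re z * sin (\<alpha> * pi / 2)"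
proof (cases "z = 0")
  case False
  then have n: "norm z > 0" by simp
  let ?a = "\<alpha> * pi / 2"
  have "\<bar>Im z\<bar> * cos ?a < Re z * sin ?a \<longleftrightarrow>
    norm z * (\<bar>sin (Arg z)\<bar> * cos ?a) < norm z * (cos (Arg z) * sin ?a)"
    using Re_Im_polar[of z] by (metis abs_mult abs_norm_cancel mult.assoc)
  also have "\<dots> \<longleftrightarrow> \<bar>sin (Arg z)\<bar> * cos ?a < cos (Arg z) * sin ?a"
    using n by simp
  also have "\<dots> \<longleftrightarrow> \<bar>Arg z\<bar> < ?a"
    using assms Arg_bounded[of z] by (intro sin_diff_abs_pos_iff) auto
  finally show ?thesis using False by (simp add: sector_def)
qed (simp add: sector_def)

lemma open_sector: "0 < \<alpha> \<Longrightarrow> \<alpha> \<le> 1 \<Longrightarrow> open (sector \<alpha>)"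
proof -
  assume a: "0 < \<alpha>" "\<alpha> \<le> 1"
  have "sector \<alpha> = {z. \<bar>Im z\<bar> * cos (\<alpha> * pi / 2) < Re z * sin (\<alpha> * pi / 2)}"
    using sector_iff[OF a] by blast
  then show ?thesis by (simp, intro open_Collect_less continuous_intros)
qed

text \<open>For \<alpha> \<le> 1 the cosine is nonnegative, so the subadditivity of the absolute
  value suffices. The closed sector, vertex included, is encoded by half planes instead of
  \<open>Arg\<close> to make it a convex cone at once.\<close>

lemma csector_add:
  assumes "z \<in> csector \<alpha>" "w \<in> csector \<alpha>" "0 < \<alpha>" "\<alpha> \<le> 1"
  shows "z + w \<in> csector \<alpha>"
proof -
  have "\<bar>Im z + Im w\<bar> * cos (\<alpha> * pi / 2) \<le> (\<bar>Im z\<bar> + \<bar>Im w\<bar>) * cos (\<alpha> * pi / 2)"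
    using sin_cos_half_angle[OF assms(3,4)] by (intro mult_right_mono) auto
  then show ?thesis using assms by (simp add: csector_def algebra_simps)
qed

lemma sector_add_csector:
  assumes "z \<in> sector \<alpha>" "w \<in> csector \<alpha>" "0 < \<alpha>" "\<alpha> \<le> 1"
  shows "z + w \<in> sector \<alpha>"
proof -
  have "\<bar>Im z + Im w\<bar> * cos (\<alpha> * pi / 2) \<le> (\<bar>Im z\<bar> + \<bar>Im w\<bar>) * cos (\<alpha> * pi / 2)"
    using sin_cos_half_angle[OF assms(3,4)] by (intro mult_right_mono) auto
  then show ?thesis using assms by (simp add: csector_def sector_iff algebra_simps)
qed

lemma csector_scale: "z \<in> csector \<alpha> \<Longrightarrow> r \<ge> 0 \<Longrightarrow> of_real r * z \<in> csector \<alpha>"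
  by (simp add: csector_def abs_mult mult.assoc mult_left_mono)

lemma sector_subset_csector: "0 < \<alpha> \<Longrightarrow> \<alpha> \<le> 1 \<Longrightarrow> sector \<alpha> \<subseteq> csector \<alpha>"
  using sector_iff[of \<alpha>] unfolding csector_def by (auto intro: less_imp_le)

lemma zero_in_csector [simp]: "0 \<in> csector \<alpha>"
  by (simp add: csector_def)

lemma of_real_in_sector:
  assumes "0 < \<alpha>" "\<alpha> \<le> 1" "x > 0"
  shows "complex_of_real x \<in> sector \<alpha>"
  using assms sin_cos_half_angle[of \<alpha>] by (simp add: sector_iff)

lemma convex_csector: "0 < \<alpha> \<Longrightarrow> \<alpha> \<le> 1 \<Longrightarrow> convex (csector \<alpha>)"
proof (rule convexI)
  fix x y :: complex and u v :: real
  assume "0 < \<alpha>" "\<alpha> \<le> 1" "x \<in> csector \<alpha>" "y \<in> csector \<alpha>" "0 \<le> u" "0 \<le> v"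
  then show "u *\<^sub>R x + v *\<^sub>R y \<in> csector \<alpha>"
    unfolding scaleR_conv_of_real by (intro csector_add csector_scale) auto
qed

lemma convex_sector: "0 < \<alpha> \<Longrightarrow> \<alpha> \<le> 1 \<Longrightarrow> convex (sector \<alpha>)"
proof (rule convexI)
  fix x y :: complex and u v :: real
  assume *: "0 < \<alpha>" "\<alpha> \<le> 1" "x \<in> sector \<alpha>" "y \<in> sector \<alpha>" "0 \<le> u" "0 \<le> v" "u + v = 1"
  have sc: "of_real r * z \<in> sector \<alpha>" if "r > 0" "z \<in> sector \<alpha>" for r z
    using that *(1,2) by (simp add: sector_iff abs_mult mult.assoc)
  have sub: "sector \<alpha> \<subseteq> csector \<alpha>" using * by (intro sector_subset_csector)
  show "u *\<^sub>R x + v *\<^sub>R y \<in> sector \<alpha>"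
  proof (cases "u = 0")
    case False
    then show ?thesis unfolding scaleR_conv_of_real
      using * sc sub by (intro sector_add_csector csector_scale) auto
  qed (use * in auto)
qed

lemma csector_Re_nonneg:
  assumes "z \<in> csector \<alpha>" "0 < \<alpha>" "\<alpha> \<le> 1"
  shows "Re z \<ge> 0"
proof -
  have "0 \<le> \<bar>Im z\<bar> * cos (\<alpha> * pi / 2)" using sin_cos_half_angle[OF assms(2,3)] by simp
  also have "\<dots> \<le> Re z * sin (\<alpha> * pi / 2)" using assms by (simp add: csector_def)
  finally show ?thesis using sin_cos_half_angle[OF assms(2,3)] by (simp add: zero_le_mult_iff)
qed

lemma csector_inverse:
  assumes "z \<in> csector \<alpha>"
  shows "inverse z \<in> csector \<alpha>"
proof -
  have "cnj z \<in> csector \<alpha>" using assms by (simp add: csector_def)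
  then have "of_real (inverse ((norm z)\<^sup>2)) * cnj z \<in> csector \<alpha>" by (rule csector_scale) simp
  moreover have "inverse z = of_real (inverse ((norm z)\<^sup>2)) * cnj z"
  proof (cases "z = 0")
    case False
    then have "z * cnj z \<noteq> 0" by simp
    then have "inverse (cnj z) * cnj z = 1" by simp
    then have "inverse z = inverse (z * cnj z) * cnj z"
      unfolding inverse_mult_distrib mult.assoc by (metis mult.right_neutral)
    then show ?thesis unfolding complex_norm_square[symmetric] by (metis of_real_inverse)
  qed simp
  ultimately show ?thesis by simp
qed

lemma rcis_in_csector:
  assumes "0 < \<alpha>" "\<alpha> \<le> 1" "r \<ge> 0" "\<bar>t\<bar> \<le> \<alpha> * pi / 2"
  shows "rcis r t \<in> csector \<alpha>"
proof -
  let ?a = "\<alpha> * pi / 2"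
  have a: "?a \<le> pi / 2" using assms by auto
  have "sin (?a - \<bar>t\<bar>) \<ge> 0" using assms a pi_gt_zero by (intro sin_ge_zero) linarith+
  moreover have "sin \<bar>t\<bar> = \<bar>sin t\<bar>"
    using assms a pi_gt_zero by (intro abs_sin_eq[symmetric]) linarith
  ultimately have "\<bar>sin t\<bar> * cos ?a \<le> cos t * sin ?a"
    by (simp add: sin_diff algebra_simps)
  then have "r * (\<bar>sin t\<bar> * cos ?a) \<le> r * (cos t * sin ?a)" using assms by (intro mult_left_mono) auto
  then show ?thesis
    by (simp only: csector_def mem_Collect_eq Re_rcis Im_rcis abs_mult abs_of_nonneg[OF assms(3)] mult.assoc)
qed

lemma csector_Arg:
  assumes "0 < \<alpha>" "\<alpha> \<le> 1" "z \<in> csector \<alpha>"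
  shows "\<bar>Arg z\<bar> \<le> \<alpha> * pi / 2"
proof (cases "z = 0")
  case False
  then have n: "norm z > 0" by simp
  let ?a = "\<alpha> * pi / 2" and ?t = "Arg z"
  have "\<bar>Im z\<bar> * cos ?a \<le> Re z * sin ?a" using assms(3) by (simp add: csector_def)
  then have "norm z * (\<bar>sin ?t\<bar> * cos ?a) \<le> norm z * (cos ?t * sin ?a)"
    using Re_Im_polar[of z] by (metis abs_mult abs_norm_cancel mult.assoc)
  then have *: "\<bar>sin ?t\<bar> * cos ?a \<le> cos ?t * sin ?a" using n by simp
  have b: "\<bar>?t\<bar> \<le> pi" "?a \<le> pi/2" "?a > 0" using Arg_bounded[of z] assms by auto
  have "sin \<bar>?t\<bar> = \<bar>sin ?t\<bar>" by (rule abs_sin_eq[OF b(1), symmetric])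
  then have s: "sin (\<bar>?t\<bar> - ?a) \<le> 0" using * by (simp add: sin_diff algebra_simps)
  show ?thesis
  proof (rule ccontr)
    assume "\<not> ?thesis"
    then have "sin (\<bar>?t\<bar> - ?a) > 0" using b by (intro sin_gt_zero) auto
    with s show False by simp
  qed
qed (use assms in \<open>auto simp: Arg_zero\<close>)

text \<open>On the imaginary axis \<open>Arg h\<close> is plus or minus pi / 2, so the negated power
  has argument \<open>- (\<alpha> * Arg h)\<close>, that is, it lies on a boundary ray of the cone.
  The exponent is the exterior angle of the sector divided by pi.\<close>

lemma neg_powr_in_csector:
  assumes "0 < \<alpha>" "\<alpha> \<le> 1" "Re h = 0"
  shows "- (h powr of_real (2 - \<alpha>)) \<in> csector \<alpha>"
proof (cases "h = 0")
  case False
  define y where "y = Im h"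
  have h: "h = \<i> * of_real y" "y \<noteq> 0" using assms False by (auto simp: y_def complex_eq_iff)
  define s where "s = (2 - \<alpha>) * Arg h"
  have ar: "\<bar>Arg h\<bar> = pi / 2" using assms(3) False Arg_Re_nonneg[of h] Arg_Re_pos[of h] by auto
  have L: "Ln h = Complex (ln (norm h)) (Arg h)"
    using False by (simp add: Arg_eq_Im_Ln complex_eq_iff)
  have "h powr of_real (2 - \<alpha>) = exp (of_real (2 - \<alpha>) * Complex (ln (norm h)) (Arg h))"
    using False L by (simp add: powr_def)
  also have "of_real (2 - \<alpha>) * Complex (ln (norm h)) (Arg h) = Complex ((2 - \<alpha>) * ln (norm h)) s"
    by (simp add: s_def complex_eq_iff)
  also have "exp \<dots> = rcis (norm h powr (2 - \<alpha>)) s"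
    using False by (intro complex_eqI) (simp_all add: powr_def Re_exp Im_exp)
  finally have e: "h powr of_real (2 - \<alpha>) = rcis (norm h powr (2 - \<alpha>)) s" .
  have "- rcis (norm h powr (2 - \<alpha>)) s = rcis (norm h powr (2 - \<alpha>)) (s - pi * sgn (Arg h))"
  proof -
    have "cis (s - pi * sgn (Arg h)) = - cis s"
      using ar by (auto simp: sgn_if complex_eq_iff cos_diff sin_diff cos_add sin_add)
    then show ?thesis by (simp add: rcis_def)
  qed
  also have "\<dots> \<in> csector \<alpha>"
  proof (rule rcis_in_csector)
    have "Arg h = pi / 2 \<or> Arg h = - (pi / 2)" using ar by linarith
    moreover have "pi * sgn t = 2 * t" if "t = pi / 2 \<or> t = - (pi / 2)" for t
      using that pi_gt_zero by (cases "t > 0") (auto simp: sgn_if)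
    ultimately have "pi * sgn (Arg h) = 2 * Arg h" by blast
    then have "s - pi * sgn (Arg h) = - (\<alpha> * Arg h)" by (simp add: s_def algebra_simps)
    moreover have "\<bar>\<alpha> * Arg h\<bar> = \<alpha> * pi / 2" using assms(1) by (simp add: abs_mult ar)
    ultimately show "\<bar>s - pi * sgn (Arg h)\<bar> \<le> \<alpha> * pi / 2" by simp
  qed (use assms in auto)
  finally show ?thesis unfolding e .
qed auto

text \<open>\<open>x / (x - 1)\<close> is the inverse of \<open>1 + 1 / (- x)\<close>, which lies in
  the cone and has real part at least 1. The image of \<open>- csector \<alpha>\<close> is the lens;
  its corners 0 and 1 correspond to \<open>x = 0\<close> and to infinity.\<close>

lemma lens_in_csector:
  assumes "0 < \<alpha>" "\<alpha> \<le> 1" "- x \<in> csector \<alpha>"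
  shows "x / (x - 1) \<in> csector \<alpha>" "norm (x / (x - 1)) \<le> 1"
proof -
  have *: "inverse (- x) \<in> csector \<alpha>" using assms by (intro csector_inverse)
  have 1: "1 + inverse (- x) \<in> csector \<alpha>"
    using assms csector_add[OF _ *, of 1] of_real_in_sector[of \<alpha> 1] sector_subset_csector[of \<alpha>]
    by auto
  have re: "Re (1 + inverse (- x)) \<ge> 1" using csector_Re_nonneg[OF * assms(1,2)] by simp
  have e: "x / (x - 1) = inverse (1 + inverse (- x))" if "x \<noteq> 0"
  proof -
    have "x \<noteq> 1" using csector_Re_nonneg[OF assms(3,1,2)] by auto
    then show ?thesis using that by (simp add: field_simps)
  qed
  show "x / (x - 1) \<in> csector \<alpha>"
    using csector_inverse[OF 1] e by (cases "x = 0") auto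
  have "norm (1 + inverse (- x)) \<ge> 1" using re complex_Re_le_cmod order_trans by blast
  then show "norm (x / (x - 1)) \<le> 1"
    using e by (cases "x = 0") (auto simp: norm_inverse inverse_le_1_iff)
qed

section \<open>Polynomials on a sector\<close>

text \<open>Since \<open>g < 2\<close>, the imaginary part of \<open>g * Ln h\<close> stays strictly
  between - pi and pi, so the principal logarithm undoes the exponential. This locates the only pole
  of \<open>\<eta>\<close> powr \<open>g\<close> / (\<open>\<eta>\<close> powr \<open>g\<close> - 1)
  on the closed half plane.\<close>

lemma powr_eq_1_right_half_plane:
  assumes "Re h \<ge> 0" "h powr of_real g = 1" "0 < g" "g < 2"
  shows "h = 1"
proof -
  have nz: "h \<noteq> 0" using assms by auto
  have "\<bar>Arg h\<bar> \<le> pi / 2" using assms(1) Arg_Re_nonneg by blast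
  then have Im_Ln: "\<bar>Im (Ln h)\<bar> \<le> pi / 2" using nz by (simp add: Arg_eq_Im_Ln)
  have "g * \<bar>Im (Ln h)\<bar> < pi"
  proof -
    have "g * \<bar>Im (Ln h)\<bar> \<le> g * (pi / 2)" using Im_Ln assms by (intro mult_left_mono) auto
    also have "\<dots> < 2 * (pi / 2)" using assms by (intro mult_strict_right_mono) auto
    finally show ?thesis by simp
  qed
  then have "\<bar>Im (of_real g * Ln h)\<bar> < pi" using assms by (simp add: abs_mult)
  then have "Ln (exp (of_real g * Ln h)) = of_real g * Ln h" by (intro Ln_exp) auto
  moreover have "exp (of_real g * Ln h) = 1" using assms(2) nz by (simp add: powr_def)
  ultimately have "of_real g * Ln h = 0" by simp
  then have "Ln h = 0" using assms by simp
  then show "h = 1" using nz by (metis exp_Ln exp_zero)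
qed

text \<open>The complement of a circular lens with corners \<open>0\<close> and \<open>1\<close> of opening \<open>\<alpha> * pi\<close> is the
  image of the right half plane under \<open>\<eta> \<mapsto> \<eta>\<^sup>\<gamma> / (\<eta>\<^sup>\<gamma> - 1)\<close>, \<open>\<gamma> = 2 - \<alpha>\<close>, so its Green function
  with pole at infinity is \<open>ln \<bar>(\<eta> + 1) / (\<eta> - 1)\<bar>\<close>.\<close>

lemma polynomial_growth_outside_lens:
  fixes c :: "nat \<Rightarrow> complex" and n :: nat
  defines "P \<equiv> \<lambda>z. \<Sum>i\<le>n. c i * z ^ i"
  assumes \<alpha>: "0 < \<alpha>" "\<alpha> \<le> 1"
    and P1: "\<And>z. z \<in> csector \<alpha> \<Longrightarrow> norm z \<le> 1 \<Longrightarrow> norm (P z) \<le> 1"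
    and h: "Re h > 0" "h \<noteq> 1"
  shows "norm (P (h powr of_real (2 - \<alpha>) / (h powr of_real (2 - \<alpha>) - 1))) \<le> norm ((h + 1) / (h - 1)) ^ n"
proof -
  define g where "g = 2 - \<alpha>"
  have g: "1 \<le> g" "g < 2" using \<alpha> by (auto simp: g_def)
  define pw where "pw = (\<lambda>h::complex. h powr of_real g)"
  define Z where "Z = (\<lambda>h. pw h / (pw h - 1))"
  \<comment> \<open>Writing \<open>pw h - 1\<close> as \<open>D h * (h - 1)\<close> with a zero-free
    \<open>D\<close> shows that \<open>((h - 1) / (h + 1)) ^ n\<close> cancels the pole of
    \<open>P (Z h)\<close> at 1. The product, multiplied out, is \<open>Q\<close>, which is
    holomorphic at 1 as well.\<close>
  define D where "D = (\<lambda>h. if h = 1 then deriv pw 1 else (pw h - pw 1) / (h - 1))"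
  define Q where "Q = (\<lambda>h. (\<Sum>i\<le>n. c i * pw h ^ i * (pw h - 1) ^ (n - i)) * (1 / (D h * (h + 1))) ^ n)"
  have pw1: "pw 1 = 1" by (simp add: pw_def)
  have pw_ne: "pw x \<noteq> 1" if "Re x \<ge> 0" "x \<noteq> 1" for x
    using powr_eq_1_right_half_plane[of x g] that g by (auto simp: pw_def)
  have dpw: "deriv pw 1 = of_real g"
  proof (rule DERIV_imp_deriv)
    have "((\<lambda>h. h powr of_real g) has_field_derivative of_real g * 1 powr (of_real g - 1)) (at (1::complex))"
      by (rule has_field_derivative_powr) auto
    then show "(pw has_field_derivative of_real g) (at 1)" by (simp add: pw_def)
  qed
  have hol_pw: "pw holomorphic_on {x. Re x > 0}"
    unfolding pw_def by (intro holomorphic_intros) (auto simp: complex_nonpos_Reals_iff)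
  have opn: "open {x::complex. Re x > 0}" by (simp add: open_halfspace_Re_gt)
  have hol_D: "D holomorphic_on {x. Re x > 0}"
    unfolding D_def using hol_pw opn by (intro pole_lemma) (auto simp: interior_open)
  have D_ne: "D x \<noteq> 0" if "Re x \<ge> 0" for x
    using pw_ne[OF that] g by (auto simp: D_def dpw pw1)
  have x1_ne: "x + 1 \<noteq> 0" if "Re x \<ge> 0" for x :: complex
    using that by (metis add_eq_0_iff2 add.commute minus_complex.simps(1) neg_le_0_iff_le not_one_le_zero one_complex.simps(1) uminus_complex.simps(1) diff_0)
  have Q_eq: "Q x = P (Z x) * ((x - 1) / (x + 1)) ^ n" if "Re x \<ge> 0" "x \<noteq> 1" for x
  proof -
    note ne = pw_ne[OF that]
    have "(\<Sum>i\<le>n. c i * pw x ^ i * (pw x - 1) ^ (n - i)) = P (Z x) * (pw x - 1) ^ n"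
      unfolding P_def sum_distrib_right
    proof (rule sum.cong)
      fix i assume "i \<in> {..n}"
      then have "(pw x - 1) ^ n = (pw x - 1) ^ i * (pw x - 1) ^ (n - i)"
        by (simp flip: power_add)
      then show "c i * pw x ^ i * (pw x - 1) ^ (n - i) = c i * Z x ^ i * (pw x - 1) ^ n"
        using ne by (simp add: Z_def power_divide)
    qed simp
    moreover have "1 / (D x * (x + 1)) = ((x - 1) / (x + 1)) / (pw x - 1)"
      using that by (simp add: D_def pw1)
    ultimately have "Q x = P (Z x) * (pw x - 1) ^ n * (((x - 1) / (x + 1)) / (pw x - 1)) ^ n"
      unfolding Q_def by (simp only:)
    then show ?thesis using ne unfolding power_divide[of _ "pw x - 1"] by simp
  qed
  have cont_pw: "continuous_on {x. Re x \<ge> 0} pw"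
    unfolding pw_def using g by (intro continuous_on_powr_complex continuous_intros) auto
  have cont_D: "continuous_on {x. Re x \<ge> 0} D"
    unfolding continuous_on_eq_continuous_within
  proof
    fix x :: complex assume x: "x \<in> {x. Re x \<ge> 0}"
    show "continuous (at x within {x. Re x \<ge> 0}) D"
    proof (cases "x = 1")
      case True
      then have "isCont D x"
        using hol_D opn by (intro holomorphic_on_imp_continuous_on[THEN continuous_on_interior])
          (auto simp: interior_open)
      then show ?thesis by (rule continuous_at_imp_continuous_at_within)
    next
      case False
      have "continuous (at x within {x. Re x \<ge> 0}) (\<lambda>h. (pw h - pw 1) / (h - 1))"
        using cont_pw x False by (intro continuous_intros) (auto simp: continuous_on_eq_continuous_within)
      then show ?thesis
        by (rule continuous_transform_within[where \<delta> = "dist x 1"]) (use x False in \<open>auto simp: D_def dist_commute\<close>)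
    qed
  qed
  have cont_Q: "continuous_on {x. Re x \<ge> 0} Q"
    unfolding Q_def using cont_pw cont_D D_ne x1_ne by (intro continuous_intros) auto
  have hol_Q: "Q holomorphic_on {x. Re x > 0}"
    unfolding Q_def using hol_pw hol_D D_ne x1_ne by (intro holomorphic_intros) auto
  have cay: "norm ((x - 1) / (x + 1)) \<le> 1" if "Re x \<ge> 0" for x :: complex
  proof -
    have "(norm (x - 1))\<^sup>2 \<le> (norm (x + 1))\<^sup>2"
      unfolding cmod_power2 using that by (simp add: power2_eq_square algebra_simps)
    then have "norm (x - 1) \<le> norm (x + 1)" by (rule power2_le_imp_le) simp
    then show ?thesis using x1_ne[OF that] by (simp add: norm_divide divide_le_eq_1)
  qed
  have Q_le: "norm (Q x) \<le> norm (P (Z x))" if "Re x \<ge> 0" "x \<noteq> 1" for x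
    unfolding Q_eq[OF that] norm_mult norm_power
    using cay[OF that(1)] by (intro mult_left_le power_le_one) auto
  \<comment> \<open>Maximum principle on a half disc. On the imaginary axis \<open>Z\<close> takes
    values in the lens, where \<open>P\<close> is bounded by 1; on a large arc \<open>Z\<close> is
    close to the corner 1 of the lens, whence the bound \<open>1 + e\<close>.\<close>
  have main: "norm (Q h) \<le> 1 + e" if e: "e > 0" for e
  proof -
    have "isCont P 1" unfolding P_def by (intro continuous_intros)
    then obtain d where d: "d > 0" "\<And>x. dist x 1 < d \<Longrightarrow> dist (P x) (P 1) < e"
      using e unfolding continuous_at_eps_delta by metis
    \<comment> \<open>On the arc the modulus of \<open>pw\<close> is at least \<open>R\<close>, so
      the summand \<open>1 / d\<close> forces \<open>Z\<close> into the disc of radius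
      \<open>d\<close> about 1; the summand \<open>norm h\<close> puts \<open>h\<close> inside the
      arc.\<close>
    define R where "R = 2 + 1 / d + norm h"
    have R: "R > 1" "R > norm h" using d(1) by (auto simp: R_def intro: add_pos_nonneg) 
    have P11: "norm (P 1) \<le> 1"
      using P1[of 1] of_real_in_sector[OF \<alpha>, of 1] sector_subset_csector[OF \<alpha>] by auto
    have far: "norm (Q x) \<le> 1 + e" if x: "Re x \<ge> 0" "norm x = R" for x
    proof -
      have "x \<noteq> 1" using x R by auto
      note ne = pw_ne[OF x(1) this]
      have "norm (pw x) = R powr g" using x by (simp add: pw_def norm_powr_real_powr')
      moreover have "R powr g \<ge> R powr 1" using R g by (intro powr_mono) auto
      ultimately have "norm (pw x) \<ge> R" using R by simp
      then have nn: "norm (pw x - 1) > 1 / d"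
        using norm_triangle_ineq2[of "pw x" 1] by (simp add: R_def) (smt (verit) norm_ge_zero)
      have "Z x - 1 = 1 / (pw x - 1)" using ne by (simp add: Z_def field_simps)
      then have "dist (Z x) 1 = 1 / norm (pw x - 1)" by (simp add: dist_norm norm_divide)
      also have "\<dots> < d" using nn d(1) ne by (simp add: field_simps)
      finally have "dist (P (Z x)) (P 1) < e" by (rule d(2))
      then have "norm (P (Z x)) \<le> 1 + e"
        using P11 norm_triangle_ineq2[of "P (Z x)" "P 1"] by (simp add: dist_norm)
      then show ?thesis using Q_le[OF x(1) \<open>x \<noteq> 1\<close>] by simp
    qed
    have near: "norm (Q x) \<le> 1" if x: "Re x = 0" for x
    proof -
      have "x \<noteq> 1" using x by auto
      have "- pw x \<in> csector \<alpha>" unfolding pw_def g_def by (rule neg_powr_in_csector[OF \<alpha> x])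
      from lens_in_csector[OF \<alpha> this] have "norm (P (Z x)) \<le> 1" unfolding Z_def by (rule P1)
      then show ?thesis using Q_le[of x] x \<open>x \<noteq> 1\<close> by simp
    qed
    define S where "S = {x. Re x > 0} \<inter> ball (0::complex) R"
    have S: "open S" unfolding S_def using opn by blast
    have clS: "closure S \<subseteq> {x. Re x \<ge> 0} \<inter> cball 0 R"
    proof (rule closure_minimal)
      show "closed ({x. Re x \<ge> 0} \<inter> cball 0 R)"
        by (intro closed_Int closed_halfspace_Re_ge) auto
    qed (auto simp: S_def)
    show ?thesis
    proof (rule maximum_modulus_frontier[of Q S])
      show "Q holomorphic_on interior S"
        unfolding interior_open[OF S] using hol_Q by (rule holomorphic_on_subset) (auto simp: S_def)
      show "continuous_on (closure S) Q"
        using clS by (intro continuous_on_subset[OF cont_Q]) auto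
      show "bounded S" unfolding S_def by (auto intro: bounded_Int)
      show "h \<in> S" using R h by (auto simp: S_def)
      fix x assume "x \<in> frontier S"
      then have "x \<in> closure S" "x \<notin> S" using S by (auto simp: frontier_def interior_open)
      then have "Re x \<ge> 0" "norm x \<le> R" "Re x = 0 \<or> norm x = R" using clS by (auto simp: S_def)
      then show "norm (Q x) \<le> 1 + e" using far near[of x] that by force
    qed
  qed
  have "norm (Q h) \<le> 1"
  proof (rule field_le_epsilon)
    fix e :: real assume "e > 0"
    then show "norm (Q h) \<le> 1 + e" by (rule main)
  qed
  then have *: "norm (P (Z h)) * norm ((h - 1) / (h + 1)) ^ n \<le> 1"
    using Q_eq[of h] h by (simp add: norm_mult norm_power)
  have pos: "norm ((h - 1) / (h + 1)) > 0" using h x1_ne[of h] by auto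
  have "norm (P (Z h)) \<le> 1 / norm ((h - 1) / (h + 1)) ^ n"
    using * pos by (simp add: pos_le_divide_eq)
  also have "\<dots> = norm ((h + 1) / (h - 1)) ^ n"
    by (simp add: norm_divide power_divide)
  finally show ?thesis unfolding Z_def pw_def g_def .
qed

text \<open>The preimage \<open>h\<close> of \<open>z\<close> in the half plane has modulus at most
  \<open>(2 * norm z) powr (1 / (2 - \<alpha>))\<close>, and the Green function is at most three
  times this bound. The radius 1 / 8 keeps \<open>norm h\<close> below 1 / 2, away from the pole at
  1.\<close>

lemma bernstein_walsh_sector:
  fixes c :: "nat \<Rightarrow> complex"
  assumes \<alpha>: "0 < \<alpha>" "\<alpha> \<le> 1"
    and P1: "\<And>z. z \<in> csector \<alpha> \<Longrightarrow> norm z \<le> 1 \<Longrightarrow> norm (\<Sum>i\<le>n. c i * z ^ i) \<le> 1"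
    and z: "norm z \<le> 1 / 8"
  shows "norm (\<Sum>i\<le>n. c i * z ^ i) \<le> exp (3 * real n * (2 * norm z) powr (1 / (2 - \<alpha>)))"
proof -
  define g where "g = 2 - \<alpha>"
  have g: "1 \<le> g" "g < 2" using \<alpha> by (auto simp: g_def)
  \<comment> \<open>The map is an involution, so also \<open>z = x / (x - 1)\<close>. Either
    \<open>- x\<close> lies in the closed sector and \<open>z\<close> in the lens, or
    \<open>x\<close> is the power with exponent \<open>g\<close> of a point with positive real
    part.\<close>
  define x where "x = z / (z - 1)"
  have z1: "z \<noteq> 1" using z by auto
  have zx: "z = x / (x - 1)" using z1 by (simp add: x_def divide_simps)
  show ?thesis
  proof (cases "- x \<in> csector \<alpha>")
    case True
    have "norm (\<Sum>i\<le>n. c i * z ^ i) \<le> 1"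
      using lens_in_csector[OF \<alpha> True] P1 zx by auto
    also have "1 \<le> exp (3 * real n * (2 * norm z) powr (1 / (2 - \<alpha>)))" by simp
    finally show ?thesis .
  next
    case False
    then have x0: "x \<noteq> 0" by auto
    define h where "h = x powr of_real (1 / g)"
    have nx: "norm x \<le> 2 * norm z"
    proof -
      have "norm (z - 1) \<ge> 1 / 2" using norm_triangle_ineq2[of 1 z] z by (simp add: norm_minus_commute)
      then have "norm z \<le> norm z * (2 * norm (z - 1))" by (intro mult_le_cancel_left1[THEN iffD2]) auto
      then show ?thesis using z1 by (simp add: x_def norm_divide divide_le_eq mult_ac)
    qed
    have Argx: "\<bar>Arg x\<bar> < g * (pi / 2)"
    proof (rule ccontr)
      assume *: "\<not> ?thesis"
      have "g * (pi / 2) > 0" using g by simp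
      then have "Arg x \<noteq> 0" using * by auto
      then have c: "cis (Arg x - pi * sgn (Arg x)) = - cis (Arg x)"
        by (auto simp: complex_eq_iff sgn_if cos_diff sin_diff cos_add sin_add)
      have "- x = - (norm x * cis (Arg x))" by (metis rcis_cmod_Arg rcis_def)
      then have "- x = rcis (norm x) (Arg x - pi * sgn (Arg x))"
        unfolding rcis_def c by simp
      moreover have "\<bar>Arg x - pi * sgn (Arg x)\<bar> \<le> \<alpha> * pi / 2"
      proof -
        have "\<bar>Arg x\<bar> \<le> pi" using Arg_bounded[of x] by auto
        moreover have "\<bar>Arg x\<bar> \<ge> pi - \<alpha> * pi / 2" using * by (simp add: g_def algebra_simps)
        ultimately show ?thesis using pi_gt_zero \<alpha> by (auto simp: sgn_if abs_if split: if_splits)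
      qed
      ultimately show False using rcis_in_csector[OF \<alpha>, of "norm x"] False by auto
    qed
    have Lnh: "Ln h = of_real (1 / g) * Ln x"
    proof -
      have "\<bar>Im (of_real (1 / g) * Ln x)\<bar> < pi / 2"
        using Argx g x0 by (simp add: Arg_eq_Im_Ln field_simps)
      then have "Ln (exp (of_real (1 / g) * Ln x)) = of_real (1 / g) * Ln x"
        using pi_gt_zero by (intro Ln_exp) linarith+
      then show ?thesis using x0 by (simp only: h_def powr_def if_False)
    qed
    have h0: "h \<noteq> 0" using x0 by (simp add: h_def)
    have hg: "h powr of_real g = x"
      using g x0 h0 Lnh by (simp add: powr_def)
    have Reh: "Re h > 0"
    proof -
      have "\<bar>Im (Ln h)\<bar> = \<bar>Im (Ln x)\<bar> / g" unfolding Lnh using g by simp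
      also have "\<dots> < pi / 2" using Argx g x0 by (simp add: Arg_eq_Im_Ln pos_divide_less_eq mult.commute)
      finally have "\<bar>Arg h\<bar> < pi / 2" using h0 by (simp add: Arg_eq_Im_Ln)
      then show ?thesis using h0 Arg_Re_pos[of h] by auto
    qed
    define r where "r = (2 * norm z) powr (1 / g)"
    have nh: "norm h \<le> r"
    proof -
      have "norm h = norm x powr (1 / g)" by (simp add: h_def norm_powr_real_powr')
      also have "\<dots> \<le> r" unfolding r_def using nx g by (intro powr_mono2) auto
      finally show ?thesis .
    qed
    have r: "0 \<le> r" "r \<le> 1 / 2"
    proof -
      have "r \<le> (1 / 4) powr (1 / g)" unfolding r_def using z g by (intro powr_mono2) auto
      also have "\<dots> \<le> (1 / 4) powr (1 / 2)" using g by (intro powr_mono') auto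
      also have "\<dots> = 1 / 2" by (simp add: powr_half_sqrt real_sqrt_divide)
      finally show "r \<le> 1 / 2" .
    qed (simp add: r_def)
    have h1: "h \<noteq> 1" using nh r by auto
    have "norm (\<Sum>i\<le>n. c i * z ^ i) \<le> norm ((h + 1) / (h - 1)) ^ n"
      using polynomial_growth_outside_lens[OF \<alpha> P1 Reh h1] hg zx unfolding g_def by auto
    also have "\<dots> \<le> exp (3 * r) ^ n"
    proof (rule power_mono)
      have "norm (h + 1) \<le> 1 + r" using norm_triangle_ineq[of h 1] nh by simp
      moreover have "norm (h - 1) \<ge> 1 - r" using norm_triangle_ineq2[of 1 h] nh
        by (simp add: norm_minus_commute)
      ultimately have "norm ((h + 1) / (h - 1)) \<le> (1 + r) / (1 - r)"
        unfolding norm_divide using r by (intro frac_le) auto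
      also have "\<dots> \<le> (1 + r) * (1 + 2 * r)"
      proof -
        have "1 \<le> (1 + 2 * r) * (1 - r)" using r mult_left_mono[of r "1/2" r] by (simp add: algebra_simps)
        then have "1 / (1 - r) \<le> 1 + 2 * r" using r by (simp add: pos_divide_le_eq)
        then show ?thesis using r mult_left_mono[of "1 / (1 - r)" "1 + 2 * r" "1 + r"] by simp
      qed
      also have "\<dots> \<le> exp r * exp (2 * r)"
        using r by (intro mult_mono exp_ge_add_one_self) auto
      also have "\<dots> = exp (3 * r)" by (simp flip: exp_add)
      finally show "norm ((h + 1) / (h - 1)) \<le> exp (3 * r)" .
    qed simp
    also have "\<dots> = exp (3 * real n * (2 * norm z) powr (1 / (2 - \<alpha>)))"
      by (simp add: r_def g_def mult_ac flip: exp_of_nat_mult)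
    finally show ?thesis .
  qed
qed

section \<open>Interpolation of derivatives through Taylor polynomials\<close>

lemma power_le_exp_fact: "x ^ n \<le> exp x * fact n" if "x \<ge> 0" for x :: real
proof -
  have "(\<Sum>i\<in>{n}. x ^ i /\<^sub>R fact i) \<le> (\<Sum>i. x ^ i /\<^sub>R fact i)"
    using that summable_exp[of x] by (intro sum_le_suminf) auto
  also have "\<dots> = exp x" using exp_converges[of x] by (simp add: sums_iff)
  finally show ?thesis by (simp add: field_simps)
qed

lemma polynomial_coeff_bound:
  fixes c :: "nat \<Rightarrow> complex"
  assumes "t > 0" "k \<le> n" "\<And>z. norm z = t \<Longrightarrow> norm (\<Sum>i\<le>n. c i * z ^ i) \<le> B"
  shows "norm (c k) \<le> B / t ^ k"
proof -
  define P where "P = (\<lambda>z. \<Sum>i\<le>n. c i * z ^ i)"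
  have "P has_fps_expansion (\<Sum>i\<le>n. fps_const (c i) * fps_X ^ i)"
    unfolding P_def by (intro fps_expansion_intros)
  from fps_nth_fps_expansion[OF this, of k] have "(deriv ^^ k) P 0 = fact k * c k"
    using assms(2) by (simp add: fps_sum_nth fps_X_power_nth if_distrib sum.delta cong: if_cong)
  moreover have "norm ((deriv ^^ k) P 0) \<le> fact k * B / t ^ k"
  proof (rule Cauchy_inequality)
    show "P holomorphic_on ball 0 t" "continuous_on (cball 0 t) P"
      unfolding P_def by (intro holomorphic_intros continuous_intros)+
  qed (use assms in \<open>auto simp: P_def\<close>)
  ultimately have "fact k * norm (c k) \<le> fact k * (B / t ^ k)"
    by (simp add: norm_mult)
  then show ?thesis by (rule mult_left_le_imp_le) simp
qed

text \<open>The Taylor polynomial at \<open>w\<close> is bounded by \<open>2 * A\<close> on the part of \<open>w + csector \<alpha>\<close> at distance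
  at most \<open>r\<close> from \<open>w\<close>, and \<open>bernstein_walsh_sector\<close> controls it near the corner \<open>w\<close>.\<close>

lemma sector_derivative_interpolation:
  assumes \<alpha>: "0 < \<alpha>" "\<alpha> \<le> 1"
    and hol: "f holomorphic_on sector \<alpha>"
    and A: "A > 0" "\<And>z. z \<in> sector \<alpha> \<Longrightarrow> norm (f z) \<le> A"
    and B: "B > 0" "\<And>z. z \<in> sector \<alpha> \<Longrightarrow> norm ((deriv ^^ n) f z) \<le> B"
    and k: "0 < k" "k < n" and w: "w \<in> sector \<alpha>"
  shows "norm ((deriv ^^ k) f w) \<le> 2 * (16 * exp 4) ^ k * (real n / real k) powr ((1 - \<alpha>) * real k)
           * (A * (B / A) powr (real k / real n))"
proof -
  define g where "g = 2 - \<alpha>"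
  have g: "1 \<le> g" "g < 2" using \<alpha> by (auto simp: g_def)
  obtain m where m: "n = Suc m" using k by (cases n) auto
  \<comment> \<open>This radius makes the bound \<open>B * r ^ n / fact m\<close> of the Taylor
    remainder equal to \<open>A\<close>.\<close>
  define r where "r = (A / B * fact m) powr (1 / real n)"
  have r: "r > 0" using A B by (simp add: r_def)
  have rn: "r ^ n = A / B * fact m"
    using r A B k by (simp add: r_def powr_powr flip: powr_realpow)
  define c where "c = (\<lambda>i. (deriv ^^ i) f w / fact i * of_real (r ^ i) / of_real (2 * A))"
  have Pb: "norm (\<Sum>i\<le>m. c i * z ^ i) \<le> 1" if z: "z \<in> csector \<alpha>" "norm z \<le> 1" for z
  proof -
    define u where "u = w + of_real r * z"
    have u: "u \<in> sector \<alpha>"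
      unfolding u_def using w z r \<alpha> by (intro sector_add_csector csector_scale) auto
    have "norm ((deriv ^^ 0) f u - (\<Sum>i\<le>m. (deriv ^^ i) f w * (u - w) ^ i / fact i)) \<le> B * norm (u - w) ^ Suc m / fact m"
    proof (rule complex_Taylor[OF convex_sector[OF \<alpha>] _ _ w u])
      fix i x assume "x \<in> sector \<alpha>"
      then have "((deriv ^^ i) f has_field_derivative deriv ((deriv ^^ i) f) x) (at x)"
        using hol open_sector[OF \<alpha>] by (intro holomorphic_derivI[OF holomorphic_higher_deriv]) auto
      then show "((deriv ^^ i) f has_field_derivative (deriv ^^ Suc i) f x) (at x within sector \<alpha>)"
        by (simp add: has_field_derivative_at_within)
    qed (use B m in auto)
    also have "\<dots> \<le> B * r ^ n / fact m"
    proof -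
      have "norm (u - w) \<le> r" using z r by (simp add: u_def norm_mult)
      then show ?thesis unfolding m using B(1) by (intro divide_right_mono mult_left_mono power_mono) auto
    qed
    also have "\<dots> = A" using B(1) by (simp add: rn)
    finally have "norm (\<Sum>i\<le>m. (deriv ^^ i) f w * (u - w) ^ i / fact i) \<le> norm (f u) + A"
      using norm_triangle_ineq2[of "\<Sum>i\<le>m. (deriv ^^ i) f w * (u - w) ^ i / fact i" "f u"]
      by (simp add: norm_minus_commute)
    also have "\<dots> \<le> 2 * A" using A(2)[OF u] by simp
    also have "(\<Sum>i\<le>m. (deriv ^^ i) f w * (u - w) ^ i / fact i) = of_real (2 * A) * (\<Sum>i\<le>m. c i * z ^ i)"
      using A(1) unfolding sum_distrib_left
      by (intro sum.cong) (auto simp: c_def u_def power_mult_distrib)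
    finally have "2 * A * norm (\<Sum>i\<le>m. c i * z ^ i) \<le> 2 * A * 1"
      using A(1) by (simp add: norm_mult)
    then show ?thesis using A(1) by (subst (asm) mult_le_cancel_left_pos) auto
  qed
  define s where "s = real k / real n"
  have s: "0 < s" "s < 1" using k by (auto simp: s_def)
  \<comment> \<open>The radius for Cauchy's estimate. It makes
    \<open>real m * (2 * t) powr (1 / g)\<close> at most \<open>n * s = k\<close>, so the polynomial
    grows by a factor that is geometric in \<open>k\<close> and free of \<open>n\<close>; the
    divisor 8 also meets the condition \<open>norm z \<le> 1 / 8\<close>.\<close>
  define t where "t = s powr g / 8"
  have t: "0 < t" "t \<le> 1 / 8" using s g by (auto simp: t_def intro: powr_le1)
  have ck: "norm (c k) \<le> exp (3 * real k) / t ^ k"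
  proof (rule polynomial_coeff_bound[of t k m])
    fix z :: complex assume z: "norm z = t"
    have "norm (\<Sum>i\<le>m. c i * z ^ i) \<le> exp (3 * real m * (2 * norm z) powr (1 / (2 - \<alpha>)))"
      using z t by (intro bernstein_walsh_sector \<alpha> Pb) auto
    also have "\<dots> \<le> exp (3 * real k)"
    proof -
      have "(2 * norm z) powr (1 / g) \<le> (s powr g) powr (1 / g)"
        using s g unfolding z t_def by (intro powr_mono2) auto
      also have "\<dots> = s" using s g by (simp add: powr_powr)
      finally have "real m * (2 * norm z) powr (1 / g) \<le> real n * s"
        using m by (intro mult_mono) auto
      then show ?thesis using k by (simp add: g_def s_def)
    qed
    finally show "norm (\<Sum>i\<le>m. c i * z ^ i) \<le> exp (3 * real k)" .
  qed (use t k m in auto)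
  \<comment> \<open>A crude form of Stirling's formula; the factor \<open>n\<close> between
    \<open>fact m\<close> and \<open>fact n\<close> is absorbed by \<open>2 ^ n\<close>.\<close>
  have fm: "fact m \<ge> (real n / (2 * exp 1)) ^ n"
  proof -
    have "real n ^ n \<le> exp (real n) * fact n" by (rule power_le_exp_fact) simp
    also have "\<dots> = exp (real n) * (real n * fact m)" by (simp add: m)
    also have "\<dots> \<le> exp (real n) * (2 ^ n * fact m)"
      using of_nat_less_two_power[of n, where ?'a = real] by (intro mult_left_mono mult_right_mono) auto
    also have "exp (real n) = exp 1 ^ n" by (simp flip: exp_of_nat_mult)
    finally show ?thesis by (simp add: power_divide power_mult_distrib field_simps)
  qed
  have r_ge: "r \<ge> (A / B) powr (1 / real n) * (real n / (2 * exp 1))"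
  proof -
    have "(A / B * (real n / (2 * exp 1)) ^ n) powr (1 / real n) \<le> r"
      unfolding r_def using fm A B k by (intro powr_mono2 mult_left_mono) auto
    moreover have "((real n / (2 * exp 1)) ^ n) powr (1 / real n) = real n / (2 * exp 1)"
      using k by (simp add: powr_powr flip: powr_realpow)
    ultimately show ?thesis using A B k by (subst (asm) powr_mult) auto
  qed
  define q where "q = (A / B) powr (1 / real n) * (real n / (2 * exp 1))"
  have q: "q > 0" "q \<le> r" using A B k r_ge by (auto simp: q_def)
  have qk: "1 / q ^ k = (B / A) powr (real k / real n) * (2 * exp 1 / real n) ^ k"
  proof -
    have "((A / B) powr (1 / real n)) ^ k = (A / B) powr (real k / real n)"
      using A B by (simp add: powr_powr flip: powr_realpow)
    moreover have "(B / A) powr (real k / real n) = 1 / (A / B) powr (real k / real n)"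
      using A B by (simp add: powr_divide)
    ultimately show ?thesis unfolding q_def power_mult_distrib
      by (simp add: power_divide)
  qed
  have "norm ((deriv ^^ k) f w) = fact k * (2 * A) * norm (c k) / r ^ k"
    using r A by (simp add: c_def norm_mult norm_divide norm_power)
  also have "\<dots> \<le> real k ^ k * (2 * A) * (exp (3 * real k) / t ^ k) / q ^ k"
  proof -
    have "fact k \<le> real k ^ k" using fact_le_power[of k, where ?'a = real] by simp
    then show ?thesis using ck q A(1) r t
      by (intro frac_le mult_mono power_mono) auto
  qed
  also have "\<dots> = 2 * A * (real k ^ k * exp (3 * real k) * (1 / t ^ k) * (1 / q ^ k))" by simp
  \<comment> \<open>The base \<open>16 * exp 4\<close> collects 8 from \<open>t\<close>,
    \<open>exp 3\<close> from the growth of the polynomial and \<open>2 * exp 1\<close> from the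
    bound of \<open>fact m\<close>. The factor \<open>s ^ k\<close>, left by
    \<open>real k ^ k\<close> over \<open>real n ^ k\<close>, lowers the exponent from 2 - \<alpha>
    to 1 - \<alpha>.\<close>
  also have "1 / t ^ k = 8 ^ k * (1 / s) powr (g * real k)"
    using s by (simp add: t_def power_divide powr_powr powr_divide flip: powr_realpow)
  also have "exp (3 * real k) = exp 3 ^ k" by (simp flip: exp_of_nat_mult add: mult.commute)
  also have "real k ^ k * exp 3 ^ k * (8 ^ k * (1 / s) powr (g * real k)) * (1 / q ^ k) =
     (16 * exp 4) ^ k * (s ^ k * (1 / s) powr (g * real k)) * (B / A) powr (real k / real n)"
  proof -
    have "exp (4::real) ^ k = exp 3 ^ k * exp 1 ^ k" by (simp flip: power_mult_distrib exp_add)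
    moreover have "(16::real) ^ k = 8 ^ k * 2 ^ k" by (simp flip: power_mult_distrib)
    ultimately show ?thesis unfolding qk
      by (simp add: power_mult_distrib power_divide s_def)
  qed
  also have "s ^ k * (1 / s) powr (g * real k) = (1 / s) powr ((1 - \<alpha>) * real k)"
  proof -
    have "(1 / s) powr (g * real k) = (1 / s) powr ((1 - \<alpha>) * real k + real k)"
      by (simp add: g_def algebra_simps)
    also have "\<dots> = (1 / s) powr ((1 - \<alpha>) * real k) * (1 / s) ^ k"
      using s by (simp add: powr_add powr_realpow)
    finally show ?thesis using s by (simp add: power_divide)
  qed
  finally show ?thesis by (simp add: s_def mult_ac)
qed

section \<open>The log-convex minorant\<close>

lemma gevrey_seq_pos: "gevrey_seq a j > 0"
  by (simp add: gevrey_seq_def)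

lemma gevrey_seq_uminus: "gevrey_seq (- a) j * gevrey_seq a j = 1"
  by (simp add: gevrey_seq_def flip: powr_add)

lemma ln_gevrey_seq: "ln (gevrey_seq a j) = a * (real j * ln (real j))"
  by (simp add: gevrey_seq_def ln_powr mult_ac)

text \<open>The logarithms of the hypotheses say that the point \<open>(k, ln v)\<close> lies below all chords of
  \<open>ln \<circ> N\<close>, hence on a line below \<open>ln \<circ> N\<close>.\<close>

lemma le_log_convex_minorantI:
  assumes pos: "\<And>j. N j > 0" and lim: "filterlim (\<lambda>j. root j (N j)) at_top sequentially"
    and "k > 0" "v > 0" "v \<le> N k"
    and chord: "\<And>l n. l < k \<Longrightarrow> k < n \<Longrightarrow>
      v \<le> N l powr (real (n - k) / real (n - l)) * N n powr (real (k - l) / real (n - l))"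
  shows "v \<le> log_convex_minorant N k"
proof -
  define y where "y = (\<lambda>j. ln (N j))"
  define u where "u = ln v"
  define S where "S = (\<lambda>l. (u - y l) / real (k - l)) ` {..<k}"
  \<comment> \<open>The largest slope of the lines from the points \<open>(l, y l)\<close> with
    \<open>l < k\<close> to \<open>(k, u)\<close>. The line of this slope through
    \<open>(k, u)\<close> is below \<open>y\<close> on the left by maximality, and on the right by
    the chord condition for an \<open>l\<close> that attains the maximum.\<close>
  define s where "s = Max S"
  have S: "finite S" "S \<noteq> {}" using \<open>k > 0\<close> by (auto simp: S_def)
  define L where "L = (\<lambda>j. exp (u + s * (real j - real k)))"
  have "log_convex L"
    unfolding log_convex_def
  proof (intro allI impI)
    fix j :: nat assume "1 \<le> j"
    then show "(L j)\<^sup>2 \<le> L (j - 1) * L (j + 1)"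
      by (simp add: L_def power2_eq_square of_nat_diff algebra_simps flip: exp_add)
  qed
  moreover have "L j \<le> N j" for j
  proof -
    have "u + s * (real j - real k) \<le> y j"
    proof (cases j k rule: linorder_cases)
      case less
      then have "(u - y j) / real (k - j) \<le> s" unfolding s_def using S by (intro Max_ge) (auto simp: S_def)
      then show ?thesis using less by (simp add: pos_divide_le_eq of_nat_diff algebra_simps)
    next
      case equal
      then show ?thesis using assms(3-5) pos[of k] by (simp add: u_def y_def)
    next
      case greater
      from Max_in[OF S] obtain l where l: "l < k" "s = (u - y l) / real (k - l)"
        by (auto simp: S_def s_def)
      have "u \<le> real (j - k) / real (j - l) * y l + real (k - l) / real (j - l) * y j"
        using chord[OF l(1) greater] pos[of l] pos[of j] assms(4)
        by (subst (asm) ln_le_cancel_iff[symmetric]) (auto simp: u_def y_def ln_mult ln_powr)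
      also have "\<dots> = (real (j - k) * y l + real (k - l) * y j) / real (j - l)"
        by (simp add: add_divide_distrib)
      finally have *: "u * (real j - real l) \<le> (real j - real k) * y l + (real k - real l) * y j"
        using l greater by (simp add: pos_le_divide_eq of_nat_diff)
      have s: "s * (real k - real l) = u - y l" using l by (simp add: of_nat_diff)
      have "(real k - real l) * (u + s * (real j - real k)) = (real k - real l) * u + (u - y l) * (real j - real k)"
        unfolding s[symmetric] by (simp add: algebra_simps)
      also have "\<dots> \<le> (real k - real l) * y j" using * by (simp add: algebra_simps)
      finally show ?thesis using l by simp
    qed
    then show ?thesis using pos[of j] by (simp add: L_def y_def ln_ge_iff flip: ln_ge_iff)
  qed
  ultimately have "L k \<le> log_convex_minorant N k"
    using pos lim by (intro log_convex_minorant_props(4)) (auto simp: L_def)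
  then show ?thesis using \<open>v > 0\<close> by (simp add: L_def u_def)
qed

section \<open>Transfer of derivative bounds to the minorant\<close>

lemma chord_weights:
  fixes l k n :: nat
  assumes "l < k" "k < n"
  shows "real (n - k) / real (n - l) + real (k - l) / real (n - l) = 1"
    and "real l * (real (n - k) / real (n - l)) + real n * (real (k - l) / real (n - l)) = real k"
proof -
  have "real n - real l \<noteq> 0" using assms by simp
  then show "real (n - k) / real (n - l) + real (k - l) / real (n - l) = 1"
    using assms by (simp add: of_nat_diff flip: add_divide_distrib)
  have "real l * (real (n - k) / real (n - l)) + real n * (real (k - l) / real (n - l)) =
      (real k * (real n - real l)) / (real n - real l)"
    using assms by (simp add: of_nat_diff algebra_simps flip: add_divide_distrib)
  then show "real l * (real (n - k) / real (n - l)) + real n * (real (k - l) / real (n - l)) = real k"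
    using \<open>real n - real l \<noteq> 0\<close> by simp
qed

text \<open>The interpolation inequality loses the power (1 - \<alpha>) * (k - l) of (n - l) / (k -
  l). Convexity of \<open>x * ln x\<close> puts \<open>k * ln k\<close> below the chord, and the gap
  pays for the logarithm of this loss up to a term linear in \<open>k\<close>. Applying
  \<open>x * ln (x / k) \<ge> x - k\<close> to the two parts \<open>\<theta> * l\<close> and
  \<open>\<tau> * n\<close> of \<open>k\<close> gives errors with sum \<open>- k\<close>.\<close>

lemma entropy_bound:
  fixes l k n :: nat
  assumes "l < k" "k < n"
  defines "\<theta> \<equiv> real (n - k) / real (n - l)" and "\<tau> \<equiv> real (k - l) / real (n - l)"
  shows "real k * ln k + real (k - l) * ln (real (n - l) / real (k - l)) \<le>
         real k + \<theta> * (real l * ln l) + \<tau> * (real n * ln n)"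
proof -
  have th: "\<theta> > 0" "\<tau> > 0" "\<theta> + \<tau> = 1"
    using assms(1,2) chord_weights[OF assms(1,2)] by (auto simp: \<theta>_def \<tau>_def)
  have ln\<tau>: "ln (real (n - l) / real (k - l)) = - ln \<tau>"
    using assms(1,2) by (simp add: \<tau>_def ln_div)
  have kl: "real (k - l) = \<tau> * (real n - real l)"
    using assms(1,2) by (simp add: \<tau>_def of_nat_diff)
  have k: "real k = \<theta> * real l + \<tau> * real n"
    using chord_weights(2)[OF assms(1,2)] by (simp add: \<theta>_def \<tau>_def mult.commute)
  have low: "x * ln (x / real k) \<ge> x - real k" if "x > 0" for x :: real
  proof -
    have "x * ln (real k / x) \<le> x * (real k / x - 1)"
      using that assms(1) by (intro mult_left_mono ln_le_minus_one) auto
    then show ?thesis using that assms(1) by (simp add: ln_div algebra_simps)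
  qed
  have x: "\<tau> * real n * ln n = \<tau> * real n * ln (\<tau> * real n / real k) + \<tau> * real n * ln k - \<tau> * real n * ln \<tau>"
    using th assms(1,2) by (simp add: ln_div ln_mult algebra_simps)
  have y: "\<theta> * real l * ln l \<ge> \<theta> * real l * ln k + (\<theta> * real l - real k)"
  proof (cases "l = 0")
    case False
    have "\<theta> * real l * ln l = \<theta> * real l * ln (\<theta> * real l / real k) + \<theta> * real l * ln k - \<theta> * real l * ln \<theta>"
      using th assms(1,2) False by (simp add: ln_div ln_mult algebra_simps)
    moreover have "\<theta> * real l * ln \<theta> \<le> 0"
      using th by (intro mult_nonneg_nonpos) auto
    ultimately show ?thesis using low[of "\<theta> * real l"] th False by simp
  qed simp
  have "real (k - l) * (- ln \<tau>) \<le> \<tau> * real n * (- ln \<tau>)"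
    unfolding kl using th by (intro mult_right_mono) auto
  moreover have "real k * ln k = \<theta> * real l * ln k + \<tau> * real n * ln k"
    by (subst k) (simp add: algebra_simps)
  moreover have "\<tau> * real n * ln (\<tau> * real n / real k) \<ge> \<tau> * real n - real k"
    using th assms(1,2) by (intro low) auto
  ultimately show ?thesis
    unfolding ln\<tau> using x y k unfolding mult_minus_right mult.assoc[symmetric] by linarith
qed

text \<open>For \<open>l < k < n\<close> the interpolation inequality is applied to the
  \<open>l\<close>-th derivative, with the orders \<open>k - l\<close> and \<open>n - l\<close>.
  After rescaling it is the chord condition that places a number below the minorant. Chords between
  arbitrary orders are needed because nothing is known about the shape of \<open>M\<close>.\<close>

lemma derivative_bounds_log_convex_minorant:
  assumes \<alpha>: "0 < \<alpha>" "\<alpha> \<le> 1"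
    and M: "\<And>j. M j > 0"
  defines "N \<equiv> \<lambda>i. gevrey_seq (1 - \<alpha>) i * M i"
  assumes lim: "filterlim (\<lambda>j. root j (N j)) at_top sequentially"
    and hol: "f holomorphic_on sector \<alpha>"
    and C: "C > 0" "h > 0"
    and f: "\<And>j z. z \<in> sector \<alpha> \<Longrightarrow> norm ((deriv ^^ j) f z) \<le> C * h ^ j * M j"
  shows "\<exists>C'>0. \<exists>h'>0. \<forall>j. \<forall>z\<in>sector \<alpha>. norm ((deriv ^^ j) f z) \<le>
    C' * h' ^ j * (gevrey_seq (\<alpha> - 1) j * log_convex_minorant N j)"
proof -
  define \<beta> where "\<beta> = 1 - \<alpha>"
  have \<beta>: "0 \<le> \<beta>" using \<alpha> by (simp add: \<beta>_def)
  have N: "N j > 0" for j using M gevrey_seq_pos by (simp add: N_def)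
  note props = log_convex_minorant_props[OF N lim]
  define K :: real where "K = 16 * exp 4"
  have K: "K \<ge> 1" unfolding K_def using one_le_exp_iff[of "4::real"] by linarith
  \<comment> \<open>\<open>K\<close> is the base in the interpolation inequality;
    \<open>exp \<beta>\<close> pays for the linear term of the entropy estimate.\<close>
  define H where "H = K * exp \<beta>"
  have H: "H \<ge> 1" using K \<beta> mult_mono[of 1 K 1 "exp \<beta>"] by (simp add: H_def)
  define c0 where "c0 = log_convex_minorant N 0"
  have c0: "c0 > 0" using props(2) by (simp add: c0_def)
  \<comment> \<open>The second summand serves the order 0, which lies on no chord: there the
    derivative is bounded by \<open>C * M 0\<close> and the minorant has the value
    \<open>c0\<close>.\<close>
  define C' where "C' = 2 * C + C * M 0 / c0"
  have bound: "norm ((deriv ^^ k) f w) \<le> C' * (h * H) ^ k * (gevrey_seq (\<alpha> - 1) k * log_convex_minorant N k)"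
    if w: "w \<in> sector \<alpha>" for k w
  proof (cases "k = 0")
    case True
    have "norm (f w) \<le> C * M 0" using f[OF w, of 0] by simp
    also have "\<dots> \<le> C' * c0" using C c0 by (simp add: C'_def algebra_simps)
    finally show ?thesis using True by (simp add: gevrey_seq_def c0_def)
  next
    case False
    define X where "X = norm ((deriv ^^ k) f w)"
    define v where "v = gevrey_seq \<beta> k * X / (2 * C * (h * H) ^ k)"
    have hk: "(h * H) ^ k > 0" using C H by simp
    have "v \<le> log_convex_minorant N k"
    proof (cases "X = 0")
      case True
      then show ?thesis using props(2)[of k] by (simp add: v_def)
    next
      case X: False
      have v0: "v > 0" using X C hk gevrey_seq_pos[of \<beta> k] by (simp add: v_def X_def)
      show ?thesis
      proof (rule le_log_convex_minorantI[OF N lim _ v0])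
        show "k > 0" using False by simp
        have "X \<le> 2 * C * (h * H) ^ k * M k"
        proof -
          have "X \<le> C * h ^ k * M k" using f[OF w] by (simp add: X_def)
          also have "\<dots> \<le> (2 * C) * (h * H) ^ k * M k"
            using C H M[of k] by (intro mult_mono power_mono) auto
          finally show ?thesis .
        qed
        then have "gevrey_seq \<beta> k * X \<le> gevrey_seq \<beta> k * (2 * C * (h * H) ^ k * M k)"
          using gevrey_seq_pos[of \<beta> k] by (intro mult_left_mono) auto
        then show "v \<le> N k" using C hk by (simp add: v_def N_def \<beta>_def divide_le_eq mult_ac)
      next
        fix l n assume ln: "l < k" "k < n"
        define \<theta> where "\<theta> = real (n - k) / real (n - l)"
        define \<tau> where "\<tau> = real (k - l) / real (n - l)"
        have th: "\<theta> + \<tau> = 1" "\<theta> \<ge> 0" "\<tau> \<ge> 0"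
          using chord_weights(1)[OF ln] by (auto simp: \<theta>_def \<tau>_def)
        have kth: "real k = real l * \<theta> + real n * \<tau>"
          using chord_weights(2)[OF ln] by (simp add: \<theta>_def \<tau>_def)
        define A where "A = C * h ^ l * M l"
        define B where "B = C * h ^ n * M n"
        have AB: "A > 0" "B > 0" using C M by (auto simp: A_def B_def)
        have "(deriv ^^ l) f holomorphic_on sector \<alpha>"
          using hol open_sector[OF \<alpha>] by (rule holomorphic_higher_deriv)
        moreover have "(deriv ^^ (n - l)) ((deriv ^^ l) f) = (deriv ^^ n) f"
          "(deriv ^^ (k - l)) ((deriv ^^ l) f) = (deriv ^^ k) f"
          using ln by (auto simp flip: funpow_add comp_apply[of "deriv ^^ _" "deriv ^^ _"])
        ultimately have "X \<le> 2 * K ^ (k - l) *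
            (real (n - l) / real (k - l)) powr (\<beta> * real (k - l)) * (A * (B / A) powr \<tau>)"
          using sector_derivative_interpolation[OF \<alpha>, of "(deriv ^^ l) f" A B "n - l" "k - l" w]
            f AB w ln unfolding X_def K_def \<beta>_def \<tau>_def A_def B_def by auto
        also have "\<dots> \<le> 2 * K ^ k * (real (n - l) / real (k - l)) powr (\<beta> * real (k - l)) * (A * (B / A) powr \<tau>)"
          using K AB by (intro mult_right_mono mult_left_mono power_increasing) auto
        finally have X1: "X \<le> 2 * K ^ k * (real (n - l) / real (k - l)) powr (\<beta> * real (k - l)) * (A * (B / A) powr \<tau>)" .
        have "ln (A * (B / A) powr \<tau>) = \<theta> * ln A + \<tau> * ln B"
          using AB th(1) by (simp add: ln_mult ln_powr ln_div algebra_simps flip: distrib_right)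
        also have "\<dots> = (\<theta> + \<tau>) * ln C + (real l * \<theta> + real n * \<tau>) * ln h + \<theta> * ln (M l) + \<tau> * ln (M n)"
          using C M[of l] M[of n] by (simp add: A_def B_def ln_mult ln_realpow algebra_simps)
        finally have lnAB: "ln (A * (B / A) powr \<tau>) = ln C + real k * ln h + \<theta> * ln (M l) + \<tau> * ln (M n)"
          using kth th by simp
        have "ln X \<le> ln (2 * K ^ k * (real (n - l) / real (k - l)) powr (\<beta> * real (k - l)) * (A * (B / A) powr \<tau>))"
          using X1 X AB K ln by (subst ln_le_cancel_iff) (auto simp: X_def)
        also have "\<dots> = ln 2 + real k * ln K + \<beta> * (real (k - l) * ln (real (n - l) / real (k - l))) + ln (A * (B / A) powr \<tau>)"
          using AB K ln by (simp add: ln_mult ln_realpow ln_powr)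
        finally have lnX: "ln X \<le> ln 2 + real k * ln K + \<beta> * (real (k - l) * ln (real (n - l) / real (k - l)))
           + ln C + real k * ln h + \<theta> * ln (M l) + \<tau> * ln (M n)"
          unfolding lnAB by simp
        have ent: "\<beta> * (real k * ln k + real (k - l) * ln (real (n - l) / real (k - l))) \<le>
           \<beta> * (real k + \<theta> * (real l * ln l) + \<tau> * (real n * ln n))"
          using entropy_bound[OF ln] \<beta> unfolding \<theta>_def \<tau>_def by (intro mult_left_mono)
        have "ln v = \<beta> * (real k * ln k) + ln X - (ln 2 + ln C + real k * (ln h + (ln K + \<beta>)))"
          using X C K hk gevrey_seq_pos[of \<beta> k]
          by (simp add: v_def ln_div ln_mult ln_gevrey_seq ln_realpow H_def X_def)
        also have "\<dots> \<le> \<theta> * (\<beta> * (real l * ln l) + ln (M l)) + \<tau> * (\<beta> * (real n * ln n) + ln (M n))"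
          using lnX ent by (simp add: algebra_simps)
        also have "\<dots> = \<theta> * ln (N l) + \<tau> * ln (N n)"
          using M gevrey_seq_pos by (simp add: N_def ln_mult ln_gevrey_seq \<beta>_def less_imp_neq[symmetric])
        also have "\<dots> = ln (N l powr \<theta> * N n powr \<tau>)"
          using N[of l] N[of n] by (simp add: ln_mult ln_powr)
        finally show "v \<le> N l powr (real (n - k) / real (n - l)) * N n powr (real (k - l) / real (n - l))"
          using v0 N[of l] N[of n] unfolding \<theta>_def \<tau>_def by (subst (asm) ln_le_cancel_iff) auto
      qed
    qed
    then have "gevrey_seq \<beta> k * X \<le> 2 * C * (h * H) ^ k * log_convex_minorant N k"
      using C hk by (simp add: v_def divide_le_eq mult_ac)
    then have "gevrey_seq (- \<beta>) k * (gevrey_seq \<beta> k * X) \<le> gevrey_seq (- \<beta>) k * (2 * C * (h * H) ^ k * log_convex_minorant N k)"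
      using gevrey_seq_pos[of "- \<beta>" k] by (intro mult_left_mono) auto
    then have "X \<le> 2 * C * ((h * H) ^ k * (gevrey_seq (\<alpha> - 1) k * log_convex_minorant N k))"
      using gevrey_seq_uminus[of \<beta> k] by (simp add: \<beta>_def mult_ac flip: mult.assoc[of "gevrey_seq (- \<beta>) k"])
    also have "\<dots> \<le> C' * ((h * H) ^ k * (gevrey_seq (\<alpha> - 1) k * log_convex_minorant N k))"
      using C c0 M[of 0] hk gevrey_seq_pos props(2)[of k]
      by (intro mult_right_mono mult_nonneg_nonneg) (auto simp: C'_def less_imp_le)
    finally show ?thesis by (simp add: X_def mult_ac)
  qed
  moreover have "C' > 0" using C c0 M[of 0] by (simp add: C'_def add_pos_pos)
  moreover have "h * H > 0" using C H by simp
  ultimately show ?thesis by blast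
qed

section \<open>An extremal kernel\<close>

lemma integrable_inverse_1_plus_square':
  "integrable lborel (\<lambda>y::real. inverse (1 + y\<^sup>2))"
  using integrable_inverse_1_plus_square by (simp add: set_integrable_def)

text \<open>Cauchy's theorem for a rectangle in terms of a primitive \<open>P\<close>: the truncated
  integrals over the two lines are differences of end values of \<open>P\<close>, so they differ by
  its increments along the horizontal segments at heights \<open>n\<close> and \<open>- n\<close>.
  The decay of \<open>G\<close> makes these vanish.\<close>

lemma vertical_line_integral_shift:
  fixes G :: "complex \<Rightarrow> complex"
  assumes hol: "G holomorphic_on {t. Re t > 0}" and c: "0 < a" "a \<le> b"
    and bnd: "\<And>t. a \<le> Re t \<Longrightarrow> Re t \<le> b \<Longrightarrow> norm (G t) \<le> K * inverse (1 + (Im t)\<^sup>2)"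
  shows "integrable lborel (\<lambda>y. G (Complex a y))"
    and "(LINT y|lborel. G (Complex a y)) = (LINT y|lborel. G (Complex b y))"
proof -
  have op: "open {t::complex. Re t > 0}" by (simp add: open_halfspace_Re_gt)
  have "convex {t::complex. Re t > 0}" by (simp add: convex_halfspace_Re_gt)
  then obtain P where P: "\<And>t. Re t > 0 \<Longrightarrow> (P has_field_derivative G t) (at t)"
    using holomorphic_convex_primitive'[OF _ op hol] at_within_open[OF _ op] by (metis mem_Collect_eq)
  have contG: "continuous_on {t. Re t > 0} G" using hol by (rule holomorphic_on_imp_continuous_on)
  have Kpos: "K \<ge> 0" using bnd[of "of_real a"] c order_trans[OF norm_ge_zero[of "G (of_real a)"]] by auto
  have cont: "continuous_on UNIV (\<lambda>y. G (Complex c y))" if "c > 0" for c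
    by (rule continuous_on_compose2[OF contG]) (use that in \<open>auto intro!: continuous_intros\<close>)
  have meas: "(\<lambda>y. G (Complex c y)) \<in> borel_measurable lborel" if "c > 0" for c
    using borel_measurable_continuous_onI[OF cont[OF that]] by simp
  have int: "integrable lborel (\<lambda>y. G (Complex c y))" if "a \<le> c" "c \<le> b" for c
  proof (rule Bochner_Integration.integrable_bound)
    show "integrable lborel (\<lambda>y. K * inverse (1 + y\<^sup>2))"
      by (intro integrable_mult_right integrable_inverse_1_plus_square')
    show "(\<lambda>y. G (Complex c y)) \<in> borel_measurable lborel" using that c by (intro meas) auto
    show "AE y in lborel. norm (G (Complex c y)) \<le> norm (K * inverse (1 + y\<^sup>2))"
      using bnd[of "Complex c _"] that Kpos by (intro AE_I2) (auto simp: abs_mult add_nonneg_nonneg)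
  qed
  show "integrable lborel (\<lambda>y. G (Complex a y))" using c by (intro int) auto
  have FTC: "(LINT y|lborel. indicator {- real n..real n} y *\<^sub>R G (Complex c y)) =
     - \<i> * P (Complex c n) - (- \<i> * P (Complex c (- real n)))" if "c > 0" for c n
  proof (rule integral_FTC_Icc)
    fix y :: real
    have "((\<lambda>y. - \<i> * P (Complex c y)) has_vector_derivative - \<i> * (\<i> * G (Complex c y))) (at y within {- real n..real n})"
    proof -
      have "((\<lambda>y. Complex c y) has_vector_derivative \<i>) (at y within {- real n..real n})"
        unfolding Complex_eq by (auto intro!: derivative_eq_intros)
      then have "((P \<circ> (\<lambda>y. Complex c y)) has_vector_derivative \<i> * G (Complex c y)) (at y within {- real n..real n})"
        by (rule field_vector_diff_chain_within) (use P[of "Complex c y"] that in \<open>auto intro: has_field_derivative_at_within\<close>)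
      then show ?thesis by (auto intro!: derivative_eq_intros simp: o_def)
    qed
    then show "((\<lambda>y. - \<i> * P (Complex c y)) has_vector_derivative G (Complex c y)) (at y within {- real n..real n})"
      by simp
  qed (use cont[OF that] in \<open>auto intro: continuous_on_subset\<close>)
  have lim: "(\<lambda>n. LINT y|lborel. indicator {- real n..real n} y *\<^sub>R G (Complex c y)) \<longlonglongrightarrow>
     (LINT y|lborel. G (Complex c y))" if "a \<le> c" "c \<le> b" for c
  proof (rule integral_dominated_convergence)
    show "integrable lborel (\<lambda>y. norm (G (Complex c y)))" using int[OF that] by (rule integrable_norm)
    show "(\<lambda>y. G (Complex c y)) \<in> borel_measurable lborel" using that c by (intro meas) auto
    then show "(\<lambda>y. indicator {- real n..real n} y *\<^sub>R G (Complex c y)) \<in> borel_measurable lborel" for n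
      by measurable
    show "AE y in lborel. (\<lambda>n. indicator {- real n..real n} y *\<^sub>R G (Complex c y)) \<longlonglongrightarrow> G (Complex c y)"
    proof (intro AE_I2 tendsto_eventually)
      fix y :: real
      obtain m where "\<bar>y\<bar> \<le> real m" using real_arch_simple by blast
      then have "indicator {- real n..real n} y *\<^sub>R G (Complex c y) = G (Complex c y)" if "n \<ge> m" for n
        using that by (auto simp: indicator_def abs_le_iff)
      then show "\<forall>\<^sub>F n in sequentially. indicator {- real n..real n} y *\<^sub>R G (Complex c y) = G (Complex c y)"
        unfolding eventually_sequentially by blast
    qed
    show "AE y in lborel. norm (indicator {- real n..real n} y *\<^sub>R G (Complex c y)) \<le> norm (G (Complex c y))" for n
      by (auto simp: indicator_def)
  qed
  have horiz: "norm (P (Complex b y) - P (Complex a y)) \<le> K * inverse (1 + y\<^sup>2) * (b - a)" for y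
  proof -
    have "norm (P (Complex b y) - P (Complex a y)) \<le> K * inverse (1 + y\<^sup>2) * norm (Complex b y - Complex a y)"
    proof (rule field_differentiable_bound)
      fix t assume "t \<in> closed_segment (Complex a y) (Complex b y)"
      then have t: "Im t = y" "a \<le> Re t" "Re t \<le> b"
        using c by (auto simp: closed_segment_same_Im closed_segment_eq_real_ivl)
      then show "(P has_field_derivative G t) (at t within closed_segment (Complex a y) (Complex b y))"
        using P[of t] c by (auto intro: has_field_derivative_at_within)
      show "norm (G t) \<le> K * inverse (1 + y\<^sup>2)" using bnd[of t] t by auto
    qed auto
    also have "Complex b y - Complex a y = of_real (b - a)" by (simp add: complex_eq_iff)
    finally show ?thesis using c by (simp only: norm_of_real abs_of_nonneg)
  qed
  have "(\<lambda>n. (LINT y|lborel. indicator {- real n..real n} y *\<^sub>R G (Complex b y)) -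
      (LINT y|lborel. indicator {- real n..real n} y *\<^sub>R G (Complex a y))) \<longlonglongrightarrow> 0"
  proof (rule Lim_null_comparison)
    show "\<forall>\<^sub>F n in sequentially. norm ((LINT y|lborel. indicator {- real n..real n} y *\<^sub>R G (Complex b y)) -
      (LINT y|lborel. indicator {- real n..real n} y *\<^sub>R G (Complex a y))) \<le> 2 * (K * inverse (1 + (real n)\<^sup>2) * (b - a))"
    proof (intro always_eventually allI)
      fix n
      have "(LINT y|lborel. indicator {- real n..real n} y *\<^sub>R G (Complex b y)) -
        (LINT y|lborel. indicator {- real n..real n} y *\<^sub>R G (Complex a y)) =
        - \<i> * (P (Complex b n) - P (Complex a n)) + \<i> * (P (Complex b (- real n)) - P (Complex a (- real n)))"
        using c by (simp add: FTC algebra_simps)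
      also have "norm \<dots> \<le> norm (P (Complex b n) - P (Complex a n)) + norm (P (Complex b (- real n)) - P (Complex a (- real n)))"
        by (rule order_trans[OF norm_triangle_ineq]) (simp add: norm_mult)
      also have "\<dots> \<le> 2 * (K * inverse (1 + (real n)\<^sup>2) * (b - a))"
        using horiz[of "real n"] horiz[of "- real n"] by simp
      finally show "norm ((LINT y|lborel. indicator {- real n..real n} y *\<^sub>R G (Complex b y)) -
        (LINT y|lborel. indicator {- real n..real n} y *\<^sub>R G (Complex a y))) \<le> 2 * (K * inverse (1 + (real n)\<^sup>2) * (b - a))" .
    qed
    have "(\<lambda>n. inverse (1 + (real n)\<^sup>2)) \<longlonglongrightarrow> 0" by real_asymp
    then have "(\<lambda>n. 2 * (K * inverse (1 + (real n)\<^sup>2) * (b - a))) \<longlonglongrightarrow> 2 * (K * 0 * (b - a))"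
      by (intro tendsto_intros)
    then show "(\<lambda>n. 2 * (K * inverse (1 + (real n)\<^sup>2) * (b - a))) \<longlonglongrightarrow> 0" by simp
  qed
  moreover have "(\<lambda>n. (LINT y|lborel. indicator {- real n..real n} y *\<^sub>R G (Complex b y)) -
      (LINT y|lborel. indicator {- real n..real n} y *\<^sub>R G (Complex a y))) \<longlonglongrightarrow>
      (LINT y|lborel. G (Complex b y)) - (LINT y|lborel. G (Complex a y))"
    using c by (intro tendsto_diff lim) auto
  ultimately show "(LINT y|lborel. G (Complex a y)) = (LINT y|lborel. G (Complex b y))"
    using LIMSEQ_unique by fastforce
qed

text \<open>After division by \<open>t powr (1 - \<alpha>)\<close> the second summand lies in the closed right half plane.\<close>

lemma kernel_denominator_bound:
  assumes \<alpha>: "0 < \<alpha>" "\<alpha> \<le> 1" and t: "Re t > 0" and z: "z \<in> csector \<alpha>"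
  shows "norm (t powr of_real (2 - \<alpha>) + z) \<ge> Re t * norm t powr (1 - \<alpha>)"
proof -
  define \<beta> where "\<beta> = 1 - \<alpha>"
  have t0: "t \<noteq> 0" using t by auto
  define u where "u = t powr of_real (- \<beta>)"
  have nu: "norm u = norm t powr (- \<beta>)" by (simp add: u_def norm_powr_real_powr')
  have "t powr of_real (2 - \<alpha>) * u = t powr (of_real (2 - \<alpha>) + of_real (- \<beta>))"
    unfolding u_def by (simp only: powr_add)
  also have "\<dots> = t" using t0 by (simp add: \<beta>_def)
  finally have tu: "t powr of_real (2 - \<alpha>) * u = t" .
  have "Re (z * u) \<ge> 0"
  proof (cases "z = 0")
    case False
    have "u = exp (Complex (- \<beta> * ln (norm t)) (- \<beta> * Arg t))"
    proof -
      have "Ln t = Complex (ln (norm t)) (Arg t)" using t0 by (simp add: Arg_eq_Im_Ln complex_eq_iff)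
      then have "u = exp (of_real (- \<beta>) * Complex (ln (norm t)) (Arg t))"
        using t0 by (simp add: u_def powr_def)
      also have "of_real (- \<beta>) * Complex (ln (norm t)) (Arg t) = Complex (- \<beta> * ln (norm t)) (- \<beta> * Arg t)"
        by (simp add: complex_eq_iff)
      finally show ?thesis .
    qed
    then have u: "Re u = norm u * cos (\<beta> * Arg t)" "Im u = - norm u * sin (\<beta> * Arg t)"
      by (simp_all add: Re_exp Im_exp)
    have "Re (z * u) = norm z * norm u * cos (Arg z - \<beta> * Arg t)"
      using Re_Im_polar[of z] u by (simp add: cos_diff algebra_simps)
    moreover have "cos (Arg z - \<beta> * Arg t) \<ge> 0"
    proof -
      have 1: "\<bar>Arg z\<bar> \<le> \<alpha> * pi / 2" by (rule csector_Arg[OF \<alpha> z])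
      have "\<bar>Arg t\<bar> \<le> pi / 2" using t Arg_Re_pos[of t] by auto
      then have "\<beta> * \<bar>Arg t\<bar> \<le> \<beta> * (pi / 2)" using \<alpha> by (intro mult_left_mono) (auto simp: \<beta>_def)
      moreover have "\<beta> * \<bar>Arg t\<bar> = \<bar>\<beta> * Arg t\<bar>" using \<alpha> by (simp add: abs_mult \<beta>_def)
      moreover have "\<alpha> * pi / 2 + \<beta> * (pi / 2) = pi / 2" by (simp add: \<beta>_def field_simps)
      ultimately have "\<bar>Arg z - \<beta> * Arg t\<bar> \<le> pi / 2" using 1 by linarith
      then show ?thesis by (intro cos_ge_zero) linarith+
    qed
    ultimately show ?thesis by simp
  qed simp
  then have "Re t \<le> Re ((t powr of_real (2 - \<alpha>) + z) * u)"
    by (simp only: distrib_right tu plus_complex.simps)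
  also have "\<dots> \<le> norm (t powr of_real (2 - \<alpha>) + z) * norm t powr (- \<beta>)"
    unfolding nu[symmetric] norm_mult[symmetric] by (rule complex_Re_le_cmod)
  finally have "Re t * norm t powr \<beta> \<le> norm (t powr of_real (2 - \<alpha>) + z) * norm t powr (- \<beta>) * norm t powr \<beta>"
    by (intro mult_right_mono) auto
  also have "\<dots> = norm (t powr of_real (2 - \<alpha>) + z)"
    using t0 by (simp add: mult.assoc flip: powr_add)
  finally show ?thesis unfolding \<beta>_def .
qed

text \<open>Up to the factor 2 * pi, a Bromwich integral for the inverse Laplace transform of 1 / (t
  powr (2 - \<alpha>) + z) ^ n at 1, that is, a Mittag-Leffler function with three parameters
  (Prabhakar function) at \<open>- z\<close>. Differentiation in \<open>z\<close> raises
  \<open>n\<close> by one and produces the factor \<open>- n\<close>. The abscissa \<open>c\<close>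
  remains free so that each estimate can choose its own line.\<close>

definition line_kernel :: "real \<Rightarrow> nat \<Rightarrow> complex \<Rightarrow> real \<Rightarrow> complex" where
  "line_kernel \<alpha> n z c =
     (LINT y|lborel. exp (Complex c y) / (Complex c y powr of_real (2 - \<alpha>) + z) ^ n)"

lemma kernel_denominator_ne:
  assumes "0 < \<alpha>" "\<alpha> \<le> 1" "Re t > 0" "z \<in> csector \<alpha>"
  shows "t powr of_real (2 - \<alpha>) + z \<noteq> 0"
proof -
  have "norm t > 0" using assms(3) by auto
  then have "Re t * norm t powr (1 - \<alpha>) > 0" using assms(3) by simp
  then show ?thesis using kernel_denominator_bound[OF assms] by auto
qed

text \<open>Of the \<open>n * (1 - \<alpha>)\<close> powers of \<open>norm t\<close> that the
  denominator supplies, two are spent on an integrable weight and the others are bounded below by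
  powers of \<open>Re t\<close>. Hence the condition on \<open>n\<close>.\<close>

lemma kernel_power_bound:
  assumes \<alpha>: "0 < \<alpha>" "\<alpha> \<le> 1" and t: "Re t \<ge> 1" and z: "z \<in> csector \<alpha>"
    and n: "real n * (1 - \<alpha>) \<ge> 2"
  shows "inverse (norm (t powr of_real (2 - \<alpha>) + z) ^ n) \<le>
    Re t powr (2 - real n * (2 - \<alpha>)) * inverse (1 + (Im t)\<^sup>2)"
proof -
  define c where "c = Re t"
  define \<beta> where "\<beta> = 1 - \<alpha>"
  have c: "c \<ge> 1" "norm t \<ge> c" "norm t > 0"
    using t complex_Re_le_cmod[of t] by (auto simp: c_def)
  have "c ^ n * (c powr (real n * \<beta> - 2) * (1 + (Im t)\<^sup>2)) \<le> c ^ n * (norm t powr (real n * \<beta> - 2) * (norm t)\<^sup>2)"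
  proof (intro mult_left_mono mult_mono powr_mono2)
    show "1 + (Im t)\<^sup>2 \<le> (norm t)\<^sup>2" using c(1) by (simp add: cmod_power2 c_def)
  qed (use c n in \<open>auto simp: \<beta>_def\<close>)
  also have "norm t powr (real n * \<beta> - 2) * (norm t)\<^sup>2 = norm t powr (real n * \<beta>)"
    using c(3) by (simp add: powr_diff)
  also have "c ^ n * norm t powr (real n * \<beta>) = (c * norm t powr \<beta>) ^ n"
    using c(3) by (simp add: power_mult_distrib powr_power mult.commute)
  also have "\<dots> \<le> norm (t powr of_real (2 - \<alpha>) + z) ^ n"
    using kernel_denominator_bound[OF \<alpha> _ z, of t] c
    by (intro power_mono) (auto simp: \<beta>_def c_def)
  finally have "inverse (norm (t powr of_real (2 - \<alpha>) + z) ^ n) \<le>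
      inverse (c ^ n * (c powr (real n * \<beta> - 2) * (1 + (Im t)\<^sup>2)))"
    using c by (intro le_imp_inverse_le mult_pos_pos) (auto simp: add_pos_nonneg)
  also have "c ^ n * (c powr (real n * \<beta> - 2) * (1 + (Im t)\<^sup>2)) = c powr (real n * (2 - \<alpha>) - 2) * (1 + (Im t)\<^sup>2)"
  proof -
    have "c ^ n * c powr (real n * \<beta> - 2) = c powr (real n + (real n * \<beta> - 2))"
      using c by (simp add: powr_add powr_realpow)
    also have "real n + (real n * \<beta> - 2) = real n * (2 - \<alpha>) - 2" by (simp add: \<beta>_def algebra_simps)
    finally show ?thesis by simp
  qed
  also have "inverse \<dots> = c powr (2 - real n * (2 - \<alpha>)) * inverse (1 + (Im t)\<^sup>2)"
    using powr_minus[of c "real n * (2 - \<alpha>) - 2"] by simp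
  finally show ?thesis by (simp add: c_def)
qed

lemma line_kernel_shift:
  assumes \<alpha>: "0 < \<alpha>" "\<alpha> \<le> 1" and z: "z \<in> csector \<alpha>" and n: "real n * (1 - \<alpha>) \<ge> 2" and c: "c \<ge> 1"
  shows "integrable lborel (\<lambda>y. exp (Complex c y) / (Complex c y powr of_real (2 - \<alpha>) + z) ^ n)"
    and "line_kernel \<alpha> n z c = line_kernel \<alpha> n z 1"
proof -
  define G where "G = (\<lambda>t. exp t / (t powr of_real (2 - \<alpha>) + z) ^ n)"
  have hol: "G holomorphic_on {t. Re t > 0}"
    unfolding G_def using kernel_denominator_ne[OF \<alpha> _ z]
    by (intro holomorphic_intros) (auto simp: complex_nonpos_Reals_iff)
  have n': "2 - real n * (2 - \<alpha>) \<le> 0" using n by (simp add: algebra_simps)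
  have bnd: "norm (G t) \<le> exp b * inverse (1 + (Im t)\<^sup>2)" if "1 \<le> Re t" "Re t \<le> b" for t b
  proof -
    have "norm (G t) = exp (Re t) * inverse (norm (t powr of_real (2 - \<alpha>) + z) ^ n)"
      by (simp add: G_def norm_mult norm_inverse norm_power divide_inverse)
    also have "\<dots> \<le> exp b * (Re t powr (2 - real n * (2 - \<alpha>)) * inverse (1 + (Im t)\<^sup>2))"
      using kernel_power_bound[OF \<alpha> that(1) z n] that by (intro mult_mono) auto
    also have "\<dots> \<le> exp b * (1 * inverse (1 + (Im t)\<^sup>2))"
    proof (intro mult_left_mono mult_right_mono)
      have "Re t powr (2 - real n * (2 - \<alpha>)) \<le> Re t powr 0" using that n' by (intro powr_mono) auto
      then show "Re t powr (2 - real n * (2 - \<alpha>)) \<le> 1" using that by simp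
    qed auto
    finally show ?thesis by simp
  qed
  show "integrable lborel (\<lambda>y. exp (Complex c y) / (Complex c y powr of_real (2 - \<alpha>) + z) ^ n)"
    using vertical_line_integral_shift(1)[OF hol, of c c "exp c"] bnd[of _ c] c unfolding G_def by auto
  show "line_kernel \<alpha> n z c = line_kernel \<alpha> n z 1"
    using vertical_line_integral_shift(2)[OF hol, of 1 c "exp c"] bnd[of _ c] c
    unfolding G_def line_kernel_def by auto
qed

text \<open>The integral is moved to the line \<open>Re t = n\<close>, which balances
  \<open>exp c\<close> against the decay in \<open>c\<close> up to factors geometric in
  \<open>n\<close>.\<close>

lemma line_kernel_upper_bound:
  assumes \<alpha>: "0 < \<alpha>" "\<alpha> \<le> 1" and z: "z \<in> csector \<alpha>" and n: "real n * (1 - \<alpha>) \<ge> 2"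
  shows "norm (line_kernel \<alpha> n z 1) \<le>
    exp (real n) * real n powr (2 - real n * (2 - \<alpha>)) * (LINT y|lborel. inverse (1 + y\<^sup>2))"
proof -
  have n1: "real n \<ge> 1" using n by (cases n) auto
  have "norm (line_kernel \<alpha> n z (real n)) \<le>
    (LINT y|lborel. norm (exp (Complex (real n) y) / (Complex (real n) y powr of_real (2 - \<alpha>) + z) ^ n))"
    unfolding line_kernel_def by (rule integral_norm_bound)
  also have "\<dots> \<le> (LINT y|lborel. exp (real n) * real n powr (2 - real n * (2 - \<alpha>)) * inverse (1 + y\<^sup>2))"
  proof (rule integral_mono)
    show "integrable lborel (\<lambda>y. norm (exp (Complex (real n) y) / (Complex (real n) y powr of_real (2 - \<alpha>) + z) ^ n))"
      by (intro integrable_norm line_kernel_shift \<alpha> z n n1)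
    show "integrable lborel (\<lambda>y. exp (real n) * real n powr (2 - real n * (2 - \<alpha>)) * inverse (1 + y\<^sup>2))"
      by (intro integrable_mult_right integrable_inverse_1_plus_square')
    fix y
    show "norm (exp (Complex (real n) y) / (Complex (real n) y powr of_real (2 - \<alpha>) + z) ^ n) \<le>
      exp (real n) * real n powr (2 - real n * (2 - \<alpha>)) * inverse (1 + y\<^sup>2)"
      using kernel_power_bound[OF \<alpha> _ z n, of "Complex (real n) y"] n1
      by (simp add: norm_mult norm_inverse norm_power divide_inverse mult.assoc)
  qed
  finally show ?thesis using line_kernel_shift(2)[OF \<alpha> z n n1] by simp
qed

text \<open>Explicit quadratic remainders, rather than mere derivatives, can be summed over a series
  of dilates and are valid up to the boundary and the vertex of the sector. The constant comes from
  integrating the majorant \<open>exp 1 * n * (n + 1) / (1 + y\<^sup>2)\<close> of the second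
  derivative of the integrand.\<close>

lemma line_kernel_quadratic_remainder:
  assumes \<alpha>: "0 < \<alpha>" "\<alpha> \<le> 1" and z: "z \<in> csector \<alpha>" and w: "w \<in> csector \<alpha>"
    and n: "real n * (1 - \<alpha>) \<ge> 2"
  shows "norm (line_kernel \<alpha> n w 1 - line_kernel \<alpha> n z 1 + (w - z) * (of_nat n * line_kernel \<alpha> (Suc n) z 1)) \<le>
    exp 1 * real n * (real n + 1) * (LINT y|lborel. inverse (1 + y\<^sup>2)) * (norm (w - z))\<^sup>2"
proof -
  define T where "T = (\<lambda>y. Complex 1 y powr of_real (2 - \<alpha>))"
  have ne: "T y + v \<noteq> 0" if "v \<in> csector \<alpha>" for y v
    using kernel_denominator_ne[OF \<alpha> _ that, of "Complex 1 y"] by (simp add: T_def)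
  have n2: "real (Suc n) * (1 - \<alpha>) \<ge> 2" "real (Suc (Suc n)) * (1 - \<alpha>) \<ge> 2"
    using n \<alpha> by (auto simp: algebra_simps)
  let ?e = "\<lambda>y. exp (Complex 1 y)"
  have i0: "integrable lborel (\<lambda>y. ?e y / (T y + v) ^ n)" if "v \<in> csector \<alpha>" for v
    unfolding T_def by (intro line_kernel_shift \<alpha> that n) simp
  have i1: "integrable lborel (\<lambda>y. ?e y / (T y + z) ^ Suc n)"
    unfolding T_def by (intro line_kernel_shift \<alpha> z n2) simp
  have pt: "norm (?e y / (T y + w) ^ n - ?e y / (T y + z) ^ n + (w - z) * (of_nat n * (?e y / (T y + z) ^ Suc n)))
      \<le> exp 1 * real n * (real n + 1) * (norm (w - z))\<^sup>2 * inverse (1 + y\<^sup>2)" for y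
  proof -
    define F where "F = (\<lambda>(i::nat) v. (if i = 0 then 1 / (T y + v) ^ n
      else if i = 1 then - of_nat n / (T y + v) ^ Suc n
      else of_nat n * (of_nat n + 1) / (T y + v) ^ Suc (Suc n)))"
    have "norm (F 0 w - (\<Sum>i\<le>1. F i z * (w - z) ^ i / fact i)) \<le>
      (real n * (real n + 1) * inverse (1 + y\<^sup>2)) * norm (w - z) ^ Suc 1 / fact 1"
    proof (rule complex_Taylor[OF convex_csector[OF \<alpha>] _ _ z w])
      fix i :: nat and v assume v: "v \<in> csector \<alpha>" "i \<le> 1"
      have der: "((\<lambda>v. inverse ((T y + v) ^ k)) has_field_derivative
          - of_nat k * inverse ((T y + v) ^ Suc k)) (at v within csector \<alpha>)" for k
      proof (cases k)
        case (Suc k')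
        have "((\<lambda>v. (T y + v) ^ k) has_field_derivative of_nat k * (T y + v) ^ k') (at v within csector \<alpha>)"
          unfolding Suc by (rule derivative_eq_intros refl)+ simp
        from DERIV_inverse'[OF this] have "((\<lambda>v. inverse ((T y + v) ^ k)) has_field_derivative
          - (inverse ((T y + v) ^ k) * (of_nat k * (T y + v) ^ k') * inverse ((T y + v) ^ k))) (at v within csector \<alpha>)"
          using ne[OF v(1)] by simp
        also have "- (inverse ((T y + v) ^ k) * (of_nat k * (T y + v) ^ k') * inverse ((T y + v) ^ k)) =
           - of_nat k * inverse ((T y + v) ^ Suc k)"
        proof -
          have "- (inverse (x ^ Suc k') * (c * x ^ k') * inverse (x ^ Suc k')) = - c * inverse (x ^ Suc (Suc k'))"
            if "x \<noteq> 0" for x c :: complex using that by (simp add: field_simps)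
          from this[OF ne[OF v(1)]] show ?thesis unfolding Suc .
        qed
        finally show ?thesis .
      qed auto
      show "(F i has_field_derivative F (Suc i) v) (at v within csector \<alpha>)"
      proof (cases "i = 0")
        case True
        then show ?thesis using der[of n] by (simp add: F_def divide_inverse)
      next
        case False
        then have "i = 1" using v by simp
        have "- of_nat n * (- of_nat (Suc n) * X) = of_nat n * (of_nat n + 1) * X" for X :: complex
          by (simp add: algebra_simps)
        moreover have "(of_nat (Suc n) :: complex) = of_nat n + 1" by simp
        ultimately show ?thesis
          using DERIV_cmult[OF der[of "Suc n"], of "- of_nat n"] \<open>i = 1\<close>
          by (simp add: F_def divide_inverse mult.assoc del: of_nat_Suc power_Suc)
      qed
    next
      fix v assume v: "v \<in> csector \<alpha>"
      have "inverse (norm (T y + v) ^ Suc (Suc n)) \<le> inverse (1 + y\<^sup>2)"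
        using kernel_power_bound[OF \<alpha> _ v n2(2), of "Complex 1 y"] by (simp add: T_def)
      then show "norm (F (Suc 1) v) \<le> real n * (real n + 1) * inverse (1 + y\<^sup>2)"
        by (auto simp: F_def norm_inverse norm_mult norm_power divide_inverse of_nat_Suc[symmetric] add.commute
            simp del: of_nat_Suc power_Suc intro!: mult_left_mono)
    qed
    then have "norm (1 / (T y + w) ^ n - 1 / (T y + z) ^ n + (w - z) * (of_nat n / (T y + z) ^ Suc n)) \<le>
      real n * (real n + 1) * inverse (1 + y\<^sup>2) * (norm (w - z))\<^sup>2"
      by (simp add: F_def power2_eq_square algebra_simps)
    then have "norm (?e y) * norm (1 / (T y + w) ^ n - 1 / (T y + z) ^ n + (w - z) * (of_nat n / (T y + z) ^ Suc n)) \<le>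
      exp 1 * (real n * (real n + 1) * inverse (1 + y\<^sup>2) * (norm (w - z))\<^sup>2)"
      by (intro mult_mono) auto
    also have "norm (?e y) * norm (1 / (T y + w) ^ n - 1 / (T y + z) ^ n + (w - z) * (of_nat n / (T y + z) ^ Suc n)) =
      norm (?e y / (T y + w) ^ n - ?e y / (T y + z) ^ n + (w - z) * (of_nat n * (?e y / (T y + z) ^ Suc n)))"
      unfolding norm_mult[symmetric] by (intro arg_cong[where f = norm]) (simp add: algebra_simps)
    finally show ?thesis by (simp add: mult_ac)
  qed
  let ?D = "\<lambda>y. ?e y / (T y + w) ^ n - ?e y / (T y + z) ^ n + (w - z) * (of_nat n * (?e y / (T y + z) ^ Suc n))"
  have iD: "integrable lborel ?D"
    by (intro Bochner_Integration.integrable_add Bochner_Integration.integrable_diff i0 z w integrable_mult_right i1)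
  have lk: "line_kernel \<alpha> k v 1 = (LINT y|lborel. ?e y / (T y + v) ^ k)" for k v
    by (simp only: line_kernel_def T_def)
  have D: "line_kernel \<alpha> n w 1 - line_kernel \<alpha> n z 1 + (w - z) * (of_nat n * line_kernel \<alpha> (Suc n) z 1) = (LINT y|lborel. ?D y)"
    by (simp only: lk Bochner_Integration.integral_add Bochner_Integration.integral_diff i0[OF z] i0[OF w] integrable_mult_right i1
        Bochner_Integration.integrable_diff integral_mult_right_zero)
  have "norm (LINT y|lborel. ?D y) \<le> (LINT y|lborel. norm (?D y))" by (rule integral_norm_bound)
  also have "\<dots> \<le> (LINT y|lborel. exp 1 * real n * (real n + 1) * (norm (w - z))\<^sup>2 * inverse (1 + y\<^sup>2))"
    by (rule integral_mono) (intro integrable_norm iD integrable_mult_right integrable_inverse_1_plus_square' pt)+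
  finally show ?thesis unfolding D by (simp add: mult_ac)
qed

section \<open>Sign and size of the kernel at the vertex\<close>

lemma line_kernel_zero_real: "c > 0 \<Longrightarrow> line_kernel \<alpha> n 0 c \<in> \<real>"
proof -
  assume c: "c > 0"
  let ?f = "\<lambda>y. exp (Complex c y) / (Complex c y powr of_real (2 - \<alpha>) + 0) ^ n"
  \<comment> \<open>Conjugation of the integrand is the reflection of \<open>y\<close>, which leaves
    the integral invariant.\<close>
  have "cnj (?f y) = ?f (- y)" for y
  proof -
    have "Complex c y \<notin> \<real>\<^sub>\<le>\<^sub>0" using c by (simp add: complex_nonpos_Reals_iff)
    then have "cnj (Complex c y powr of_real (2 - \<alpha>)) = cnj (Complex c y) powr of_real (2 - \<alpha>)"
      using c by (subst cnj_powr) auto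
    moreover have "cnj (Complex c y) = Complex c (- y)" by (simp add: complex_eq_iff)
    ultimately show ?thesis by (simp only: complex_cnj_divide complex_cnj_power exp_cnj add_0_right)
  qed
  moreover have "cnj (line_kernel \<alpha> n 0 c) = (LINT y|lborel. cnj (?f y))"
    unfolding line_kernel_def by (rule Bochner_Integration.integral_cnj[symmetric])
  ultimately have "cnj (line_kernel \<alpha> n 0 c) = (LINT y|lborel. ?f (- y))" by (simp only:)
  also have "\<dots> = line_kernel \<alpha> n 0 c"
    unfolding line_kernel_def using lborel_integral_real_affine[of "-1" ?f 0] by simp
  finally show ?thesis by (simp add: Reals_cnj_iff)
qed

text \<open>The weighted inequality of arithmetic and geometric means with weights 2 / s and 1 - 2 /
  s. It supplies a majorant independent of \<open>s\<close> for dominated convergence.\<close>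

lemma one_plus_sq_powr_lower: "1 + v\<^sup>2 / 2 \<le> (1 + v\<^sup>2 / s) powr (s / 2)" if "s \<ge> 2" for s v :: real
proof -
  have p: "1 + v\<^sup>2 / 2 > 0" by (simp add: add_pos_nonneg)
  have "(1 + v\<^sup>2 / 2) powr (2 / s) * 1 powr (1 - 2 / s) \<le> (2 / s) * (1 + v\<^sup>2 / 2) + (1 - 2 / s) * 1"
    using that p by (intro Youngs_inequality_0) auto
  also have "\<dots> = 1 + v\<^sup>2 / s" using that by (simp add: field_simps)
  finally have "((1 + v\<^sup>2 / 2) powr (2 / s)) powr (s / 2) \<le> (1 + v\<^sup>2 / s) powr (s / 2)"
    using that by (intro powr_mono2) auto
  then show ?thesis using that p by (simp add: powr_powr)
qed

text \<open>Laplace's method on the line \<open>Re t = s\<close> through the saddle point of \<open>exp t * t powr (- s)\<close>,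
  in the variable \<open>v = Im t / sqrt s\<close>.\<close>

lemma saddle_point_limit:
  fixes s :: "nat \<Rightarrow> real"
  assumes s: "filterlim s at_top sequentially" "\<And>n. s n \<ge> 2"
  shows "(\<lambda>n. LINT v|lborel. (1 + v\<^sup>2 / s n) powr (- s n / 2) * cos (sqrt (s n) * v - s n * arctan (v / sqrt (s n))))
     \<longlonglongrightarrow> sqrt (2 * pi)"
proof -
  have "(\<lambda>n. LINT v|lborel. (1 + v\<^sup>2 / s n) powr (- s n / 2) * cos (sqrt (s n) * v - s n * arctan (v / sqrt (s n))))
     \<longlonglongrightarrow> (LINT v|lborel. exp (- v\<^sup>2 / 2))"
  proof (rule integral_dominated_convergence)
    show "integrable lborel (\<lambda>v::real. 2 * inverse (1 + v\<^sup>2))"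
      by (intro integrable_mult_right integrable_inverse_1_plus_square')
    show "(\<lambda>v. (1 + v\<^sup>2 / s n) powr (- s n / 2) * cos (sqrt (s n) * v - s n * arctan (v / sqrt (s n)))) \<in> borel_measurable lborel" for n
    proof -
      have "continuous_on UNIV (\<lambda>v. (1 + v\<^sup>2 / s n) powr (- s n / 2) * cos (sqrt (s n) * v - s n * arctan (v / sqrt (s n))))"
      proof (intro continuous_intros ballI)
        fix v :: real
        have "0 \<le> v\<^sup>2 / s n" using s(2)[of n] by simp
        then show "1 + v\<^sup>2 / s n \<noteq> 0" by linarith
      qed (use s(2)[of n] in auto)
      from borel_measurable_continuous_onI[OF this] show ?thesis by simp
    qed
    show "AE v in lborel. norm ((1 + v\<^sup>2 / s n) powr (- s n / 2) * cos (sqrt (s n) * v - s n * arctan (v / sqrt (s n)))) \<le> 2 * inverse (1 + v\<^sup>2)" for n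
    proof (rule AE_I2)
      fix v :: real
      have p: "1 + v\<^sup>2 / 2 > 0" by (simp add: add_pos_nonneg)
      have "norm ((1 + v\<^sup>2 / s n) powr (- s n / 2) * cos (sqrt (s n) * v - s n * arctan (v / sqrt (s n)))) \<le> (1 + v\<^sup>2 / s n) powr (- s n / 2) * 1"
        unfolding norm_mult by (intro mult_mono) auto
      also have "\<dots> = inverse ((1 + v\<^sup>2 / s n) powr (s n / 2))" by (simp add: powr_minus)
      also have "\<dots> \<le> inverse (1 + v\<^sup>2 / 2)"
        using one_plus_sq_powr_lower[OF s(2)[of n], of v] p by (intro le_imp_inverse_le) auto
      also have "\<dots> = 2 * inverse (2 + v\<^sup>2)"
      proof -
        have "2 + v\<^sup>2 \<noteq> 0" by (smt (verit) zero_le_power2)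
        then show ?thesis using p by (simp add: field_simps)
      qed
      also have "\<dots> \<le> 2 * inverse (1 + v\<^sup>2)"
        by (intro mult_left_mono le_imp_inverse_le) (auto simp: add_pos_nonneg)
      finally show "norm ((1 + v\<^sup>2 / s n) powr (- s n / 2) * cos (sqrt (s n) * v - s n * arctan (v / sqrt (s n)))) \<le> 2 * inverse (1 + v\<^sup>2)" .
    qed
    show "AE v in lborel. (\<lambda>n. (1 + v\<^sup>2 / s n) powr (- s n / 2) * cos (sqrt (s n) * v - s n * arctan (v / sqrt (s n)))) \<longlonglongrightarrow> exp (- v\<^sup>2 / 2)"
    proof (rule AE_I2)
      fix v :: real
      have 1: "((\<lambda>x. (1 + v\<^sup>2 / x) powr (- x / 2)) \<longlongrightarrow> exp (- v\<^sup>2 / 2)) at_top"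
        by real_asymp
      \<comment> \<open>The phase vanishes in the limit because arctan deviates from the identity
        only to third order at 0.\<close>
      have 2: "((\<lambda>x. sqrt x * v - x * arctan (v / sqrt x)) \<longlongrightarrow> 0) at_top"
      proof -
        consider "v = 0" | "v > 0" | "v < 0" by linarith
        then show ?thesis by cases (simp, real_asymp, real_asymp)
      qed
      have "((\<lambda>x. (1 + v\<^sup>2 / x) powr (- x / 2) * cos (sqrt x * v - x * arctan (v / sqrt x))) \<longlongrightarrow> exp (- v\<^sup>2 / 2) * cos 0) at_top"
        by (intro tendsto_mult 1 tendsto_cos 2)
      from filterlim_compose[OF this s(1)]
      show "(\<lambda>n. (1 + v\<^sup>2 / s n) powr (- s n / 2) * cos (sqrt (s n) * v - s n * arctan (v / sqrt (s n)))) \<longlonglongrightarrow> exp (- v\<^sup>2 / 2)"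
        by simp
    qed
  qed auto
  also have "(LINT v|lborel. exp (- v\<^sup>2 / 2)) = sqrt (2 * pi)"
  proof -
    have "(LINT v|lborel. normal_density 0 1 v) = 1" by (rule integral_normal_density) simp
    then have "sqrt (2 * pi) = (LINT v|lborel. exp (- v\<^sup>2 / 2))"
      by (simp add: normal_density_def)
    then show ?thesis by simp
  qed
  finally show ?thesis .
qed

text \<open>At \<open>z = 0\<close> the integrand is \<open>exp t * t powr (- x)\<close> with
  \<open>x = n * (2 - \<alpha>)\<close>, so the kernel is 2 * pi / Gamma x. On the line
  \<open>Re t = x\<close> it equals \<open>x powr (- x) * exp x * sqrt x\<close> times a factor with
  limit \<open>sqrt (2 * pi)\<close>; the factors that exceed 1 are dropped.\<close>

lemma line_kernel_lower_bound:
  assumes \<alpha>: "0 < \<alpha>" "\<alpha> < 1"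
  shows "eventually (\<lambda>n. Re (line_kernel \<alpha> n 0 1) \<ge> (real n * (2 - \<alpha>)) powr (- (real n * (2 - \<alpha>)))) sequentially"
proof -
  define s where "s = (\<lambda>n. real n * (2 - \<alpha>))"
  \<comment> \<open>The cut-off provides the lower bound 2 at every index and is inactive from some
    index on.\<close>
  define s' where "s' = (\<lambda>n. max 2 (s n))"
  define I where "I = (\<lambda>s. LINT v|lborel. (1 + v\<^sup>2 / s) powr (- s / 2) * cos (sqrt s * v - s * arctan (v / sqrt s)))"
  have s: "filterlim s at_top sequentially" unfolding s_def using \<alpha> by real_asymp
  then have "filterlim s' at_top sequentially"
    by (rule filterlim_at_top_mono) (auto simp: s'_def)
  then have "(\<lambda>n. I (s' n)) \<longlonglongrightarrow> sqrt (2 * pi)"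
    unfolding I_def by (rule saddle_point_limit) (simp add: s'_def)
  moreover have "sqrt (2 * pi) > 1" using pi_gt3 by simp
  ultimately have "eventually (\<lambda>n. I (s' n) > 1) sequentially" by (rule order_tendstoD)
  moreover have "eventually (\<lambda>n. s n \<ge> 2) sequentially" using s by (simp add: filterlim_at_top)
  moreover have "eventually (\<lambda>n. real n * (1 - \<alpha>) \<ge> 2) sequentially" using \<alpha> by real_asymp
  ultimately show ?thesis
  proof eventually_elim
    case (elim n)
    define x where "x = s n"
    have x: "x \<ge> 2" "I x > 1" using elim by (auto simp: x_def s'_def max_def)
    let ?f = "\<lambda>y. exp (Complex x y) / (Complex x y powr of_real (2 - \<alpha>) + 0) ^ n"
    have Re_f: "Re (?f (sqrt x * v)) = exp x * x powr (- x) *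
      ((1 + v\<^sup>2 / x) powr (- x / 2) * cos (sqrt x * v - x * arctan (v / sqrt x)))" for v
    proof -
      define t where "t = Complex x (sqrt x * v)"
      have "Re t > 0" using x by (simp add: t_def)
      then have t0: "t \<noteq> 0" by auto
      have q: "1 + v\<^sup>2 / x > 0" using x by (simp add: add_pos_nonneg)
      have "(norm t)\<^sup>2 = x\<^sup>2 * (1 + v\<^sup>2 / x)"
        unfolding t_def cmod_power2 using x by (simp add: power_mult_distrib field_simps power2_eq_square)
      then have "ln ((norm t)\<^sup>2) = 2 * ln x + ln (1 + v\<^sup>2 / x)"
        using x q by (simp add: ln_mult ln_realpow)
      then have "ln (norm t) = ln x + ln (1 + v\<^sup>2 / x) / 2" using t0 by (simp add: ln_realpow)
      moreover have "Im (Ln t) = arctan (v / sqrt x)"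
      proof -
        have "Im (Ln t) = arctan (Im t / Re t)" using \<open>Re t > 0\<close> Im_Ln_eq[OF t0] by simp
        also have "Im t / Re t = v / sqrt x"
          using x real_div_sqrt[of x] by (simp add: t_def field_simps)
        finally show ?thesis .
      qed
      ultimately have L: "Ln t = Complex (ln x + ln (1 + v\<^sup>2 / x) / 2) (arctan (v / sqrt x))"
        using t0 by (simp add: complex_eq_iff)
      have "(t powr of_real (2 - \<alpha>)) ^ n = exp (of_real x * Ln t)"
        using t0 by (simp add: powr_def x_def s_def mult_ac flip: exp_of_nat_mult)
      then have "?f (sqrt x * v) = exp (t - of_real x * Ln t)"
        by (simp add: t_def[symmetric] exp_diff)
      also have "t - of_real x * Ln t = Complex (x - x * (ln x + ln (1 + v\<^sup>2 / x) / 2)) (sqrt x * v - x * arctan (v / sqrt x))"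
        unfolding L by (simp add: t_def complex_eq_iff)
      also have "Re (exp \<dots>) = exp (x - x * ln x - x * ln (1 + v\<^sup>2 / x) / 2) * cos (sqrt x * v - x * arctan (v / sqrt x))"
        by (simp add: Re_exp algebra_simps)
      also have "exp (x - x * ln x - x * ln (1 + v\<^sup>2 / x) / 2) = exp x * x powr (- x) * (1 + v\<^sup>2 / x) powr (- x / 2)"
        using x q by (simp add: powr_def flip: exp_add)
      finally show ?thesis by simp
    qed
    have "line_kernel \<alpha> n 0 1 = line_kernel \<alpha> n 0 x"
      using line_kernel_shift(2)[of \<alpha> 0 n x] \<alpha> elim x by simp
    moreover have "Re (line_kernel \<alpha> n 0 x) = (LINT y|lborel. Re (?f y))"
      unfolding line_kernel_def using line_kernel_shift(1)[of \<alpha> 0 n x] \<alpha> elim x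
      by (intro integral_Re[symmetric]) auto
    moreover have "(LINT y|lborel. Re (?f y)) = sqrt x * (LINT v|lborel. Re (?f (sqrt x * v)))"
      using lborel_integral_real_affine[of "sqrt x" "\<lambda>y. Re (?f y)" 0] x by simp
    moreover have "(LINT v|lborel. Re (?f (sqrt x * v))) = exp x * x powr (- x) * I x"
      unfolding Re_f I_def by (rule integral_mult_right_zero)
    ultimately have "Re (line_kernel \<alpha> n 0 1) = x powr (- x) * (sqrt x * exp x * I x)" by simp
    also have "\<dots> \<ge> x powr (- x) * (1 * 1 * 1)"
      using x by (intro mult_left_mono mult_mono) auto
    finally show ?case by (simp add: x_def s_def)
  qed
qed

text \<open>The \<open>j\<close>-th derivative of the kernel carries the exponent
  \<open>m + j\<close>. Replacing \<open>(m + j) ^ (m + j)\<close> by \<open>j ^ j\<close> thus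
  costs only a factor geometric in \<open>j\<close>.\<close>

lemma shifted_power_bound:
  "real (m + j) ^ (m + j) \<le> (fact m * exp (2 * real m)) * exp 1 ^ j * real j ^ j"
proof -
  have 1: "real (m + j) ^ m \<le> exp (real m) * exp 1 ^ j * fact m"
    using power_le_exp_fact[of "real (m + j)" m] by (simp add: exp_add flip: exp_of_nat_mult)
  have 2: "real (m + j) ^ j \<le> exp (real m) * real j ^ j"
  proof (cases "j = 0")
    case False
    have "1 + real m / real j \<le> exp (real m / real j)" by (rule exp_ge_add_one_self)
    then have "(1 + real m / real j) ^ j \<le> exp (real m / real j) ^ j" by (intro power_mono) auto
    also have "\<dots> = exp (real m)" using False by (simp flip: exp_of_nat_mult)
    finally have "(1 + real m / real j) ^ j * real j ^ j \<le> exp (real m) * real j ^ j"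
      by (intro mult_right_mono) auto
    moreover have "(1 + real m / real j) * real j = real (m + j)" using False by (simp add: field_simps)
    ultimately show ?thesis by (simp flip: power_mult_distrib)
  qed simp
  have "real (m + j) ^ m * real (m + j) ^ j \<le> (exp (real m) * exp 1 ^ j * fact m) * (exp (real m) * real j ^ j)"
    using 1 2 by (intro mult_mono) auto
  also have "\<dots> = (fact m * (exp (real m) * exp (real m))) * exp 1 ^ j * real j ^ j" by simp
  also have "exp (real m) * exp (real m) = exp (2 * real m)" by (simp flip: exp_add)
  finally show ?thesis by (simp only: power_add)
qed

lemma powr_of_self_power: "x > 0 \<Longrightarrow> (x ^ k) powr y = x powr (real k * y)" for x y :: real
  using powr_powr[of x "real k" y] powr_realpow[of x k] by simp

lemma gevrey_seq_eq_powr: "gevrey_seq a j = (real j ^ j) powr a"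
  by (cases "j = 0") (simp_all add: gevrey_seq_def powr_of_self_power)

text \<open>Derivatives of a function on the closed sector that are extremal for the weight
  \<open>j\<^bsup>j(\<alpha>-1)\<^esup>\<close>: for \<open>\<alpha> = 1\<close> take \<open>exp (- z)\<close>, otherwise a function of Mittag-Leffler type.\<close>

lemma extremal_kernel_exists:
  assumes \<alpha>: "0 < \<alpha>" "\<alpha> \<le> 1"
  obtains e :: "nat \<Rightarrow> complex \<Rightarrow> complex" and A h a b :: real and B :: "nat \<Rightarrow> real"
  where "A > 0" "h > 0" "a > 0" "b > 0"
    and "\<And>j z. z \<in> csector \<alpha> \<Longrightarrow> norm (e j z) \<le> A * h ^ j * gevrey_seq (\<alpha> - 1) j"
    and "\<And>j z w. z \<in> csector \<alpha> \<Longrightarrow> w \<in> csector \<alpha> \<Longrightarrow>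
           norm (e j w - e j z - (w - z) * e (Suc j) z) \<le> B j * (norm (w - z))\<^sup>2"
    and "\<And>j. (- 1) ^ j * e j 0 \<in> \<real>"
    and "\<And>j. Re ((- 1) ^ j * e j 0) \<ge> a * b ^ j * gevrey_seq (\<alpha> - 1) j"
proof (cases "\<alpha> = 1")
  case True
  \<comment> \<open>The line integrals require \<open>n * (1 - \<alpha>) \<ge> 2\<close>, so
    \<alpha> = 1 is a case of its own; the weight is then constantly 1.\<close>
  define e where "e = (\<lambda>(j::nat) z::complex. (- 1) ^ j * exp (- z))"
  have bnd: "norm (e j z) \<le> 1" if "z \<in> csector \<alpha>" for j z
    using csector_Re_nonneg[OF that \<alpha>] by (simp add: e_def norm_mult norm_power)
  have g: "gevrey_seq (\<alpha> - 1) j = 1" for j using True by (simp add: gevrey_seq_def)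
  show ?thesis
  proof (rule that[of 1 1 1 1 e "\<lambda>_. 1"])
    fix j z w assume zw: "z \<in> csector \<alpha>" "w \<in> csector \<alpha>"
    have "norm (e (j + 0) w - (\<Sum>i\<le>1. e (j + i) z * (w - z) ^ i / fact i)) \<le> 1 * norm (w - z) ^ Suc 1 / fact 1"
    proof (rule complex_Taylor[OF convex_csector[OF \<alpha>] _ _ zw])
      fix i :: nat and x :: complex
      show "(e (j + i) has_field_derivative e (j + Suc i) x) (at x within csector \<alpha>)"
        unfolding e_def by (auto intro!: derivative_eq_intros)
    qed (use bnd in auto)
    then show "norm (e j w - e j z - (w - z) * e (Suc j) z) \<le> 1 * (norm (w - z))\<^sup>2"
      by (simp add: power2_eq_square algebra_simps)
  qed (use bnd g in \<open>auto simp: e_def simp flip: mult.assoc power_add\<close>)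
next
  case False
  then have \<alpha>1: "\<alpha> < 1" using \<alpha> by simp
  define \<beta> where "\<beta> = 1 - \<alpha>"
  have \<beta>: "0 < \<beta>" "\<beta> < 1" using \<alpha> \<alpha>1 by (auto simp: \<beta>_def)
  \<comment> \<open>The exponent of the undifferentiated kernel, large enough for absolute
    convergence and for the lower bound at the vertex at this and all later exponents.\<close>
  obtain m where m: "m \<ge> 1" "real m * (1 - \<alpha>) \<ge> 2"
    and low: "\<And>n. n \<ge> m \<Longrightarrow> Re (line_kernel \<alpha> n 0 1) \<ge> (real n * (2 - \<alpha>)) powr (- (real n * (2 - \<alpha>)))"
  proof -
    have "eventually (\<lambda>n. real n * (1 - \<alpha>) \<ge> 2) sequentially" using \<alpha>1 by real_asymp
    with line_kernel_lower_bound[OF \<alpha>(1) \<alpha>1] eventually_ge_at_top[of 1]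
    have "eventually (\<lambda>n. Re (line_kernel \<alpha> n 0 1) \<ge> (real n * (2 - \<alpha>)) powr (- (real n * (2 - \<alpha>)))
       \<and> n \<ge> 1 \<and> real n * (1 - \<alpha>) \<ge> 2) sequentially"
      by eventually_elim auto
    then show ?thesis using that unfolding eventually_sequentially by blast
  qed
  have nb: "real (m + j) * (1 - \<alpha>) \<ge> 2" for j
    using m(2) \<alpha>1 by (simp add: distrib_right add_increasing2)
  \<comment> \<open>The \<open>j\<close>-th derivative of the kernel with exponent \<open>m\<close>:
    the factors \<open>- m\<close>, \<open>- (m + 1)\<close>, ... collect into a sign and a
    Pochhammer symbol.\<close>
  define e where "e = (\<lambda>j z. (- 1) ^ j * pochhammer (of_nat m) j * line_kernel \<alpha> (m + j) z 1)"
  define I where "I = (LINT y|lborel. inverse (1 + y\<^sup>2) :: real)"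
  define A where "A = 2 * exp (2 * real m) * I + 1"
  define D where "D = fact m * exp (2 * real m)"
  define B where "B = (\<lambda>j. pochhammer (real m) j * (exp 1 * real (m + j) * (real (m + j) + 1) * I))"
  have I: "I \<ge> 0" unfolding I_def by (intro Bochner_Integration.integral_nonneg) (auto simp: add_nonneg_nonneg)
  have D: "D \<ge> 1"
    unfolding D_def using mult_mono[of 1 "fact m" 1 "exp (2 * real m)"] by (simp add: fact_ge_1)
  have poch_norm: "norm (pochhammer (of_nat m :: complex) j) = pochhammer (real m) j" for j
    by (simp add: pochhammer_of_nat)
  have poch_pos: "pochhammer (real m) j > 0" for j using m by (intro pochhammer_pos) auto
  have g: "gevrey_seq (\<alpha> - 1) j = (real j ^ j) powr (- \<beta>)" for j by (simp add: gevrey_seq_eq_powr \<beta>_def)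
  show ?thesis
  proof (rule that[of A "exp 2" "inverse (4 ^ m * D\<^sup>2)" "inverse (4 * exp 3)" e B])
    show "A > 0" using I by (simp add: A_def add_nonneg_pos)
    show "0 < inverse (4 ^ m * D\<^sup>2)" using D by simp
  next
    fix j z assume z: "z \<in> csector \<alpha>"
    define n where "n = m + j"
    have n: "real n \<ge> 1" using m by (simp add: n_def)
    have "pochhammer (real m) j \<le> real n ^ j"
    proof -
      have "pochhammer (real m) j \<le> (\<Prod>i = 0..<j. real n)"
        unfolding pochhammer_prod by (intro prod_mono) (auto simp: n_def)
      then show ?thesis by simp
    qed
    moreover have "norm (line_kernel \<alpha> n z 1) \<le> exp (real n) * real n powr (2 - real n * (2 - \<alpha>)) * I"
      unfolding I_def n_def by (rule line_kernel_upper_bound[OF \<alpha> z nb])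
    moreover have "norm (e j z) = pochhammer (real m) j * norm (line_kernel \<alpha> n z 1)"
      unfolding e_def norm_mult poch_norm n_def[symmetric] by (simp add: norm_power)
    ultimately have "norm (e j z) \<le> real n ^ j * (exp (real n) * real n powr (2 - real n * (2 - \<alpha>)) * I)"
      using poch_pos[of j] by (simp only:) (intro mult_mono, auto)
    also have "\<dots> = exp (real n) * I * (real n ^ j * real n powr (2 - real n * (2 - \<alpha>)))" by simp
    also have "\<dots> \<le> exp (real n) * I * (2 * exp (real n) * gevrey_seq (\<alpha> - 1) j)"
    proof (intro mult_left_mono)
      have "real n ^ j * real n powr (2 - real n * (2 - \<alpha>)) = real n powr (real j + (2 - real n * (2 - \<alpha>)))"
        using n by (simp add: powr_add powr_realpow)
      also have "\<dots> \<le> real n powr (2 + real n * (- \<beta>))"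
        using n by (intro powr_mono) (auto simp: n_def \<beta>_def algebra_simps)
      also have "\<dots> = real n ^ 2 * (real n ^ n) powr (- \<beta>)"
        using n powr_add[of "real n" 2 "real n * (- \<beta>)"] by (simp add: powr_of_self_power)
      also have "\<dots> \<le> (2 * exp (real n)) * (real j ^ j) powr (- \<beta>)"
      proof (intro mult_mono)
        show "real n ^ 2 \<le> 2 * exp (real n)" using power_le_exp_fact[of "real n" 2] by (simp add: fact_2 mult.commute)
        show "(real n ^ n) powr (- \<beta>) \<le> (real j ^ j) powr (- \<beta>)"
        proof (rule powr_mono2')
          show "real j ^ j > 0" by (cases "j = 0") auto
          have "real j ^ j \<le> real n ^ j" by (intro power_mono) (auto simp: n_def)
          also have "\<dots> \<le> real n ^ n" using n by (intro power_increasing) (auto simp: n_def)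
          finally show "real j ^ j \<le> real n ^ n" .
        qed (use \<beta> in auto)
      qed auto
      finally show "real n ^ j * real n powr (2 - real n * (2 - \<alpha>)) \<le> 2 * exp (real n) * gevrey_seq (\<alpha> - 1) j"
        by (simp add: g)
    qed (use I in auto)
    also have "\<dots> = 2 * (exp (real n) * exp (real n)) * I * gevrey_seq (\<alpha> - 1) j" by simp
    also have "exp (real n) * exp (real n) = exp (2 * real m) * exp 2 ^ j"
      by (simp add: n_def algebra_simps flip: exp_add exp_of_nat_mult)
    also have "2 * (exp (2 * real m) * exp 2 ^ j) * I * gevrey_seq (\<alpha> - 1) j = (2 * exp (2 * real m) * I) * (exp 2 ^ j * gevrey_seq (\<alpha> - 1) j)"
      by simp
    also have "\<dots> \<le> A * (exp 2 ^ j * gevrey_seq (\<alpha> - 1) j)"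
      unfolding A_def using gevrey_seq_pos[of "\<alpha> - 1" j] by (intro mult_right_mono) auto
    finally show "norm (e j z) \<le> A * exp 2 ^ j * gevrey_seq (\<alpha> - 1) j" by simp
  next
    fix j z w assume zw: "z \<in> csector \<alpha>" "w \<in> csector \<alpha>"
    let ?n = "m + j"
    have "e j w - e j z - (w - z) * e (Suc j) z = ((- 1) ^ j * pochhammer (of_nat m) j) *
      (line_kernel \<alpha> ?n w 1 - line_kernel \<alpha> ?n z 1 + (w - z) * (of_nat ?n * line_kernel \<alpha> (Suc ?n) z 1))"
      by (simp add: e_def pochhammer_rec' algebra_simps)
    also have "norm \<dots> = pochhammer (real m) j *
      norm (line_kernel \<alpha> ?n w 1 - line_kernel \<alpha> ?n z 1 + (w - z) * (of_nat ?n * line_kernel \<alpha> (Suc ?n) z 1))"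
      by (simp only: norm_mult norm_power poch_norm) simp
    also have "\<dots> \<le> pochhammer (real m) j * (exp 1 * real ?n * (real ?n + 1) * I * (norm (w - z))\<^sup>2)"
      unfolding I_def using poch_pos[of j] by (intro mult_left_mono line_kernel_quadratic_remainder \<alpha> zw nb) auto
    finally show "norm (e j w - e j z - (w - z) * e (Suc j) z) \<le> B j * (norm (w - z))\<^sup>2"
      by (simp add: B_def mult_ac)
  next
    fix j
    define n where "n = m + j"
    have n: "real n \<ge> 1" using m by (simp add: n_def)
    have e0: "(- 1) ^ j * e j 0 = of_real (pochhammer (real m) j) * line_kernel \<alpha> n 0 1"
      by (simp add: e_def n_def pochhammer_of_real[symmetric] flip: mult.assoc power_add power_mult_distrib)
    show "(- 1) ^ j * e j 0 \<in> \<real>" unfolding e0 by (intro Reals_mult line_kernel_zero_real) auto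
    define g where "g = 2 - \<alpha>"
    have g2: "1 < g" "g < 2" "g = 1 + \<beta>" using \<alpha> \<alpha>1 by (auto simp: g_def \<beta>_def)
    have jj: "real j ^ j > 0" by (cases "j = 0") auto
    have nn: "real n ^ n > 0" using n by simp
    \<comment> \<open>As \<open>g\<close> is between 1 and 2, \<open>g powr g\<close> is at most 4.
      In the final base \<open>4 * exp 3\<close> this accounts for the 4; one factor
      \<open>exp 1\<close> comes from the Pochhammer symbol and two from the passage from
      \<open>n ^ n\<close> to \<open>j ^ j\<close>.\<close>
    have L: "Re (line_kernel \<alpha> n 0 1) \<ge> inverse (4 ^ n) * (real n ^ n) powr (- g)"
    proof -
      have "g powr g \<le> 2 powr 2" using g2 by (intro order_trans[OF powr_mono2[of g g 2] powr_mono]) auto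
      then have "g powr g \<le> 4" by simp
      then have "(g powr g) ^ n \<le> 4 ^ n" by (intro power_mono) auto
      then have "inverse (4 ^ n) * (real n ^ n) powr (- g) \<le> inverse ((g powr g) ^ n) * (real n ^ n) powr (- g)"
        using g2 by (intro mult_right_mono le_imp_inverse_le) auto
      also have "\<dots> = (real n * g) powr (- (real n * g))"
      proof -
        have "(g powr g) ^ n = g powr (real n * g)"
          using g2 powr_realpow[of "g powr g" n] by (simp add: powr_powr mult.commute)
        then have "inverse ((g powr g) ^ n) = g powr (- (real n * g))" by (simp add: powr_minus)
        moreover have "(real n ^ n) powr (- g) = real n powr (- (real n * g))"
          using n by (simp add: powr_of_self_power)
        ultimately show ?thesis using n g2 by (simp add: powr_mult mult.commute)
      qed
      also have "\<dots> \<le> Re (line_kernel \<alpha> n 0 1)" using low[of n] by (simp add: g_def n_def)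
      finally show ?thesis .
    qed
    have P: "pochhammer (real m) j \<ge> inverse (exp 1 ^ j) * real j ^ j"
    proof -
      have "inverse (exp 1 ^ j) * real j ^ j \<le> fact j"
        using power_le_exp_fact[of "real j" j] by (simp add: field_simps flip: exp_of_nat_mult)
      also have "fact j = pochhammer (1::real) j" by (simp add: pochhammer_fact)
      also have "\<dots> \<le> pochhammer (real m) j"
        unfolding pochhammer_prod using m by (intro prod_mono) auto
      finally show ?thesis .
    qed
    have N: "(real n ^ n) powr (- g) \<ge> inverse ((D * exp 1 ^ j) ^ 2) * (real j ^ j) powr (- g)"
    proof -
      have De: "D * exp 1 ^ j \<ge> 1" using D mult_mono[of 1 D 1 "exp 1 ^ j"] by (simp add: one_le_power)
      have "inverse ((D * exp 1 ^ j) ^ 2) = (D * exp 1 ^ j) powr (- 2)"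
        using De by (simp add: powr_minus)
      also have "\<dots> \<le> (D * exp 1 ^ j) powr (- g)"
        using De g2 by (intro powr_mono) auto
      finally have "inverse ((D * exp 1 ^ j) ^ 2) * (real j ^ j) powr (- g) \<le> (D * exp 1 ^ j) powr (- g) * (real j ^ j) powr (- g)"
        by (intro mult_right_mono) auto
      also have "\<dots> = (D * exp 1 ^ j * real j ^ j) powr (- g)"
        using De jj by (subst powr_mult) auto
      also have "\<dots> \<le> (real n ^ n) powr (- g)"
        using shifted_power_bound[of m j] g2 nn unfolding n_def D_def by (intro powr_mono2') auto
      finally show ?thesis .
    qed
    have "inverse (4 ^ m * D\<^sup>2) * inverse (4 * exp 3) ^ j * gevrey_seq (\<alpha> - 1) j =
      (inverse (exp 1 ^ j) * real j ^ j) * (inverse (4 ^ n) * (inverse ((D * exp 1 ^ j) ^ 2) * (real j ^ j) powr (- g)))"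
    proof -
      have "real j ^ j * (real j ^ j) powr (- g) = (real j ^ j) powr (1 + - g)"
        using jj by (simp only: powr_add) simp
      then have 1: "gevrey_seq (\<alpha> - 1) j = real j ^ j * (real j ^ j) powr (- g)"
        by (simp add: gevrey_seq_eq_powr g_def)
      have "exp (3::real) ^ j = exp 1 ^ j * exp 1 ^ j * exp 1 ^ j"
        by (simp flip: power_mult_distrib exp_add)
      then have "inverse (4 * exp 3) ^ j = inverse (4 ^ j) * inverse (exp (1::real) ^ j * exp 1 ^ j * exp 1 ^ j)"
        by (simp only: power_inverse power_mult_distrib inverse_mult_distrib)
      then show ?thesis unfolding 1
        by (simp only: n_def power_add power_mult_distrib power2_eq_square inverse_mult_distrib mult_ac)
    qed
    also have "\<dots> \<le> pochhammer (real m) j * Re (line_kernel \<alpha> n 0 1)"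
    proof (intro mult_mono P order_trans[OF mult_left_mono[OF N] L])
    qed (use poch_pos[of j] jj in \<open>auto simp: less_imp_le\<close>)
    also have "\<dots> = Re ((- 1) ^ j * e j 0)" unfolding e0 by simp
    finally show "inverse (4 ^ m * D\<^sup>2) * inverse (4 * exp 3) ^ j * gevrey_seq (\<alpha> - 1) j \<le> Re ((- 1) ^ j * e j 0)" .
  qed auto
qed

section \<open>An extremal function\<close>

lemma log_convex_ratio_mono:
  assumes "log_convex N" "\<And>j. N j > 0" "i \<le> k"
  shows "N (Suc i) / N i \<le> N (Suc k) / N k"
proof (rule lift_Suc_mono_le[OF _ assms(3)])
  fix n
  have "(N (Suc n))\<^sup>2 \<le> N n * N (Suc (Suc n))"
    using assms(1) unfolding log_convex_def by (metis Suc_eq_plus1 diff_Suc_1 le_add2)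
  then show "N (Suc n) / N n \<le> N (Suc (Suc n)) / N (Suc n)"
    using assms(2)[of n] assms(2)[of "Suc n"] by (simp add: field_simps power2_eq_square)
qed

text \<open>On a logarithmic scale the geometric sequence through \<open>N k\<close> with ratio
  \<open>\<nu> k\<close> is a supporting line of a convex sequence. The factor
  \<open>\<nu> k ^ k\<close> on the right avoids negative exponents for
  \<open>j < k\<close>.\<close>

lemma log_convex_tangent:
  assumes "log_convex N" "\<And>j. N j > 0"
  defines "\<nu> \<equiv> \<lambda>k. N (Suc k) / N k"
  shows "N k * \<nu> k ^ j \<le> N j * \<nu> k ^ k"
proof -
  have \<nu>: "\<nu> i > 0" for i using assms(2) by (simp add: \<nu>_def)
  have mono: "\<nu> i \<le> \<nu> k" if "i \<le> k" for i k
    unfolding \<nu>_def by (rule log_convex_ratio_mono[OF assms(1,2) that])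
  have step: "N (Suc i) = N i * \<nu> i" for i using assms(2)[of i] by (simp add: \<nu>_def)
  have up: "N k * \<nu> k ^ d \<le> N (k + d)" for d
  proof (induction d)
    case (Suc d)
    have "N k * \<nu> k ^ Suc d = (N k * \<nu> k ^ d) * \<nu> k" by simp
    also have "\<dots> \<le> N (k + d) * \<nu> (k + d)"
      using Suc \<nu>[of k] mono[of k "k + d"] less_imp_le[OF assms(2)[of "k + d"]] by (intro mult_mono) auto
    finally show ?case using step[of "k + d"] by simp
  qed simp
  have down: "N (i + d) \<le> N i * \<nu> k ^ d" if "i + d \<le> k" for i d
    using that
  proof (induction d)
    case (Suc d)
    have "N (i + Suc d) = N (i + d) * \<nu> (i + d)" using step by simp
    also have "\<dots> \<le> (N i * \<nu> k ^ d) * \<nu> k"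
      using Suc \<nu>[of "i + d"] \<nu>[of k] less_imp_le[OF assms(2)[of i]] mono[of "i + d" k] by (intro mult_mono) auto
    finally show ?case by (simp add: mult_ac)
  qed simp
  show ?thesis
  proof (cases "k \<le> j")
    case True
    then have "N k * \<nu> k ^ j = (N k * \<nu> k ^ (j - k)) * \<nu> k ^ k" by (simp flip: power_add)
    also have "\<dots> \<le> N j * \<nu> k ^ k"
      using up[of "j - k"] True \<nu>[of k] by (intro mult_right_mono) auto
    finally show ?thesis .
  next
    case False
    then have "N k * \<nu> k ^ j \<le> (N j * \<nu> k ^ (k - j)) * \<nu> k ^ j"
      using down[of j "k - j"] \<nu>[of k] by (intro mult_right_mono) auto
    also have "\<dots> = N j * \<nu> k ^ k" using False by (simp flip: power_add)
    finally show ?thesis .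
  qed
qed

lemma has_field_derivative_quadratic_remainder:
  fixes f :: "complex \<Rightarrow> complex"
  assumes "\<And>w. w \<in> S \<Longrightarrow> norm (f w - f z - (w - z) * d) \<le> C * (norm (w - z))\<^sup>2"
  shows "(f has_field_derivative d) (at z within S)"
proof -
  have "((\<lambda>w. (f w - f z) / (w - z) - d) \<longlongrightarrow> 0) (at z within S)"
  proof (rule Lim_null_comparison)
    show "\<forall>\<^sub>F w in at z within S. norm ((f w - f z) / (w - z) - d) \<le> C * norm (w - z)"
      unfolding eventually_at_filter
    proof (intro always_eventually allI impI)
      fix w assume w: "w \<noteq> z" "w \<in> S"
      then have "(f w - f z) / (w - z) - d = (f w - f z - (w - z) * d) / (w - z)"
        by (simp add: field_simps)
      then have "norm ((f w - f z) / (w - z) - d) \<le> C * (norm (w - z))\<^sup>2 / norm (w - z)"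
        using assms[OF w(2)] by (simp add: norm_divide divide_right_mono)
      then show "norm ((f w - f z) / (w - z) - d) \<le> C * norm (w - z)"
        using w by (simp add: power2_eq_square)
    qed
    have "((\<lambda>w. C * norm (w - z)) \<longlongrightarrow> C * norm (z - z)) (at z within S)"
      by (intro tendsto_intros)
    then show "((\<lambda>w. C * norm (w - z)) \<longlongrightarrow> 0) (at z within S)" by simp
  qed
  then show ?thesis unfolding has_field_derivative_iff by (subst (asm) LIM_zero_iff)
qed

text \<open>The dilation by \<open>\<nu> k\<close> puts \<open>\<nu> k ^ j\<close> into the
  \<open>j\<close>-th derivative, and the weights \<open>u k\<close> turn this into the supporting
  geometric sequence of \<open>N\<close> at \<open>k\<close>, times \<open>(1 / 2) ^ k\<close>. So
  every term is controlled by \<open>N j\<close>, while the term \<open>k = j\<close> attains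
  \<open>(1 / 2) ^ j * N j\<close>. At the vertex all terms have the same sign, and that single term
  gives the lower bound.\<close>

lemma extremal_function_exists:
  assumes \<alpha>: "0 < \<alpha>" "\<alpha> \<le> 1"
    and lc: "log_convex N" and N: "\<And>j. N j > 0"
  obtains F :: "nat \<Rightarrow> complex \<Rightarrow> complex" and A h a b :: real
  where "A > 0" "h > 0" "a > 0" "b > 0"
    and "\<And>j z. z \<in> csector \<alpha> \<Longrightarrow> norm (F j z) \<le> A * h ^ j * (gevrey_seq (\<alpha> - 1) j * N j)"
    and "\<And>j z. z \<in> csector \<alpha> \<Longrightarrow> (F j has_field_derivative F (Suc j) z) (at z within csector \<alpha>)"
    and "\<And>j. (- 1) ^ j * F j 0 \<in> \<real>"
    and "\<And>j. Re ((- 1) ^ j * F j 0) \<ge> a * b ^ j * (gevrey_seq (\<alpha> - 1) j * N j)"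
proof -
  obtain e A h a b B where pos: "A > 0" "h > 0" "a > 0" "b > 0"
    and up: "\<And>j z. z \<in> csector \<alpha> \<Longrightarrow> norm (e j z) \<le> A * h ^ j * gevrey_seq (\<alpha> - 1) j"
    and quad: "\<And>j z w. z \<in> csector \<alpha> \<Longrightarrow> w \<in> csector \<alpha> \<Longrightarrow>
           norm (e j w - e j z - (w - z) * e (Suc j) z) \<le> B j * (norm (w - z))\<^sup>2"
    and real: "\<And>j. (- 1) ^ j * e j 0 \<in> \<real>"
    and low: "\<And>j. Re ((- 1) ^ j * e j 0) \<ge> a * b ^ j * gevrey_seq (\<alpha> - 1) j"
    using extremal_kernel_exists[OF \<alpha>] by metis
  define \<nu> where "\<nu> = (\<lambda>k. N (Suc k) / N k)"
  have \<nu>: "\<nu> k > 0" for k using N by (simp add: \<nu>_def)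
  define u where "u = (\<lambda>k. (1 / 2) ^ k * (N k / \<nu> k ^ k))"
  have u: "u k > 0" for k using N \<nu> by (simp add: u_def)
  have uN: "u k * \<nu> k ^ j \<le> (1 / 2) ^ k * N j" for k j
  proof -
    have "N k * \<nu> k ^ j \<le> N j * \<nu> k ^ k"
      using log_convex_tangent[OF lc N, of k j] by (simp only: \<nu>_def)
    then have "N k / \<nu> k ^ k * \<nu> k ^ j \<le> N j" using \<nu>[of k] by (simp add: divide_le_eq)
    then have "(1 / 2) ^ k * (N k / \<nu> k ^ k * \<nu> k ^ j) \<le> (1 / 2) ^ k * N j"
      by (intro mult_left_mono) auto
    then show ?thesis by (simp only: u_def mult.assoc)
  qed
  define c where "c = (\<lambda>j k z. of_real (u k * \<nu> k ^ j) * e j (of_real (\<nu> k) * z))"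
  define F where "F = (\<lambda>j z. \<Sum>k. c j k z)"
  have \<nu>S: "of_real (\<nu> k) * z \<in> csector \<alpha>" if "z \<in> csector \<alpha>" for k z
    using that \<nu>[of k] by (intro csector_scale) auto
  have geo: "summable (\<lambda>k. (1 / 2) ^ k * X)" "(\<Sum>k. (1 / 2) ^ k * X) = 2 * X" for X :: real
    using sums_mult2[OF geometric_sums[of "1 / 2 :: real"], of X] by (auto simp: sums_iff)
  have cb: "norm (c j k z) \<le> (1 / 2) ^ k * (N j * (A * h ^ j * gevrey_seq (\<alpha> - 1) j))"
    if "z \<in> csector \<alpha>" for j k z
  proof -
    have "norm (c j k z) = (u k * \<nu> k ^ j) * norm (e j (of_real (\<nu> k) * z))"
      using u[of k] \<nu>[of k] by (simp add: c_def norm_mult norm_power)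
    also have "\<dots> \<le> ((1 / 2) ^ k * N j) * (A * h ^ j * gevrey_seq (\<alpha> - 1) j)"
      using less_imp_le[OF N[of j]] by (intro mult_mono[OF uN up[OF \<nu>S[OF that]]]) auto
    finally show ?thesis by (simp add: mult.assoc)
  qed
  have sm: "summable (\<lambda>k. c j k z)" if "z \<in> csector \<alpha>" for j z
    by (rule summable_comparison_test[OF _ geo(1)]) (use cb[OF that] in blast)
  have Fb: "norm (F j z) \<le> 2 * A * h ^ j * (gevrey_seq (\<alpha> - 1) j * N j)" if "z \<in> csector \<alpha>" for j z
  proof -
    have "norm (F j z) \<le> (\<Sum>k. (1 / 2) ^ k * (N j * (A * h ^ j * gevrey_seq (\<alpha> - 1) j)))"
      unfolding F_def by (rule norm_suminf_le[OF _ geo(1)]) (rule cb[OF that])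
    then show ?thesis unfolding geo(2) by (simp add: mult_ac)
  qed
  \<comment> \<open>A quadratic remainder gains two powers of \<open>\<nu> k\<close> under the
    dilation, hence the index \<open>j + 2\<close>.\<close>
  have Fq: "norm (F j w - F j z - (w - z) * F (Suc j) z) \<le> 2 * (N (j + 2) * \<bar>B j\<bar> * (norm (w - z))\<^sup>2)"
    if zw: "z \<in> csector \<alpha>" "w \<in> csector \<alpha>" for j z w
  proof -
    have "F j w - F j z - (w - z) * F (Suc j) z = (\<Sum>k. c j k w - c j k z - (w - z) * c (Suc j) k z)"
    proof -
      have 1: "summable (\<lambda>k. c j k w - c j k z)" by (intro summable_diff sm zw)
      have 2: "summable (\<lambda>k. (w - z) * c (Suc j) k z)" by (intro summable_mult sm zw)
      show ?thesis
        unfolding F_def suminf_diff[OF 1 2, symmetric] suminf_diff[OF sm[OF zw(2)] sm[OF zw(1)], symmetric]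
          suminf_mult[OF sm[OF zw(1)]] ..
    qed
    also have "norm \<dots> \<le> (\<Sum>k. (1 / 2) ^ k * (N (j + 2) * \<bar>B j\<bar> * (norm (w - z))\<^sup>2))"
    proof (rule norm_suminf_le[OF _ geo(1)])
      fix k
      let ?n = "of_real (\<nu> k) :: complex"
      have "c j k w - c j k z - (w - z) * c (Suc j) k z =
        of_real (u k * \<nu> k ^ j) * (e j (?n * w) - e j (?n * z) - (?n * w - ?n * z) * e (Suc j) (?n * z))"
        by (simp add: c_def algebra_simps)
      also have "norm \<dots> \<le> (u k * \<nu> k ^ j) * (\<bar>B j\<bar> * (norm (?n * w - ?n * z))\<^sup>2)"
      proof -
        have "norm (e j (?n * w) - e j (?n * z) - (?n * w - ?n * z) * e (Suc j) (?n * z)) \<le>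
          \<bar>B j\<bar> * (norm (?n * w - ?n * z))\<^sup>2"
          by (rule order_trans[OF quad[OF \<nu>S[OF zw(1)] \<nu>S[OF zw(2)]]]) (intro mult_right_mono, auto)
        moreover have "norm (of_real (u k * \<nu> k ^ j) :: complex) = u k * \<nu> k ^ j"
          using u[of k] \<nu>[of k] by (simp add: norm_mult norm_power)
        ultimately show ?thesis unfolding norm_mult[of "of_real (u k * \<nu> k ^ j)"]
          using u[of k] \<nu>[of k] by (simp add: mult_left_mono)
      qed
      also have "\<dots> = (u k * \<nu> k ^ (j + 2)) * (\<bar>B j\<bar> * (norm (w - z))\<^sup>2)"
        using \<nu>[of k] by (simp add: norm_mult power_mult_distrib power2_eq_square flip: right_diff_distrib)
      also have "\<dots> \<le> ((1 / 2) ^ k * N (j + 2)) * (\<bar>B j\<bar> * (norm (w - z))\<^sup>2)"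
        by (intro mult_right_mono uN) auto
      finally show "norm (c j k w - c j k z - (w - z) * c (Suc j) k z) \<le> (1 / 2) ^ k * (N (j + 2) * \<bar>B j\<bar> * (norm (w - z))\<^sup>2)"
        by (simp add: mult_ac)
    qed
    finally show ?thesis by (simp only: geo(2))
  qed
  have F0: "(- 1) ^ j * F j 0 = of_real (\<Sum>k. u k * \<nu> k ^ j * Re ((- 1) ^ j * e j 0))"
    and F0s: "summable (\<lambda>k. u k * \<nu> k ^ j * Re ((- 1) ^ j * e j 0))" for j
  proof -
    have eq: "(- 1) ^ j * c j k 0 = of_real (u k * \<nu> k ^ j * Re ((- 1) ^ j * e j 0))" for k
    proof -
      have "of_real (Re ((- 1) ^ j * e j 0)) = (- 1) ^ j * e j 0" using real[of j] by (rule of_real_Re)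
      then have "of_real (u k * \<nu> k ^ j * Re ((- 1) ^ j * e j 0)) = of_real (u k * \<nu> k ^ j) * ((- 1) ^ j * e j 0)"
        by (simp only: of_real_mult)
      then show ?thesis by (simp only: c_def mult_zero_right mult.left_commute)
    qed
    have s: "summable (\<lambda>k. (- 1) ^ j * c j k 0)" using sm[of 0 j] by (intro summable_mult) simp
    then show S: "summable (\<lambda>k. u k * \<nu> k ^ j * Re ((- 1) ^ j * e j 0))"
      unfolding eq summable_complex_of_real .
    have "(- 1) ^ j * F j 0 = (\<Sum>k. (- 1) ^ j * c j k 0)"
      unfolding F_def using sm[of 0 j] by (intro suminf_mult[symmetric]) simp
    also have "\<dots> = of_real (\<Sum>k. u k * \<nu> k ^ j * Re ((- 1) ^ j * e j 0))"
      unfolding eq by (rule suminf_of_real[OF S, symmetric])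
    finally show "(- 1) ^ j * F j 0 = of_real (\<Sum>k. u k * \<nu> k ^ j * Re ((- 1) ^ j * e j 0))" .
  qed
  show ?thesis
  proof (rule that[of "2 * A" h a "b / 2" F])
    fix j z assume "z \<in> csector \<alpha>"
    then show "(F j has_field_derivative F (Suc j) z) (at z within csector \<alpha>)"
      using Fq by (intro has_field_derivative_quadratic_remainder[where C = "2 * (N (j + 2) * \<bar>B j\<bar>)"]) (auto simp: mult_ac)
  next
    fix j
    show "(- 1) ^ j * F j 0 \<in> \<real>" unfolding F0 by simp
    have nn: "u k * \<nu> k ^ j * Re ((- 1) ^ j * e j 0) \<ge> 0" for k
    proof -
      have "0 \<le> a * b ^ j * gevrey_seq (\<alpha> - 1) j"
        using pos gevrey_seq_pos[of "\<alpha> - 1" j] by simp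
      then show ?thesis using low[of j] u[of k] \<nu>[of k] by (intro mult_nonneg_nonneg) auto
    qed
    have "a * (b / 2) ^ j * (gevrey_seq (\<alpha> - 1) j * N j) = (u j * \<nu> j ^ j) * (a * b ^ j * gevrey_seq (\<alpha> - 1) j)"
      using \<nu>[of j] by (simp add: u_def power_divide)
    also have "\<dots> \<le> u j * \<nu> j ^ j * Re ((- 1) ^ j * e j 0)"
      using u[of j] \<nu>[of j] by (intro mult_left_mono low) auto
    also have "\<dots> = (\<Sum>k\<in>{j}. u k * \<nu> k ^ j * Re ((- 1) ^ j * e j 0))" by simp
    also have "\<dots> \<le> (\<Sum>k. u k * \<nu> k ^ j * Re ((- 1) ^ j * e j 0))"
      using F0s nn by (intro sum_le_suminf) auto
    also have "\<dots> = Re ((- 1) ^ j * F j 0)" unfolding F0 by simp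
    finally show "a * (b / 2) ^ j * (gevrey_seq (\<alpha> - 1) j * N j) \<le> Re ((- 1) ^ j * F j 0)" .
  qed (use pos Fb in auto)
qed

section \<open>Composition\<close>

lemma A_matrix_class_iff:
  assumes "\<And>p j. p > 0 \<Longrightarrow> M p j > 0"
  shows "f \<in> A_matrix_class M S \<longleftrightarrow> f holomorphic_on S \<and>
    (\<exists>p>0. \<exists>C>0. \<exists>h>0. \<forall>j. \<forall>z\<in>S. norm ((deriv ^^ j) f z) \<le> C * h ^ j * M p j)"
proof -
  have "ud_bounded_on S h (M p) f \<longleftrightarrow> (\<exists>C>0. \<forall>j. \<forall>z\<in>S. norm ((deriv ^^ j) f z) \<le> C * h ^ j * M p j)"
    if "p > 0" "h > 0" for p h
  proof -
    have pos: "h ^ j * M p j > 0" for j using assms that by simp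
    have "ud_bounded_on S h (M p) f \<longleftrightarrow> (\<exists>C. \<forall>j. \<forall>z\<in>S. norm ((deriv ^^ j) f z) \<le> C * h ^ j * M p j)"
    proof -
      have "a / (h ^ j * M p j) \<le> C \<longleftrightarrow> a \<le> C * h ^ j * M p j" for a C j
        using pos[of j] by (simp only: pos_divide_le_eq mult.assoc)
      moreover have "bdd_above {u z j |z j. z \<in> S} \<longleftrightarrow> (\<exists>C. \<forall>j. \<forall>z\<in>S. u z j \<le> C)"
        for u :: "complex \<Rightarrow> nat \<Rightarrow> real" unfolding bdd_above_def by blast
      ultimately show ?thesis unfolding ud_bounded_on_def by (simp only:)
    qed
    also have "\<dots> \<longleftrightarrow> (\<exists>C>0. \<forall>j. \<forall>z\<in>S. norm ((deriv ^^ j) f z) \<le> C * h ^ j * M p j)"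
    proof
      assume "\<exists>C. \<forall>j. \<forall>z\<in>S. norm ((deriv ^^ j) f z) \<le> C * h ^ j * M p j"
      then obtain C where C: "\<And>j z. z \<in> S \<Longrightarrow> norm ((deriv ^^ j) f z) \<le> C * h ^ j * M p j" by blast
      have "norm ((deriv ^^ j) f z) \<le> max C 1 * h ^ j * M p j" if "z \<in> S" for j z
      proof -
        have "C * (h ^ j * M p j) \<le> max C 1 * (h ^ j * M p j)"
          using pos[of j] by (intro mult_right_mono) auto
        then show ?thesis using C[OF that, of j] by (simp only: mult.assoc order_trans)
      qed
      then show "\<exists>C>0. \<forall>j. \<forall>z\<in>S. norm ((deriv ^^ j) f z) \<le> C * h ^ j * M p j"
        by (intro exI[of _ "max C 1"]) auto
    qed blast
    finally show ?thesis .
  qed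
  note ud = this
  have "f \<in> A_matrix_class M S \<longleftrightarrow> f holomorphic_on S \<and> (\<exists>p>0. \<exists>h>0. ud_bounded_on S h (M p) f)"
    unfolding A_matrix_class_def A_class_def by auto
  also have "(\<exists>p>0. \<exists>h>0. ud_bounded_on S h (M p) f) \<longleftrightarrow>
      (\<exists>p>0. \<exists>h>0. \<exists>C>0. \<forall>j. \<forall>z\<in>S. norm ((deriv ^^ j) f z) \<le> C * h ^ j * M p j)"
    by (intro ex_cong1 conj_cong refl ud)
  finally show ?thesis by blast
qed

text \<open>Formal composition needs an inner series without constant term, so \<open>f\<close> is
  recentred by subtracting \<open>f z\<close>, and \<open>g\<close> is expanded at
  \<open>f z\<close>.\<close>

lemma higher_deriv_compose_fps:
  assumes "f analytic_on {z}" "g analytic_on {f z}"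
  defines "F \<equiv> fps_expansion f z - fps_const (f z)"
  shows "(deriv ^^ k) (g \<circ> f) z = fact k * fps_nth (fps_compose (fps_expansion g (f z)) F) k"
proof -
  have F: "(\<lambda>t. f (z + t) - f z) has_fps_expansion F"
    unfolding F_def by (intro fps_expansion_intros analytic_at_imp_has_fps_expansion assms)
  have F0: "fps_nth F 0 = 0" by (simp add: F_def fps_expansion_def)
  have "(\<lambda>s. g (f z + s)) has_fps_expansion fps_expansion g (f z)"
    by (intro analytic_at_imp_has_fps_expansion assms)
  from has_fps_expansion_compose[OF this F F0]
  have "(\<lambda>t. (g \<circ> f) (z + t)) has_fps_expansion fps_compose (fps_expansion g (f z)) F"
    by (simp add: o_def)
  moreover have "(\<lambda>t. (g \<circ> f) (z + t)) has_fps_expansion fps_expansion (g \<circ> f) z"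
    by (intro analytic_at_imp_has_fps_expansion analytic_on_compose_gen) (use assms in \<open>auto simp: analytic_on_compose\<close>)
  ultimately have "fps_compose (fps_expansion g (f z)) F = fps_expansion (g \<circ> f) z"
    using fps_expansion_unique_complex by blast
  then show ?thesis by (simp add: fps_expansion_def)
qed

text \<open>Doubling \<open>y\<close> pays for the number of ways to split \<open>i\<close>: the
  convolution leaves factors \<open>(1 / 2) ^ t\<close> with \<open>t \<ge> 1\<close>, whose sum is
  at most 1. The hypothesis stops at index \<open>k\<close> because \<open>y\<close> will depend on
  \<open>k\<close>.\<close>

lemma fps_power_coeff_bound:
  fixes F :: "complex fps"
  assumes "fps_nth F 0 = 0" "\<And>i. 1 \<le> i \<Longrightarrow> i \<le> k \<Longrightarrow> norm (fps_nth F i) \<le> C * y ^ i" "C \<ge> 0" "y \<ge> 0" "i \<le> k"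
  shows "norm (fps_nth (F ^ l) i) \<le> C ^ l * (2 * y) ^ i"
  using assms(5)
proof (induction l arbitrary: i)
  case 0
  then show ?case using assms(4) by (simp add: zero_le_power)
next
  case (Suc l)
  have "fps_nth (F ^ Suc l) i = (\<Sum>t=0..i. fps_nth F t * fps_nth (F ^ l) (i - t))"
    by (simp add: fps_mult_nth)
  also have "norm \<dots> \<le> (\<Sum>t=0..i. norm (fps_nth F t * fps_nth (F ^ l) (i - t)))" by (rule norm_sum)
  also have "\<dots> = (\<Sum>t\<in>{1..i}. norm (fps_nth F t * fps_nth (F ^ l) (i - t)))"
    using assms(1) by (intro sum.mono_neutral_right) (auto simp: not_less_eq_eq)
  also have "\<dots> \<le> (\<Sum>t\<in>{1..i}. C ^ Suc l * (2 * y) ^ i * (1 / 2) ^ t)"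
  proof (intro sum_mono)
    fix t assume t: "t \<in> {1..i}"
    have "norm (fps_nth F t * fps_nth (F ^ l) (i - t)) \<le> (C * y ^ t) * (C ^ l * (2 * y) ^ (i - t))"
      unfolding norm_mult using t Suc assms(2)[of t] assms(3,4) by (intro mult_mono) auto
    also have "\<dots> = C ^ Suc l * (2 * y) ^ i * (1 / 2) ^ t"
    proof -
      have "(2 * y) ^ i = (2 * y) ^ t * (2 * y) ^ (i - t)"
        using t power_add[of "2 * y" t "i - t"] by simp
      then show ?thesis by (simp add: power_mult_distrib power_divide)
    qed
    finally show "norm (fps_nth F t * fps_nth (F ^ l) (i - t)) \<le> C ^ Suc l * (2 * y) ^ i * (1 / 2) ^ t" .
  qed
  also have "\<dots> = C ^ Suc l * (2 * y) ^ i * (\<Sum>t\<in>{1..i}. (1 / 2) ^ t)" by (simp only: sum_distrib_left)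
  also have "\<dots> \<le> C ^ Suc l * (2 * y) ^ i * 1"
  proof (rule mult_left_mono)
    have "(\<Sum>t\<in>{1..i}. (1 / 2 :: real) ^ t) = 1 - (1 / 2) ^ i" by (induction i) auto
    then show "(\<Sum>t\<in>{1..i}. (1 / 2 :: real) ^ t) \<le> 1" by simp
  qed (use assms(3,4) in auto)
  finally show ?case by simp
qed

text \<open>All \<open>k + 1\<close> summands obey the same bound, and
  \<open>k + 1 \<le> 2 ^ k\<close> turns the 2 of the bound for powers into 4.\<close>

lemma fps_compose_coeff_bound:
  fixes F G :: "complex fps"
  assumes "fps_nth F 0 = 0" "\<And>i. 1 \<le> i \<Longrightarrow> i \<le> k \<Longrightarrow> norm (fps_nth F i) \<le> C * y ^ i" "C \<ge> 0" "y \<ge> 0"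
    and "\<And>l. norm (fps_nth G l) \<le> A * B ^ l" "A \<ge> 0" "B \<ge> 0"
  shows "norm (fps_nth (fps_compose G F) k) \<le> A * (4 * (1 + B * C) * y) ^ k"
proof -
  have "norm (fps_nth (fps_compose G F) k) \<le> (\<Sum>l=0..k. norm (fps_nth G l * fps_nth (F ^ l) k))"
    unfolding fps_compose_nth by (rule norm_sum)
  also have "\<dots> \<le> (\<Sum>l=0..k. A * (2 * y) ^ k * (1 + B * C) ^ k)"
  proof (intro sum_mono)
    fix l assume l: "l \<in> {0..k}"
    have "norm (fps_nth G l * fps_nth (F ^ l) k) \<le> (A * B ^ l) * (C ^ l * (2 * y) ^ k)"
      unfolding norm_mult using assms by (intro mult_mono fps_power_coeff_bound[of F k C y k l]) auto
    also have "\<dots> = A * (2 * y) ^ k * (B * C) ^ l" by (simp add: power_mult_distrib)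
    also have "\<dots> \<le> A * (2 * y) ^ k * (1 + B * C) ^ k"
    proof (rule mult_left_mono)
      have "(B * C) ^ l \<le> (1 + B * C) ^ l" using assms by (intro power_mono) auto
      also have "\<dots> \<le> (1 + B * C) ^ k" using assms l by (intro power_increasing) auto
      finally show "(B * C) ^ l \<le> (1 + B * C) ^ k" .
    qed (use assms in auto)
    finally show "norm (fps_nth G l * fps_nth (F ^ l) k) \<le> A * (2 * y) ^ k * (1 + B * C) ^ k" .
  qed
  also have "\<dots> = A * (real (Suc k) * ((2 * y) ^ k * (1 + B * C) ^ k))" by simp
  also have "\<dots> \<le> A * (2 ^ k * ((2 * y) ^ k * (1 + B * C) ^ k))"
  proof (intro mult_left_mono mult_right_mono)
    show "real (Suc k) \<le> 2 ^ k"
      using Suc_le_eq[of k "2 ^ k"] less_exp[of k] by (metis of_nat_le_iff of_nat_numeral of_nat_power)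
  qed (use assms in auto)
  also have "\<dots> = A * (4 * (1 + B * C) * y) ^ k"
  proof -
    have "(4::real) ^ k = 2 ^ k * 2 ^ k" by (simp flip: power_mult_distrib)
    then show ?thesis by (simp only: power_mult_distrib mult_ac)
  qed
  finally show ?thesis .
qed

section \<open>Holomorphic outer functions\<close>

lemma holomorphic_Cauchy_bounds_on_compact:
  assumes "compact K" "open U" "K \<subseteq> U" "g holomorphic_on U"
  obtains A B where "A > 0" "B > 0" "\<And>w l. w \<in> K \<Longrightarrow> norm ((deriv ^^ l) g w) \<le> A * B ^ l * fact l"
proof -
  obtain e where e: "e > 0" "(\<Union>x\<in>K. cball x e) \<subseteq> U"
    using compact_subset_open_imp_cball_epsilon_subset[OF assms(1-3)] by metis
  define K' where "K' = {x + y |x y. x \<in> K \<and> y \<in> cball 0 e}"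
  have "compact K'" unfolding K'_def using assms(1) by (intro compact_sums) auto
  moreover have K': "K' \<subseteq> U"
  proof
    fix w assume "w \<in> K'"
    then obtain x y where "w = x + y" "x \<in> K" "norm y \<le> e" by (auto simp: K'_def)
    then have "w \<in> (\<Union>x\<in>K. cball x e)" by (auto simp: dist_norm intro!: bexI[of _ x])
    then show "w \<in> U" using e by blast
  qed
  ultimately have "compact (g ` K')"
    using assms(4) by (intro compact_continuous_image) (auto intro: holomorphic_on_imp_continuous_on holomorphic_on_subset)
  then obtain A where A: "A > 0" "\<And>w. w \<in> K' \<Longrightarrow> norm (g w) \<le> A"
    using compact_imp_bounded bounded_pos by (metis image_eqI)
  show ?thesis
  proof (rule that[of A "1 / e"])
    fix w l assume w: "w \<in> K"
    have cb: "cball w e \<subseteq> U" using e(2) w by blast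
    have "norm ((deriv ^^ l) g w) \<le> fact l * A / e ^ l"
    proof (rule Cauchy_inequality)
      show "g holomorphic_on ball w e" "continuous_on (cball w e) g"
        using cb ball_subset_cball[of w e]
        by (intro holomorphic_on_imp_continuous_on holomorphic_on_subset[OF assms(4)]; blast)+
      fix x assume "norm (w - x) = e"
      then have "x \<in> K'" unfolding K'_def mem_Collect_eq using w
        by (intro exI[of _ w] exI[of _ "x - w"]) (auto simp: norm_minus_commute)
      then show "norm (g x) \<le> A" by (rule A(2))
    qed (use e in auto)
    then show "norm ((deriv ^^ l) g w) \<le> A * (1 / e) ^ l * fact l"
      by (simp add: power_divide mult_ac)
  qed (use A e in auto)
qed

lemma root_le_imp_le_power:
  assumes "root j a \<le> x" "j \<ge> 1" "a \<ge> 0"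
  shows "a \<le> x ^ j"
proof -
  have "root j a ^ j \<le> x ^ j" using assms by (intro power_mono) auto
  then show ?thesis using assms by simp
qed

text \<open>Faa di Bruno's formula enters through the composition of formal power series.\<close>

lemma rai_imp_holomorphically_closed:
  assumes S: "open S"
    and pos: "\<And>p j. p > 0 \<Longrightarrow> M p j > 0" "\<And>p j. p > 0 \<Longrightarrow> Ma p j > 0"
    and le: "\<And>p j. p > 0 \<Longrightarrow> Ma p j \<le> M p j"
    and reg: "\<And>f. f \<in> A_matrix_class M S \<Longrightarrow>
      \<exists>p>0. \<exists>C>0. \<exists>h>0. \<forall>j. \<forall>z\<in>S. norm ((deriv ^^ j) f z) \<le> C * h ^ j * Ma p j"
    and rai: "cond_rai Ma"
  shows "holomorphically_closed M S"
  unfolding holomorphically_closed_def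
proof (intro ballI allI impI)
  fix f U g
  assume f: "f \<in> A_matrix_class M S" and U: "open U" "closure (f ` S) \<subseteq> U" and g: "g holomorphic_on U"
  have holf: "f holomorphic_on S" using f by (simp add: A_matrix_class_iff[OF pos(1)])
  obtain p C h where p: "p > 0" "C > 0" "h > 0"
    and fb: "\<And>j z. z \<in> S \<Longrightarrow> norm ((deriv ^^ j) f z) \<le> C * h ^ j * Ma p j"
    using reg[OF f] by blast
  obtain R q where R: "R > 0" "q > 0"
    and rpq: "\<And>j k. 1 \<le> j \<Longrightarrow> j \<le> k \<Longrightarrow> root j (check_seq (Ma p) j) \<le> R * root k (check_seq (Ma q) k)"
    using rai p(1) unfolding cond_rai_def by blast
  have "bounded (f ` S)"
    using fb[of _ 0] by (intro boundedI[of _ "C * Ma p 0"]) auto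
  then have "compact (closure (f ` S))" by (simp add: compact_closure)
  then obtain A B where A: "A > 0" "B > 0"
    and gb: "\<And>w l. w \<in> closure (f ` S) \<Longrightarrow> norm ((deriv ^^ l) g w) \<le> A * B ^ l * fact l"
    using holomorphic_Cauchy_bounds_on_compact[OF _ U g] by metis
  have inU: "f z \<in> U" if "z \<in> S" for z using that U closure_subset[of "f ` S"] by blast
  \<comment> \<open>The summand \<open>1 / M q 0\<close> is there for \<open>k = 0\<close>, since
    \<open>M q 0\<close> is not normalised here.\<close>
  have bound: "norm ((deriv ^^ k) (g \<circ> f) z) \<le> (A * (1 + 1 / M q 0)) * (4 * (1 + B * C) * (h * R)) ^ k * M q k"
    if z: "z \<in> S" for k z
  proof -
    define F where "F = fps_expansion f z - fps_const (f z)"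
    have anf: "f analytic_on {z}" using holf S z analytic_at by blast
    have ang: "g analytic_on {f z}" using g U(1) inU[OF z] analytic_at by blast
    have gz: "f z \<in> closure (f ` S)" using z closure_subset[of "f ` S"] by blast
    have Mk: "check_seq (Ma q) k > 0" using pos(2)[OF R(2)] by (simp add: check_seq_def)
    \<comment> \<open>Condition (rai) bounds the normalised derivatives of all orders
      \<open>i\<close> with \<open>1 \<le> i \<le> k\<close> by powers of this one number, and its
      \<open>k\<close>-th power returns \<open>check_seq (Ma q) k\<close> up to a geometric
      factor.\<close>
    define y where "y = h * (R * root k (check_seq (Ma q) k))"
    have y: "y \<ge> 0"
      unfolding y_def using p R Mk by (intro mult_nonneg_nonneg real_root_ge_zero) auto
    have "norm ((deriv ^^ k) (g \<circ> f) z) = fact k * norm (fps_nth (fps_compose (fps_expansion g (f z)) F) k)"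
      unfolding higher_deriv_compose_fps[OF anf ang] F_def by (simp add: norm_mult)
    also have "norm (fps_nth (fps_compose (fps_expansion g (f z)) F) k) \<le> A * (4 * (1 + B * C) * y) ^ k"
    proof (rule fps_compose_coeff_bound)
      show "fps_nth F 0 = 0" by (simp add: F_def fps_expansion_def)
      fix i assume i: "1 \<le> i" "i \<le> k"
      have "norm (fps_nth F i) = norm ((deriv ^^ i) f z) / fact i"
        using i by (simp add: F_def fps_expansion_def norm_divide)
      also have "\<dots> \<le> C * h ^ i * check_seq (Ma p) i"
        using fb[OF z, of i] by (simp add: check_seq_def divide_right_mono)
      also have "check_seq (Ma p) i \<le> (R * root k (check_seq (Ma q) k)) ^ i"
        using i pos(2)[OF p(1), of i] by (intro root_le_imp_le_power rpq) (auto simp: check_seq_def)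
      finally show "norm (fps_nth F i) \<le> C * y ^ i"
        using p by (simp add: y_def power_mult_distrib mult.assoc)
    next
      fix l
      show "norm (fps_nth (fps_expansion g (f z)) l) \<le> A * B ^ l"
        using gb[OF gz, of l] by (simp add: fps_expansion_def norm_divide divide_le_eq)
    qed (use p A y in auto)
    finally have 1: "norm ((deriv ^^ k) (g \<circ> f) z) \<le> fact k * (A * (4 * (1 + B * C) * y) ^ k)" by simp
    have Mq: "M q k > 0" "M q 0 > 0" using pos(1) R(2) by auto
    define Y where "Y = (4 * (1 + B * C) * (h * R)) ^ k"
    have Y: "Y \<ge> 0" unfolding Y_def using A p R by (intro zero_le_power mult_nonneg_nonneg) auto
    show ?thesis
    proof (cases "k = 0")
      case True
      have "A * (1 + 1 / M q 0) * M q 0 = A * M q 0 + A" using Mq by (simp add: algebra_simps)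
      moreover have "A * M q 0 > 0" using A Mq by simp
      ultimately show ?thesis using 1 True by simp
    next
      case False
      have "root k (check_seq (Ma q) k) ^ k = check_seq (Ma q) k" using False Mk by simp
      then have "(4 * (1 + B * C) * y) ^ k = Y * check_seq (Ma q) k"
        unfolding Y_def y_def power_mult_distrib by simp
      then have "norm ((deriv ^^ k) (g \<circ> f) z) \<le> A * Y * Ma q k"
        using 1 by (simp add: check_seq_def)
      also have "\<dots> \<le> (A * (1 + 1 / M q 0)) * Y * M q k"
        using A Mq le[OF R(2), of k] less_imp_le[OF pos(2)[OF R(2), of k]] Y
        by (intro mult_mono mult_nonneg_nonneg) (auto simp: add_nonneg_nonneg)
      finally show ?thesis by (simp add: Y_def)
    qed
  qed
  have "g \<circ> f holomorphic_on S"
    using holf g inU by (intro holomorphic_on_compose_gen[where t = U]) auto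
  moreover have "A * (1 + 1 / M q 0) > 0" "4 * (1 + B * C) * (h * R) > 0"
    using A p R pos(1)[OF R(2), of 0] by (auto intro!: mult_pos_pos add_pos_pos)
  ultimately have "g \<circ> f holomorphic_on S \<and>
    (\<exists>p>0. \<exists>C>0. \<exists>h>0. \<forall>j. \<forall>z\<in>S. norm ((deriv ^^ j) (g \<circ> f) z) \<le> C * h ^ j * M p j)"
    using bound R(2) by (intro conjI exI[of _ q] exI[of _ "A * (1 + 1 / M q 0)"]
      exI[of _ "4 * (1 + B * C) * (h * R)"]) auto
  then show "g \<circ> f \<in> A_matrix_class M S"
    by (simp add: A_matrix_class_iff[OF pos(1)])
qed

section \<open>Reciprocals\<close>

text \<open>The supporting geometric sequence at \<open>j\<close> gives
  \<open>N j \<le> \<nu> ^ j\<close> by comparison at index 0 and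
  \<open>N j * \<nu> ^ (k - j) \<le> N k\<close> by comparison at \<open>k\<close>. Eliminating
  \<open>\<nu>\<close> leaves \<open>N j ^ k \<le> N k ^ j\<close>.\<close>

lemma log_convex_root_mono:
  assumes "log_convex N" "\<And>j. N j > 0" "N 0 \<le> 1" "1 \<le> j" "j \<le> k"
  shows "root j (N j) \<le> root k (N k)"
proof -
  define \<nu> where "\<nu> = N (Suc j) / N j"
  have \<nu>: "\<nu> > 0" using assms(2) by (simp add: \<nu>_def)
  have tan: "N j * \<nu> ^ i \<le> N i * \<nu> ^ j" for i
    unfolding \<nu>_def by (rule log_convex_tangent[OF assms(1,2)])
  have "N j \<le> N 0 * \<nu> ^ j" using tan[of 0] by simp
  also have "\<dots> \<le> 1 * \<nu> ^ j" using assms(3) \<nu> by (intro mult_right_mono) auto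
  finally have 1: "N j \<le> \<nu> ^ j" by simp
  have "N j * \<nu> ^ (k - j) * \<nu> ^ j \<le> N k * \<nu> ^ j"
    using tan[of k] assms(5) by (simp add: mult.assoc flip: power_add)
  then have 2: "N j * \<nu> ^ (k - j) \<le> N k" using \<nu> by (simp add: mult_le_cancel_right)
  have "N j ^ k = N j ^ j * N j ^ (k - j)" using assms(5) by (simp flip: power_add)
  also have "\<dots> \<le> N j ^ j * (\<nu> ^ j) ^ (k - j)"
    using 1 less_imp_le[OF assms(2)[of j]] by (intro mult_left_mono power_mono) auto
  also have "\<dots> = (N j * \<nu> ^ (k - j)) ^ j"
    by (simp only: power_mult_distrib power_mult[symmetric] mult.commute)
  also have "\<dots> \<le> N k ^ j"
    using 2 \<nu> less_imp_le[OF assms(2)[of j]] by (intro power_mono) auto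
  finally have "N j ^ k \<le> N k ^ j" .
  moreover have "root j (N j) ^ (j * k) = N j ^ k"
    using assms(2)[of j] assms(4) by (simp add: power_mult)
  moreover have "root k (N k) ^ (j * k) = N k ^ j"
    using assms(2)[of k] assms(4,5) by (simp add: power_mult mult.commute[of j])
  ultimately have "root j (N j) ^ (j * k) \<le> root k (N k) ^ (j * k)" by simp
  moreover have "root j (N j) \<ge> 0" "root k (N k) \<ge> 0" "j * k > 0"
    using assms(4,5) by (auto intro!: real_root_ge_zero less_imp_le[OF assms(2)])
  ultimately show ?thesis using power_mono_iff by blast
qed

lemma root_fact_le: "k \<ge> 1 \<Longrightarrow> root k (fact k) \<le> real k"
proof -
  assume k: "k \<ge> 1"
  have "root k (fact k) \<le> root k (real k ^ k)"
    using k fact_le_power[of k, where ?'a = real] by (intro real_root_le_mono) auto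
  also have "\<dots> = real k" using k by (intro real_root_power_cancel) auto
  finally show ?thesis .
qed

lemma root_fact_ge: "k \<ge> 1 \<Longrightarrow> real k / exp 1 \<le> root k (fact k)"
proof -
  assume k: "k \<ge> 1"
  have "(real k / exp 1) ^ k \<le> fact k"
    using power_le_exp_fact[of "real k" k]
    by (simp add: power_divide divide_le_eq mult.commute flip: exp_of_nat_mult)
  then have "root k ((real k / exp 1) ^ k) \<le> root k (fact k)" using k by (intro real_root_le_mono) auto
  then show ?thesis using k by (simp add: real_root_power_cancel)
qed

lemma root_check_seq_gevrey:
  assumes "k \<ge> 1"
  shows "root k (check_seq (\<lambda>j. gevrey_seq a j * K j) k) = real k powr a * root k (K k) / root k (fact k)"
proof -
  have "root k (gevrey_seq a k) = real k powr a"
    using assms by (simp add: gevrey_seq_def root_powr_inverse powr_powr)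
  then show ?thesis by (simp add: check_seq_def real_root_divide real_root_mult)
qed

text \<open>The root splits into a power of the index, the root of \<open>K\<close> and the
  reciprocal root of the factorial. From \<open>i\<close> to \<open>k \<le> 2 * i\<close> the first
  loses at most a factor 2, the second does not decrease, and the third loses at most
  \<open>2 * exp 1\<close>.\<close>

lemma root_check_seq_doubling:
  assumes \<alpha>: "0 < \<alpha>" "\<alpha> \<le> 1"
    and K: "log_convex K" "\<And>j. K j > 0" "K 0 \<le> 1"
    and k: "1 \<le> i" "i \<le> k" "k \<le> 2 * i"
  defines "m \<equiv> check_seq (\<lambda>j. gevrey_seq (\<alpha> - 1) j * K j)"
  shows "root i (m i) \<le> 4 * exp 1 * root k (m k)"
proof -
  have ik: "real i > 0" "real k > 0" "real k \<le> 2 * real i" using k by auto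
  have p: "real i powr (\<alpha> - 1) \<le> 2 * real k powr (\<alpha> - 1)"
  proof -
    have "real i powr (\<alpha> - 1) \<le> (real k / 2) powr (\<alpha> - 1)"
      using ik \<alpha> by (intro powr_mono2') auto
    also have "\<dots> = real k powr (\<alpha> - 1) * 2 powr (1 - \<alpha>)"
      using ik by (simp add: powr_divide powr_diff field_simps)
    also have "\<dots> \<le> real k powr (\<alpha> - 1) * 2 powr 1"
      using \<alpha> by (intro mult_left_mono powr_mono) auto
    finally show ?thesis by simp
  qed
  have f: "1 / root i (fact i) \<le> 2 * exp 1 * (1 / root k (fact k))"
  proof -
    have "1 / root i (fact i) \<le> 1 / (real i / exp 1)"
      using root_fact_ge[of i] k ik by (intro divide_left_mono mult_pos_pos) auto
    also have "\<dots> \<le> 2 * exp 1 * (1 / real k)" using ik by (simp add: field_simps)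
    also have "\<dots> \<le> 2 * exp 1 * (1 / root k (fact k))"
      using root_fact_le[of k] k ik by (intro mult_left_mono divide_left_mono mult_pos_pos) auto
    finally show ?thesis .
  qed
  have r: "root i (K i) \<le> root k (K k)" by (rule log_convex_root_mono[OF K k(1,2)])
  have pos: "root i (K i) \<ge> 0" "root k (K k) \<ge> 0" "root i (fact i) > 0" "root k (fact k) > 0"
    using k less_imp_le[OF K(2)] by (auto intro: real_root_ge_zero)
  have "root i (m i) = real i powr (\<alpha> - 1) * root i (K i) * (1 / root i (fact i))"
    unfolding m_def using root_check_seq_gevrey[of i "\<alpha> - 1" K] k by simp
  also have "\<dots> \<le> (2 * real k powr (\<alpha> - 1)) * root k (K k) * (2 * exp 1 * (1 / root k (fact k)))"
    using p f r pos by (intro mult_mono) auto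
  also have "\<dots> = 4 * exp 1 * root k (m k)"
    unfolding m_def using root_check_seq_gevrey[of k "\<alpha> - 1" K] k by simp
  finally show ?thesis .
qed

text \<open>With \<open>i = k div j\<close> the multiple \<open>i * j\<close> satisfies
  \<open>i * j \<le> k \<le> 2 * (i * j)\<close>. The hypothesis leads from \<open>j\<close> to
  \<open>i * j\<close>, the doubling estimate from there to \<open>k\<close>.\<close>

lemma cond_raiI_multiples:
  assumes \<alpha>: "0 < \<alpha>" "\<alpha> \<le> 1"
    and K: "\<And>p. p > 0 \<Longrightarrow> log_convex (K p)" "\<And>p j. p > 0 \<Longrightarrow> K p j > 0" "\<And>p. p > 0 \<Longrightarrow> K p 0 \<le> 1"
  defines "Ma \<equiv> \<lambda>p j. gevrey_seq (\<alpha> - 1) j * K p j"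
  assumes mult: "\<And>p. p > 0 \<Longrightarrow> \<exists>E>0. \<exists>q>0. \<forall>i\<ge>1. \<forall>j\<ge>1.
      check_seq (Ma p) j ^ i \<le> E ^ (i * j) * check_seq (Ma q) (i * j)"
  shows "cond_rai Ma"
  unfolding cond_rai_def
proof (intro allI impI)
  fix p :: real assume p: "p > 0"
  obtain E q where E: "E > 0" "q > 0" and le: "\<And>i j. i \<ge> 1 \<Longrightarrow> j \<ge> 1 \<Longrightarrow>
      check_seq (Ma p) j ^ i \<le> E ^ (i * j) * check_seq (Ma q) (i * j)"
    using mult[OF p] by blast
  have pos: "check_seq (Ma r) j > 0" if "r > 0" for r j
    using K(2)[OF that, of j] gevrey_seq_pos by (simp add: Ma_def check_seq_def)
  have "root j (check_seq (Ma p) j) \<le> E * (4 * exp 1) * root k (check_seq (Ma q) k)"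
    if jk: "1 \<le> j" "j \<le> k" for j k
  proof -
    define i where "i = k div j"
    have i: "i \<ge> 1" using jk by (simp add: i_def div_greater_zero_iff Suc_le_eq)
    have ij: "1 \<le> i * j" "i * j \<le> k" using i jk by (auto simp: i_def)
    have "k < i * j + j" using jk unfolding i_def
      by (metis Suc_eq_plus1 add.commute dividend_less_div_times less_le_trans zero_less_one)
    also have "\<dots> \<le> 2 * (i * j)" using i by simp
    finally have k2: "k \<le> 2 * (i * j)" by simp
    have "root j (check_seq (Ma p) j) ^ (i * j) = check_seq (Ma p) j ^ i"
      using pos[OF p, of j] jk by (simp add: mult.commute[of i j] power_mult)
    also have "\<dots> \<le> E ^ (i * j) * check_seq (Ma q) (i * j)" by (rule le[OF i jk(1)])
    also have "\<dots> = (E * root (i * j) (check_seq (Ma q) (i * j))) ^ (i * j)"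
      using pos[OF E(2), of "i * j"] ij by (simp add: power_mult_distrib)
    finally have "root j (check_seq (Ma p) j) ^ (i * j) \<le> (E * root (i * j) (check_seq (Ma q) (i * j))) ^ (i * j)" .
    moreover have "root j (check_seq (Ma p) j) \<ge> 0" "E * root (i * j) (check_seq (Ma q) (i * j)) \<ge> 0" "i * j > 0"
      using ij less_imp_le[OF E(1)]
      by (auto intro!: real_root_ge_zero mult_nonneg_nonneg less_imp_le[OF pos[OF p]] less_imp_le[OF pos[OF E(2)]])
    ultimately have "root j (check_seq (Ma p) j) \<le> E * root (i * j) (check_seq (Ma q) (i * j))"
      using power_mono_iff by blast
    also have "\<dots> \<le> E * (4 * exp 1 * root k (check_seq (Ma q) k))"
      unfolding Ma_def using E ij k2 K[OF E(2)]
      by (intro mult_left_mono root_check_seq_doubling[OF \<alpha>]) auto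
    finally show ?thesis by (simp only: mult.assoc)
  qed
  moreover have "E * (4 * exp 1) > 0" using E by simp
  ultimately show "\<exists>C>0. \<exists>q>0. \<forall>j k. 1 \<le> j \<longrightarrow> j \<le> k \<longrightarrow>
      root j (check_seq (Ma p) j) \<le> C * root k (check_seq (Ma q) k)"
    using E(2) by blast
qed

text \<open>The recursion for the coefficients of \<open>inverse P\<close> has only nonnegative
  terms. Keeping the one with \<open>b j\<close> costs nothing but size, and \<open>i\<close> such
  steps lead from index 0 to \<open>i * j\<close>.\<close>

lemma fps_reciprocal_coeff_lower_bound:
  fixes b :: "nat \<Rightarrow> real"
  assumes b: "\<And>i. b i \<ge> 0" "b 0 < l"
  defines "P \<equiv> Abs_fps (\<lambda>i. if i = 0 then l - b 0 else - b i)"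
  assumes j: "j \<ge> 1"
  shows "fps_nth (inverse P) (i * j) \<ge> (b j / l) ^ i / l"
proof -
  define r where "r = fps_nth (inverse P)"
  have l: "l > 0" using b(1)[of 0] b(2) by simp
  have PP: "P * inverse P = 1" using b(2) by (intro inverse_mult_eq_1') (simp add: P_def)
  have rec: "(l - b 0) * r k = (if k = 0 then 1 else 0) + (\<Sum>i=1..k. b i * r (k - i))" for k
  proof -
    have "(if k = 0 then 1 else 0) = fps_nth (P * inverse P) k" unfolding PP by simp
    also have "\<dots> = fps_nth P 0 * r k + (\<Sum>i=1..k. fps_nth P i * r (k - i))"
      by (simp add: fps_mult_nth sum.atLeast_Suc_atMost r_def)
    also have "(\<Sum>i=1..k. fps_nth P i * r (k - i)) = (\<Sum>i=1..k. - (b i * r (k - i)))"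
      by (intro sum.cong) (auto simp: P_def)
    also have "fps_nth P 0 = l - b 0" by (simp add: P_def)
    finally show ?thesis by (simp add: sum_negf)
  qed
  have nn: "r k \<ge> 0" for k
  proof (induction k rule: less_induct)
    case (less k)
    have "(l - b 0) * r k \<ge> 0"
      unfolding rec using less b(1) by (intro add_nonneg_nonneg sum_nonneg mult_nonneg_nonneg) auto
    then show ?case using b(2) by (simp add: zero_le_mult_iff)
  qed
  have lr: "l * r k \<ge> (l - b 0) * r k" for k
    using nn[of k] b(1)[of 0] by (intro mult_right_mono) auto
  have "r (i * j) \<ge> (b j / l) ^ i / l"
  proof (induction i)
    case 0
    have "(l - b 0) * r 0 = 1" using rec[of 0] by simp
    then show ?case using lr[of 0] l by (simp add: divide_le_eq mult.commute)
  next
    case (Suc i)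
    have "b j * ((b j / l) ^ i / l) \<le> b j * r (Suc i * j - j)"
      using Suc b(1) by (intro mult_left_mono) auto
    also have "\<dots> = (\<Sum>t\<in>{j}. b t * r (Suc i * j - t))" by simp
    also have "\<dots> \<le> (\<Sum>t=1..Suc i * j. b t * r (Suc i * j - t))"
      using j b(1) nn by (intro sum_mono2) auto
    also have "\<dots> = (l - b 0) * r (Suc i * j)" using rec[of "Suc i * j"] j by simp
    also have "\<dots> \<le> l * r (Suc i * j)" by (rule lr)
    finally show ?case using l by (simp add: field_simps)
  qed
  then show ?thesis by (simp add: r_def)
qed

section \<open>Reciprocals at the vertex of the sector\<close>

lemma higher_deriv_eq_chain:
  assumes "open S" "\<And>j z. z \<in> S \<Longrightarrow> (F j has_field_derivative F (Suc j) z) (at z)" "z \<in> S"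
  shows "(deriv ^^ j) (F 0) z = F j z"
  using assms(3)
proof (induction j arbitrary: z)
  case (Suc j)
  have "((deriv ^^ j) (F 0) has_field_derivative F (Suc j) z) (at z)"
    using assms(2)[OF Suc.prems] assms(1) Suc.prems
    by (rule has_field_derivative_transform_within_open) (simp add: Suc.IH)
  then show ?case by (simp add: DERIV_imp_deriv)
qed simp

lemma zero_islimpt_sector:
  assumes "0 < \<alpha>" "\<alpha> \<le> 1"
  shows "0 islimpt sector \<alpha>"
  unfolding islimpt_approachable
proof (intro allI impI)
  fix e :: real assume "e > 0"
  then show "\<exists>x'\<in>sector \<alpha>. x' \<noteq> 0 \<and> dist x' 0 < e"
    using assms by (intro bexI[of _ "of_real (e / 2)"] of_real_in_sector) auto
qed

text \<open>All coefficients of \<open>1 / (l - f)\<close> at \<open>0\<close> have alternating signs for the extremal function \<open>f\<close>, so no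
  cancellation occurs and the coefficient of index \<open>i * j\<close> dominates the \<open>i\<close>-th power of that of \<open>f\<close> of index \<open>j\<close>.\<close>

lemma inverse_closed_imp_multiples:
  assumes \<alpha>: "0 < \<alpha>" "\<alpha> \<le> 1"
    and M: "\<And>p j. p > 0 \<Longrightarrow> M p j > 0"
    and K: "\<And>p. p > 0 \<Longrightarrow> log_convex (K p)" "\<And>p j. p > 0 \<Longrightarrow> K p j > 0" "\<And>p. p > 0 \<Longrightarrow> K p 0 = 1"
  defines "Ma \<equiv> \<lambda>p j. gevrey_seq (\<alpha> - 1) j * K p j"
  assumes le: "\<And>p j. p > 0 \<Longrightarrow> Ma p j \<le> M p j"
    and reg: "\<And>f. f \<in> A_matrix_class M (sector \<alpha>) \<Longrightarrow>
      \<exists>p>0. \<exists>C>0. \<exists>h>0. \<forall>j. \<forall>z\<in>sector \<alpha>. norm ((deriv ^^ j) f z) \<le> C * h ^ j * Ma p j"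
    and ic: "inverse_closed M (sector \<alpha>)" and p: "p > 0"
  shows "\<exists>E>0. \<exists>q>0. \<forall>i\<ge>1. \<forall>j\<ge>1. check_seq (Ma p) j ^ i \<le> E ^ (i * j) * check_seq (Ma q) (i * j)"
proof -
  let ?S = "sector \<alpha>"
  have S: "open ?S" "?S \<subseteq> csector \<alpha>" using open_sector[OF \<alpha>] sector_subset_csector[OF \<alpha>] .
  obtain F A h a b where pos: "A > 0" "h > 0" "a > 0" "b > 0"
    and up: "\<And>j z. z \<in> csector \<alpha> \<Longrightarrow> norm (F j z) \<le> A * h ^ j * (gevrey_seq (\<alpha> - 1) j * K p j)"
    and der: "\<And>j z. z \<in> csector \<alpha> \<Longrightarrow> (F j has_field_derivative F (Suc j) z) (at z within csector \<alpha>)"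
    and real: "\<And>j. (- 1) ^ j * F j 0 \<in> \<real>"
    and low: "\<And>j. Re ((- 1) ^ j * F j 0) \<ge> a * b ^ j * (gevrey_seq (\<alpha> - 1) j * K p j)"
    using extremal_function_exists[OF \<alpha> K(1)[OF p] K(2)[OF p]] by metis
  have derS: "(F j has_field_derivative F (Suc j) z) (at z)" if "z \<in> ?S" for j z
  proof -
    have "(F j has_field_derivative F (Suc j) z) (at z within ?S)"
      using that S(2) by (intro has_field_derivative_subset[OF der S(2)]) blast
    then show ?thesis by (simp only: at_within_open[OF that S(1)])
  qed
  have hd: "(deriv ^^ j) (F 0) z = F j z" if "z \<in> ?S" for j z
    using higher_deriv_eq_chain[where F = F, OF S(1) derS that] .
  have holF: "F 0 holomorphic_on ?S"
    using derS S(1) by (metis holomorphic_on_open)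
  \<comment> \<open>\<open>A\<close> bounds \<open>F 0\<close>, so this choice keeps
    \<open>l - F 0\<close> at distance at least 1 from 0.\<close>
  define l where "l = A + 1"
  define g where "g = (\<lambda>z. of_real l - F 0 z)"
  have F0: "norm (F 0 z) \<le> A" if "z \<in> csector \<alpha>" for z
    using up[OF that, of 0] K(3)[OF p] by (simp add: gevrey_seq_def)
  have g1: "norm (g z) \<ge> 1" if "z \<in> ?S" for z
    using norm_triangle_ineq2[of "of_real l" "F 0 z"] F0[of z] that S(2) pos
    by (auto simp: g_def l_def)
  have holg: "g holomorphic_on ?S" unfolding g_def by (intro holomorphic_intros holF)
  have hg: "(deriv ^^ j) g z = (if j = 0 then of_real l else 0) - F j z" if "z \<in> ?S" for j z
    using higher_deriv_diff[OF holomorphic_on_const holF S(1) that, of j "of_real l"] hd[OF that]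
    by (simp add: g_def)
  have "g \<in> A_matrix_class M ?S"
  proof -
    have "norm ((deriv ^^ j) g z) \<le> (l + A) * h ^ j * M p j" if z: "z \<in> ?S" for j z
    proof -
      have 1: "norm (F j z) \<le> A * h ^ j * M p j"
      proof -
        have "norm (F j z) \<le> A * h ^ j * Ma p j" unfolding Ma_def using up[of z j] z S(2) by blast
        also have "\<dots> \<le> A * h ^ j * M p j" using pos le[OF p] by (intro mult_left_mono) auto
        finally show ?thesis .
      qed
      have 2: "norm (if j = 0 then of_real l else 0 :: complex) \<le> l * h ^ j * M p j"
      proof (cases "j = 0")
        case True
        have "1 \<le> M p 0" using le[OF p, of 0] K(3)[OF p] by (simp add: Ma_def gevrey_seq_def)
        then show ?thesis using True pos by (simp add: l_def)
      qed (use pos M[OF p, of j] in \<open>simp add: l_def\<close>)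
      show ?thesis unfolding hg[OF z]
        using norm_triangle_ineq4[of "if j = 0 then of_real l else 0 :: complex" "F j z"] 1 2
        by (simp add: distrib_right)
    qed
    moreover have "l + A > 0" using pos by (simp add: l_def)
    ultimately have "\<exists>p>0. \<exists>C>0. \<exists>h>0. \<forall>j. \<forall>z\<in>?S. norm ((deriv ^^ j) g z) \<le> C * h ^ j * M p j"
      using p pos(2) by (intro exI[of _ p] exI[of _ "l + A"] exI[of _ h]) auto
    then show ?thesis using holg by (simp add: A_matrix_class_iff[OF M])
  qed
  moreover have "(INF z\<in>?S. norm (g z)) > 0"
  proof -
    have "?S \<noteq> {}" using of_real_in_sector[OF \<alpha>, of 1] by auto
    then have "(INF z\<in>?S. norm (g z)) \<ge> 1" using g1 by (intro cINF_greatest)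
    then show ?thesis by simp
  qed
  ultimately have w: "(\<lambda>z. 1 / g z) \<in> A_matrix_class M ?S" using ic unfolding inverse_closed_def by blast
  define w where "w = (\<lambda>z. 1 / g z)"
  obtain q C H where q: "q > 0" "C > 0" "H > 0"
    and wb: "\<And>j z. z \<in> ?S \<Longrightarrow> norm ((deriv ^^ j) w z) \<le> C * H ^ j * Ma q j"
    using reg[OF \<open>(\<lambda>z. 1 / g z) \<in> A_matrix_class M ?S\<close>] unfolding w_def by blast
  have g0: "g z \<noteq> 0" if "z \<in> ?S" for z using g1[OF that] by auto
  have holw: "w holomorphic_on ?S" unfolding w_def using g0 by (intro holomorphic_intros holg) auto
  define G where "G = (\<lambda>j z. (deriv ^^ j) g z / fact j)"
  define W where "W = (\<lambda>j z. (deriv ^^ j) w z / fact j)"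
  have GW: "(\<Sum>i=0..n. G i z * W (n - i) z) = (if n = 0 then 1 else 0)" if z: "z \<in> ?S" for n z
  proof -
    have "(deriv ^^ n) (\<lambda>z. g z * w z) z = (\<Sum>i=0..n. of_nat (n choose i) * (deriv ^^ i) g z * (deriv ^^ (n - i)) w z)"
      by (rule higher_deriv_mult[OF holg holw S(1) z])
    also have "\<dots> = fact n * (\<Sum>i=0..n. G i z * W (n - i) z)"
      unfolding sum_distrib_left by (intro sum.cong) (auto simp: G_def W_def binomial_fact)
    also have "(deriv ^^ n) (\<lambda>z. g z * w z) z = (deriv ^^ n) (\<lambda>z. 1) z"
      using g0 by (intro higher_deriv_transform_within_open[OF _ _ S(1) z] holomorphic_intros holg holw)
        (auto simp: w_def)
    also have "\<dots> = (if n = 0 then 1 else 0)" by simp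
    finally show ?thesis by (auto split: if_splits)
  qed
  \<comment> \<open>The Taylor coefficients of the extremal function at the vertex after
    \<open>z\<close> is replaced by \<open>- z\<close>. They are nonnegative, and \<open>P\<close>
    below is the corresponding series of \<open>g\<close>.\<close>
  define \<beta> where "\<beta> = (\<lambda>j. Re ((- 1) ^ j * F j 0) / fact j)"
  have \<beta>low: "\<beta> j \<ge> a * b ^ j * check_seq (Ma p) j" for j
    using low[of j] by (simp add: \<beta>_def check_seq_def Ma_def divide_right_mono)
  have cpos: "check_seq (Ma r) j > 0" if "r > 0" for r j
    using K(2)[OF that, of j] gevrey_seq_pos by (simp add: Ma_def check_seq_def)
  have \<beta>nn: "\<beta> j \<ge> 0" for j
  proof -
    have "0 \<le> a * b ^ j * check_seq (Ma p) j" using pos cpos[OF p, of j] by simp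
    then show ?thesis using \<beta>low[of j] by linarith
  qed
  have \<beta>0: "\<beta> 0 < l"
    using complex_Re_le_cmod[of "F 0 0"] F0[of 0] by (simp add: \<beta>_def l_def)
  define P where "P = Abs_fps (\<lambda>i. if i = 0 then l - \<beta> 0 else - \<beta> i)"
  define r where "r = fps_nth (inverse P)"
  have F_eq: "F j 0 = (- 1) ^ j * of_real (fact j * \<beta> j)" for j
  proof -
    have "of_real (Re ((- 1) ^ j * F j 0)) = (- 1) ^ j * F j 0" using real by (rule of_real_Re)
    then have "(- 1) ^ j * of_real (fact j * \<beta> j) = (- 1) ^ j * ((- 1) ^ j * F j 0)" by (simp add: \<beta>_def)
    then show ?thesis by (simp flip: mult.assoc power_add)
  qed
  \<comment> \<open>The bounds for \<open>w\<close> are available on the open sector only. Its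
    coefficients at the vertex are therefore obtained as limits from inside, by recursion from those
    of \<open>g\<close>, and the bounds pass to the limit.\<close>
  let ?A = "at 0 within ?S"
  have ev: "eventually (\<lambda>z. z \<in> ?S) ?A" by (simp add: eventually_at_filter)
  have nontriv: "?A \<noteq> bot" using zero_islimpt_sector[OF \<alpha>] by (simp add: trivial_limit_within)
  have limG: "(G i \<longlongrightarrow> (- 1) ^ i * of_real (fps_nth P i)) ?A" for i
  proof -
    have "(F i has_field_derivative F (Suc i) 0) (at 0 within ?S)"
      using has_field_derivative_subset[OF der S(2)] by simp
    then have "(F i \<longlongrightarrow> F i 0) ?A"
      using DERIV_continuous unfolding continuous_within by blast
    then have "((\<lambda>z. ((if i = 0 then of_real l else 0) - F i z) / fact i) \<longlongrightarrow>
        ((if i = 0 then of_real l else 0) - F i 0) / fact i) ?A"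
      by (intro tendsto_intros) auto
    moreover have "((if i = 0 then of_real l else 0) - F i 0) / fact i = (- 1) ^ i * of_real (fps_nth P i)"
      unfolding F_eq by (simp add: P_def)
    moreover have "eventually (\<lambda>z. ((if i = 0 then of_real l else 0) - F i z) / fact i = G i z) ?A"
      using ev by eventually_elim (simp add: G_def hg)
    ultimately show ?thesis using tendsto_cong by fastforce
  qed
  have PP: "P * inverse P = 1" using \<beta>0 by (intro inverse_mult_eq_1') (simp add: P_def)
  have rec: "(\<Sum>i=1..n. fps_nth P i * r (n - i)) = (if n = 0 then 1 else 0) - fps_nth P 0 * r n" for n
  proof -
    have "fps_nth (P * inverse P) n = (if n = 0 then 1 else 0)" unfolding PP by simp
    then show ?thesis by (simp add: fps_mult_nth sum.atLeast_Suc_atMost r_def algebra_simps)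
  qed
  have limW: "(W n \<longlongrightarrow> (- 1) ^ n * of_real (r n)) ?A" for n
  proof (induction n rule: less_induct)
    case (less n)
    have P0: "fps_nth P 0 \<noteq> 0" using \<beta>0 by (simp add: P_def)
    have "((\<lambda>z. ((if n = 0 then 1 else 0) - (\<Sum>i=1..n. G i z * W (n - i) z)) / G 0 z) \<longlongrightarrow>
      ((if n = 0 then 1 else 0) - (\<Sum>i=1..n. ((- 1) ^ i * of_real (fps_nth P i)) * ((- 1) ^ (n - i) * of_real (r (n - i)))))
        / ((- 1) ^ 0 * of_real (fps_nth P 0))) ?A"
      by (intro tendsto_divide tendsto_diff tendsto_const tendsto_sum tendsto_mult limG less) (use P0 in auto)
    moreover have "(\<Sum>i=1..n. ((- 1) ^ i * of_real (fps_nth P i)) * ((- 1) ^ (n - i) * of_real (r (n - i)))) =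
      (- 1) ^ n * (of_real (\<Sum>i=1..n. fps_nth P i * r (n - i)) :: complex)"
      unfolding of_real_sum sum_distrib_left
    proof (rule sum.cong)
      fix i assume "i \<in> {1..n}"
      then have "(- 1 :: complex) ^ n = (- 1) ^ i * (- 1) ^ (n - i)" by (simp flip: power_add)
      then show "((- 1) ^ i * of_real (fps_nth P i)) * ((- 1) ^ (n - i) * of_real (r (n - i))) =
        (- 1) ^ n * (of_real (fps_nth P i * r (n - i)) :: complex)" by simp
    qed simp
    moreover have "eventually (\<lambda>z. ((if n = 0 then 1 else 0) - (\<Sum>i=1..n. G i z * W (n - i) z)) / G 0 z = W n z) ?A"
      using ev
    proof eventually_elim
      case (elim z)
      have "G 0 z \<noteq> 0" using g0[OF elim] by (simp add: G_def)
      moreover have "G 0 z * W n z + (\<Sum>i=1..n. G i z * W (n - i) z) = (if n = 0 then 1 else 0)"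
        using GW[OF elim, of n] by (simp add: sum.atLeast_Suc_atMost)
      ultimately show ?case by (simp add: field_simps)
    qed
    moreover have "((if n = 0 then 1 else 0) - (- 1) ^ n * of_real (\<Sum>i=1..n. fps_nth P i * r (n - i)))
        / ((- 1) ^ 0 * of_real (fps_nth P 0)) = (- 1) ^ n * (of_real (r n) :: complex)"
      unfolding rec using P0 by (cases "n = 0") (simp_all add: field_simps)
    ultimately show ?case using tendsto_cong by fastforce
  qed
  have r_up: "r n \<le> C * H ^ n * check_seq (Ma q) n" for n
  proof -
    have "norm ((- 1) ^ n * (of_real (r n) :: complex)) \<le> C * H ^ n * check_seq (Ma q) n"
    proof (rule tendsto_upperbound[OF tendsto_norm[OF limW] _ nontriv])
      show "eventually (\<lambda>z. norm (W n z) \<le> C * H ^ n * check_seq (Ma q) n) ?A"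
        using ev
      proof eventually_elim
        case (elim z)
        then show ?case using wb[OF elim, of n]
          by (simp add: W_def check_seq_def norm_divide divide_right_mono)
      qed
    qed
    then show ?thesis by (simp add: norm_mult norm_power)
  qed
  \<comment> \<open>\<open>l / a\<close> and \<open>1 / b\<close> come from the lower bound of the
    extremal function, \<open>l * C\<close> and \<open>H\<close> from the bounds for
    \<open>1 / g\<close>. The maxima with 1 allow the constants to be raised to the power
    \<open>i * j\<close>.\<close>
  define E where "E = max 1 (l / a) * max 1 (l * C) * (H / b)"
  have l: "l > 0" using pos by (simp add: l_def)
  have "check_seq (Ma p) j ^ i \<le> E ^ (i * j) * check_seq (Ma q) (i * j)" if ij: "i \<ge> 1" "j \<ge> 1" for i j
  proof -
    define m where "m = check_seq (Ma p) j"
    define m' where "m' = check_seq (Ma q) (i * j)"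
    have m: "m > 0" "m' > 0" using cpos p q by (auto simp: m_def m'_def)
    have "(a * b ^ j * m / l) ^ i / l \<le> (\<beta> j / l) ^ i / l"
      using \<beta>low[of j] pos m l unfolding m_def by (intro divide_right_mono power_mono) auto
    also have "\<dots> \<le> r (i * j)"
      unfolding r_def P_def by (rule fps_reciprocal_coeff_lower_bound[where b = \<beta>, OF \<beta>nn \<beta>0 ij(2)])
    also have "\<dots> \<le> C * H ^ (i * j) * m'" unfolding m'_def by (rule r_up)
    finally have 1: "(a * b ^ j * m / l) ^ i \<le> (l * C) * H ^ (i * j) * m'"
      using l by (simp add: divide_le_eq mult_ac)
    have "m ^ i = (l / a) ^ i * (1 / b) ^ (i * j) * (a * b ^ j * m / l) ^ i"
      using pos l by (simp add: power_mult_distrib power_divide mult.commute[of i] flip: power_mult)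
    also have "\<dots> \<le> max 1 (l / a) ^ (i * j) * (1 / b) ^ (i * j) * (max 1 (l * C) ^ (i * j) * H ^ (i * j) * m')"
    proof (intro mult_mono order_trans[OF 1])
      have "(l / a) ^ i \<le> max 1 (l / a) ^ i" using l pos by (intro power_mono) auto
      also have "\<dots> \<le> max 1 (l / a) ^ (i * j)" using ij by (intro power_increasing) auto
      finally show "(l / a) ^ i \<le> max 1 (l / a) ^ (i * j)" .
      have "l * C \<le> max 1 (l * C) ^ 1" by simp
      also have "\<dots> \<le> max 1 (l * C) ^ (i * j)" using ij by (intro power_increasing) auto
      finally show "l * C \<le> max 1 (l * C) ^ (i * j)" .
    qed (use pos l m q in \<open>auto simp: less_imp_le\<close>)
    also have "\<dots> = E ^ (i * j) * m'"
      by (simp add: E_def power_mult_distrib power_divide)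
    finally show ?thesis by (simp add: m_def m'_def)
  qed
  moreover have "E > 0" unfolding E_def using pos q by (intro mult_pos_pos) (auto simp: less_max_iff_disj)
  ultimately show ?thesis using q(1) by blast
qed

section \<open>Condition (FdB)\<close>

lemma le_fdb_circ:
  assumes "js \<noteq> []" "\<forall>j\<in>set js. 1 \<le> j" "sum_list js = k" "k \<ge> 1"
  shows "m (length js) * (\<Prod>j\<leftarrow>js. m j) \<le> fdb_circ m k"
  using assms fdb_circ_wf[of k m] by (auto simp: fdb_circ_def intro!: Max_ge)

lemma fdb_circ_leI:
  assumes "k \<ge> 1"
    and "\<And>js. js \<noteq> [] \<Longrightarrow> \<forall>j\<in>set js. 1 \<le> j \<Longrightarrow> sum_list js = k \<Longrightarrow> m (length js) * (\<Prod>j\<leftarrow>js. m j) \<le> B"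
  shows "fdb_circ m k \<le> B"
  using assms fdb_circ_wf[of k m] by (auto simp: fdb_circ_def intro!: Max.boundedI)

text \<open>Each factor lacks one power of \<open>x\<close>, so the product lacks
  \<open>length js\<close> of them. Nonnegativity and the comparison of length and sum are carried
  through the induction for the monotonicity of products and for the truncated subtraction in the
  exponent.\<close>

lemma prod_list_shift_bound:
  fixes m :: "nat \<Rightarrow> real"
  assumes "\<And>j. j \<in> set js \<Longrightarrow> 0 \<le> m j \<and> m j \<le> c ^ j * x ^ (j - 1)" "\<forall>j\<in>set js. 1 \<le> j" "c \<ge> 0" "x \<ge> 0"
  shows "(\<Prod>j\<leftarrow>js. m j) \<le> c ^ sum_list js * x ^ (sum_list js - length js)
    \<and> 0 \<le> (\<Prod>j\<leftarrow>js. m j) \<and> length js \<le> sum_list js"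
  using assms(1,2)
proof (induction js)
  case (Cons j js)
  then have IH: "(\<Prod>j\<leftarrow>js. m j) \<le> c ^ sum_list js * x ^ (sum_list js - length js)"
    "0 \<le> (\<Prod>j\<leftarrow>js. m j)" "length js \<le> sum_list js" and j: "0 \<le> m j" "m j \<le> c ^ j * x ^ (j - 1)" "1 \<le> j"
    by auto
  have "m j * (\<Prod>j\<leftarrow>js. m j) \<le> (c ^ j * x ^ (j - 1)) * (c ^ sum_list js * x ^ (sum_list js - length js))"
    using IH j assms(3,4) by (intro mult_mono) auto
  also have "\<dots> = c ^ (j + sum_list js) * x ^ ((j - 1) + (sum_list js - length js))"
    by (simp add: power_add)
  also have "(j - 1) + (sum_list js - length js) = (j + sum_list js) - Suc (length js)"
    using IH j by simp
  finally show ?case using IH j by simp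
qed simp

text \<open>Derivation closedness trades \<open>m j\<close> for \<open>m (j - 1)\<close>, which frees the exponent
  \<open>l = length js\<close> needed to absorb the outer factor \<open>m l\<close>.\<close>

lemma rai_dc_imp_FdB:
  assumes wm: "weight_matrix M" and rai: "cond_rai M" and dc: "cond_dc M"
  shows "cond_FdB M"
  unfolding cond_FdB_def
proof (intro allI impI)
  fix p :: real assume p: "p > 0"
  obtain c s where c: "c > 0" "s > 0" and dcp: "\<And>j. M p (j + 1) \<le> c ^ (j + 1) * M s j"
    using dc p unfolding cond_dc_def by blast
  \<comment> \<open>One index above \<open>p\<close>, needed for the outer factor, and
    \<open>s\<close>, needed for the inner ones, so that powers of a single number \<open>x\<close>
    bound both.\<close>
  define t where "t = max p s"
  have t: "t > 0" using p by (simp add: t_def)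
  obtain R q where R: "R > 0" "q > 0"
    and rt: "\<And>j k. 1 \<le> j \<Longrightarrow> j \<le> k \<Longrightarrow> root j (check_seq (M t) j) \<le> R * root k (check_seq (M q) k)"
    using rai t unfolding cond_rai_def by blast
  have pos: "check_seq (M r) j > 0" if "r > 0" for r j
    using wm that by (simp add: weight_matrix_def check_seq_def)
  have one: "check_seq (M r) 0 = 1" if "r > 0" for r
    using wm that by (simp add: weight_matrix_def check_seq_def)
  have mono: "check_seq (M r) j \<le> check_seq (M t) j" if "0 < r" "r \<le> t" for r j
    using wm that unfolding weight_matrix_def check_seq_def by (intro divide_right_mono) auto
  have bound: "fdb_circ (check_seq (M p)) k \<le> 1 * (c * R) ^ k * check_seq (M q) k" for k
  proof (cases "k = 0")
    case True
    then show ?thesis using one[OF R(2)] by (simp add: fdb_circ_def)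
  next
    case False
    define x where "x = R * root k (check_seq (M q) k)"
    have x: "x \<ge> 0" unfolding x_def using R pos[OF R(2), of k] by (intro mult_nonneg_nonneg real_root_ge_zero) auto
    have tx: "check_seq (M t) j \<le> x ^ j" if "j \<le> k" for j
    proof (cases "j = 0")
      case False
      then show ?thesis unfolding x_def using that pos[OF t, of j]
        by (intro root_le_imp_le_power rt) auto
    qed (simp add: one[OF t])
    show ?thesis
    proof (rule fdb_circ_leI)
      fix js :: "nat list"
      assume js: "js \<noteq> []" "\<forall>j\<in>set js. 1 \<le> j" "sum_list js = k"
      have "0 \<le> check_seq (M p) j \<and> check_seq (M p) j \<le> c ^ j * x ^ (j - 1)" if j: "j \<in> set js" for j
      proof
        show "0 \<le> check_seq (M p) j" using pos[OF p, of j] by simp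
        have j1: "1 \<le> j" "j \<le> k" using js j member_le_sum_list[of j js] by auto
        have "M p j \<le> c ^ j * M s (j - 1)" using dcp[of "j - 1"] j1 by simp
        then have "check_seq (M p) j \<le> c ^ j * M s (j - 1) / fact j"
          by (simp add: check_seq_def divide_right_mono)
        also have "\<dots> \<le> c ^ j * M s (j - 1) / fact (j - 1)"
        proof (rule divide_left_mono)
          show "(fact (j - 1) :: real) \<le> fact j" by (intro fact_mono) simp
          show "0 \<le> c ^ j * M s (j - 1)" using c wm by (simp add: weight_matrix_def less_imp_le)
        qed simp
        also have "\<dots> = c ^ j * check_seq (M s) (j - 1)" by (simp add: check_seq_def)
        also have "\<dots> \<le> c ^ j * x ^ (j - 1)"
        proof (rule mult_left_mono)
          have "check_seq (M s) (j - 1) \<le> check_seq (M t) (j - 1)"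
            using c by (intro mono) (auto simp: t_def)
          also have "\<dots> \<le> x ^ (j - 1)" using j1 by (intro tx) auto
          finally show "check_seq (M s) (j - 1) \<le> x ^ (j - 1)" .
        qed (use c in simp)
        finally show "check_seq (M p) j \<le> c ^ j * x ^ (j - 1)" .
      qed
      from prod_list_shift_bound[of js "check_seq (M p)", OF this js(2) _ x]
      have pr: "(\<Prod>j\<leftarrow>js. check_seq (M p) j) \<le> c ^ k * x ^ (k - length js)"
        "0 \<le> (\<Prod>j\<leftarrow>js. check_seq (M p) j)" "length js \<le> k" using c js by auto
      have "check_seq (M p) (length js) * (\<Prod>j\<leftarrow>js. check_seq (M p) j) \<le> x ^ length js * (c ^ k * x ^ (k - length js))"
        using pr tx[OF pr(3)] mono[OF p, of "length js"] x by (intro mult_mono) (auto simp: t_def)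
      also have "\<dots> = c ^ k * x ^ k" using pr(3) by (simp add: mult.left_commute flip: power_add)
      also have "\<dots> = 1 * (c * R) ^ k * check_seq (M q) k"
        using False pos[OF R(2), of k] by (simp add: x_def power_mult_distrib)
      finally show "check_seq (M p) (length js) * (\<Prod>j\<leftarrow>js. check_seq (M p) j) \<le> 1 * (c * R) ^ k * check_seq (M q) k" .
    qed (use False in simp)
  qed
  show "\<exists>q>0. seq_preceq (fdb_circ (check_seq (M p))) (check_seq (M q))"
    unfolding seq_preceq_def using bound R c
    by (intro exI[of _ q] conjI exI[of _ "1::real"] exI[of _ "c * R"]) auto
qed

text \<open>The limes inferior yields a geometric lower bound from some index on; the finitely many
  earlier indices are absorbed into the minimum \<open>c\<close>.\<close>

lemma cond_ComegaD:
  assumes wm: "weight_matrix M" and "cond_Comega M"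
  obtains p c d where "p > 0" "0 < c" "c \<le> 1" "0 < d" "d \<le> 1" "\<And>j. c * d ^ j * fact j \<le> M p j"
proof -
  obtain p where p: "p > 0" "liminf (\<lambda>j. ereal (root j (check_seq (M p) j))) > 0"
    using assms(2) unfolding cond_Comega_def by blast
  have pos: "M p j > 0" for j using wm p by (simp add: weight_matrix_def)
  obtain y where y: "0 < y" "ereal y < liminf (\<lambda>j. ereal (root j (check_seq (M p) j)))"
    using ereal_dense2[OF p(2)] by (metis ereal_less(2))
  have "eventually (\<lambda>j. ereal y < ereal (root j (check_seq (M p) j))) sequentially"
    using y(2) by (rule less_LiminfD)
  then obtain J where J: "\<And>j. j \<ge> J \<Longrightarrow> y < root j (check_seq (M p) j)"
    by (auto simp: eventually_sequentially)
  define d where "d = min 1 y"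
  have d: "0 < d" "d \<le> 1" "d \<le> y" using y by (auto simp: d_def)
  define c where "c = Min (insert 1 ((\<lambda>j. check_seq (M p) j) ` {..J}))"
  have c: "c > 0" "c \<le> 1" unfolding c_def using pos by (auto simp: check_seq_def)
  have "c * d ^ j * fact j \<le> M p j" for j
  proof -
    have "c * d ^ j \<le> check_seq (M p) j"
    proof (cases "j \<le> J")
      case True
      have "c * d ^ j \<le> c * 1" using c d by (intro mult_left_mono power_le_one) auto
      also have "c * 1 \<le> check_seq (M p) j" unfolding mult_1_right c_def using True by (intro Min_le) auto
      finally show ?thesis .
    next
      case False
      have "c * d ^ j \<le> 1 * y ^ j" using c d by (intro mult_mono power_mono) auto
      also have "y ^ j \<le> root j (check_seq (M p) j) ^ j"
        using J[of j] False y by (intro power_mono) auto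
      also have "\<dots> = check_seq (M p) j" using False pos[of j] by (simp add: check_seq_def)
      finally show ?thesis by simp
    qed
    then show ?thesis by (simp add: check_seq_def pos_le_divide_eq)
  qed
  then show ?thesis using that p(1) c d by blast
qed

lemma log_convex_fact_powr:
  assumes "c > 0" "d > 0" "r \<ge> 0"
  shows "log_convex (\<lambda>j. c * d ^ j * fact j powr r)"
  unfolding log_convex_def
proof (intro allI impI)
  fix j :: nat assume j: "1 \<le> j"
  obtain i where i: "j = Suc i" using j by (cases j) auto
  have "(fact j :: real) * fact j \<le> fact (j - 1) * fact (j + 1)"
    unfolding i by (simp add: algebra_simps)
  then have "(fact j * fact j) powr r \<le> (fact (j - 1) * fact (j + 1) :: real) powr r"
    using assms by (intro powr_mono2) auto
  then have f: "fact j powr r * fact j powr r \<le> fact (j - 1) powr r * fact (j + 1) powr (r::real)"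
    by (simp only: powr_mult fact_ge_zero)
  have "(c * d ^ j * fact j powr r)\<^sup>2 = (c * c * (d ^ j * d ^ j)) * (fact j powr r * fact j powr r)"
    by (simp add: power2_eq_square)
  also have "\<dots> \<le> (c * c * (d ^ j * d ^ j)) * (fact (j - 1) powr r * fact (j + 1) powr r)"
    using f assms by (intro mult_left_mono) auto
  also have "d ^ j * d ^ j = d ^ (j - 1) * d ^ (j + 1)" unfolding i by simp
  finally show "(c * d ^ j * fact j powr r)\<^sup>2 \<le> c * d ^ (j - 1) * fact (j - 1) powr r * (c * d ^ (j + 1) * fact (j + 1) powr r)"
    by (simp add: mult_ac)
qed

text \<open>The multiple \<open>c * d ^ j\<close> of \<open>fact j powr (2 - \<alpha>)\<close> is
  log-convex and below the sequence whose minorant is taken, hence below the minorant. Division by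
  j^(j(1-\<alpha>)) afterwards costs at most \<open>exp 1 ^ j\<close>, by Stirling's
  formula.\<close>

lemma Comega_matrix_alpha:
  assumes \<alpha>: "0 < \<alpha>" "\<alpha> \<le> 1"
    and M: "\<And>j. M p j > 0"
    and lim: "filterlim (\<lambda>j. root j (gevrey_seq (1 - \<alpha>) j * M p j)) at_top sequentially"
    and c: "0 < c" "0 < d" "\<And>j. c * d ^ j * fact j \<le> M p j"
  shows "c * (d / exp 1) ^ j * fact j \<le> matrix_alpha \<alpha> M p j"
proof -
  define \<beta> where "\<beta> = 1 - \<alpha>"
  have \<beta>: "0 \<le> \<beta>" "\<beta> \<le> 1" using \<alpha> by (auto simp: \<beta>_def)
  have N: "gevrey_seq (1 - \<alpha>) j * M p j > 0" for j using M gevrey_seq_pos by simp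
  have L: "c * d ^ j * fact j powr (1 + \<beta>) \<le> log_convex_minorant (\<lambda>i. gevrey_seq (1 - \<alpha>) i * M p i) j"
  proof (rule log_convex_minorant_props(4)[OF N lim])
    show "log_convex (\<lambda>j. c * d ^ j * fact j powr (1 + \<beta>))"
      using c \<beta> by (intro log_convex_fact_powr) auto
    fix i
    show "0 < c * d ^ i * fact i powr (1 + \<beta>)" using c by simp
    have "fact i powr \<beta> \<le> (real i ^ i) powr \<beta>"
      using \<beta> fact_le_power[of i, where ?'a = real] by (intro powr_mono2) auto
    then have "(c * d ^ i * fact i) * fact i powr \<beta> \<le> M p i * gevrey_seq \<beta> i"
      unfolding gevrey_seq_eq_powr using c M[of i] by (intro mult_mono) (auto simp: less_imp_le)
    moreover have "fact i powr (1 + \<beta>) = fact i * fact i powr \<beta>" by (simp only: powr_add) simp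
    ultimately show "c * d ^ i * fact i powr (1 + \<beta>) \<le> gevrey_seq (1 - \<alpha>) i * M p i"
      by (simp only: \<beta>_def mult_ac)
  qed
  have "inverse (exp 1 ^ j) * gevrey_seq \<beta> j \<le> fact j powr \<beta>"
  proof -
    have e: "exp (1::real) ^ j \<ge> 1" by (simp add: one_le_power)
    have "inverse (exp 1 ^ j) * gevrey_seq \<beta> j \<le> inverse (exp 1 ^ j) powr \<beta> * gevrey_seq \<beta> j"
    proof (rule mult_right_mono)
      have "inverse (exp (1::real) ^ j) powr 1 \<le> inverse (exp 1 ^ j) powr \<beta>"
        using \<beta> e by (intro powr_mono') (auto simp: inverse_le_1_iff)
      then show "inverse (exp (1::real) ^ j) \<le> inverse (exp 1 ^ j) powr \<beta>" by simp
    qed (simp add: less_imp_le gevrey_seq_pos)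
    also have "\<dots> = (inverse (exp 1 ^ j) * real j ^ j) powr \<beta>"
      unfolding gevrey_seq_eq_powr by (rule powr_mult[symmetric])
    also have "\<dots> \<le> fact j powr \<beta>"
    proof (rule powr_mono2)
      show "inverse (exp 1 ^ j) * real j ^ j \<le> fact j"
        using power_le_exp_fact[of "real j" j] by (simp add: field_simps flip: exp_of_nat_mult)
    qed (use \<beta> in auto)
    finally show ?thesis .
  qed
  then have "gevrey_seq (- \<beta>) j * (c * d ^ j * fact j) * (inverse (exp 1 ^ j) * gevrey_seq \<beta> j) \<le>
    gevrey_seq (- \<beta>) j * (c * d ^ j * fact j) * fact j powr \<beta>"
    using c gevrey_seq_pos[of "- \<beta>" j] by (intro mult_left_mono) auto
  also have "\<dots> = gevrey_seq (- \<beta>) j * (c * d ^ j * fact j powr (1 + \<beta>))"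
    by (simp add: powr_add mult_ac)
  also have "\<dots> \<le> matrix_alpha \<alpha> M p j"
    unfolding matrix_alpha_def using L gevrey_seq_pos[of "- \<beta>" j]
    by (simp add: \<beta>_def mult_left_mono)
  finally have "(gevrey_seq (- \<beta>) j * gevrey_seq \<beta> j) * (c * (d ^ j * inverse (exp 1 ^ j)) * fact j) \<le> matrix_alpha \<alpha> M p j"
    by (simp add: mult_ac)
  then show ?thesis unfolding gevrey_seq_uminus by (simp add: power_mult_distrib power_inverse divide_inverse)
qed

text \<open>Splitting \<open>i * j\<close> into \<open>i\<close> parts equal to \<open>j\<close>
  contributes the product of the \<open>i\<close>-th power of the value at \<open>j\<close> with the
  value at \<open>i\<close>. The analytic lower bound removes this outer factor, and
  \<open>d \<le> 1\<close> permits the exponent \<open>i * j\<close> in place of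
  \<open>i\<close>.\<close>

lemma FdB_imp_multiples:
  assumes wm: "weight_matrix M" and FdB: "cond_FdB M"
    and om: "p0 > 0" "0 < c" "c \<le> 1" "0 < d" "d \<le> 1" "\<And>j. c * d ^ j * fact j \<le> M p0 j" and p: "p > 0"
  shows "\<exists>E>0. \<exists>q>0. \<forall>i\<ge>1. \<forall>j\<ge>1. check_seq (M p) j ^ i \<le> E ^ (i * j) * check_seq (M q) (i * j)"
proof -
  define t where "t = max p p0"
  have t: "t > 0" using p by (simp add: t_def)
  obtain q A B where q: "q > 0" "A > 0" "B > 0"
    and le: "\<And>j. fdb_circ (check_seq (M t)) j \<le> A * B ^ j * check_seq (M q) j"
    using FdB t unfolding cond_FdB_def seq_preceq_def by blast
  have pos: "check_seq (M r) j > 0" if "r > 0" for r j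
    using wm that by (simp add: weight_matrix_def check_seq_def)
  have mono: "check_seq (M r) j \<le> check_seq (M t) j" if "0 < r" "r \<le> t" for r j
    using wm that unfolding weight_matrix_def check_seq_def by (intro divide_right_mono) auto
  define E where "E = max 1 (A / c) * (B / d)"
  have "check_seq (M p) j ^ i \<le> E ^ (i * j) * check_seq (M q) (i * j)" if ij: "i \<ge> 1" "j \<ge> 1" for i j
  proof -
    have "c * d ^ (i * j) \<le> c * d ^ i"
      using om ij by (intro mult_left_mono power_decreasing) auto
    also have "\<dots> \<le> check_seq (M p0) i" using om(6)[of i] by (simp add: check_seq_def pos_le_divide_eq)
    also have "\<dots> \<le> check_seq (M t) i" using om by (intro mono) (auto simp: t_def)
    finally have 1: "c * d ^ (i * j) \<le> check_seq (M t) i" .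
    have 2: "check_seq (M p) j ^ i \<le> check_seq (M t) j ^ i"
      using pos[OF p, of j] mono[OF p, of j] by (intro power_mono) (auto simp: t_def)
    have "c * d ^ (i * j) * check_seq (M p) j ^ i \<le> check_seq (M t) i * check_seq (M t) j ^ i"
      using 1 2 om pos[OF p, of j] pos[OF t, of i] by (intro mult_mono) auto
    also have "\<dots> \<le> fdb_circ (check_seq (M t)) (i * j)"
      using le_fdb_circ[of "replicate i j" "i * j" "check_seq (M t)"] ij by (simp add: sum_list_replicate)
    also have "\<dots> \<le> A * B ^ (i * j) * check_seq (M q) (i * j)" by (rule le)
    finally have "check_seq (M p) j ^ i \<le> (A / c) * (B / d) ^ (i * j) * check_seq (M q) (i * j)"
      using om by (simp add: power_divide field_simps)
    also have "\<dots> \<le> max 1 (A / c) ^ (i * j) * (B / d) ^ (i * j) * check_seq (M q) (i * j)"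
    proof (intro mult_right_mono)
      have "A / c \<le> max 1 (A / c) ^ 1" by simp
      also have "\<dots> \<le> max 1 (A / c) ^ (i * j)" using ij by (intro power_increasing) auto
      finally show "A / c \<le> max 1 (A / c) ^ (i * j)" .
    qed (use q om pos[OF q(1), of "i * j"] in auto)
    finally show ?thesis unfolding E_def power_mult_distrib .
  qed
  moreover have "E > 0" unfolding E_def using q om by (intro mult_pos_pos) (auto simp: less_max_iff_disj)
  ultimately show ?thesis using q(1) by blast
qed

section \<open>Closedness properties and the equivalences\<close>

lemma holomorphically_closed_imp_inverse_closed:
  assumes "holomorphically_closed M S"
  shows "inverse_closed M S"
  unfolding inverse_closed_def
proof (intro ballI impI)
  fix f assume f: "f \<in> A_matrix_class M S" and inf: "(INF z\<in>S. norm (f z)) > 0"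
  define \<delta> where "\<delta> = (INF z\<in>S. norm (f z))"
  have "norm (f z) \<ge> \<delta>" if "z \<in> S" for z
    unfolding \<delta>_def using that by (intro cINF_lower) (auto intro: bdd_belowI[of _ 0])
  then have "f ` S \<subseteq> - ball 0 \<delta>" using leD by fastforce
  then have "closure (f ` S) \<subseteq> - ball 0 \<delta>" by (intro closure_minimal) auto
  then have "closure (f ` S) \<subseteq> - {0}" using inf by (auto simp: \<delta>_def[symmetric])
  moreover have "(\<lambda>w::complex. 1 / w) holomorphic_on - {0}" by (intro holomorphic_intros) auto
  moreover have "open (- {0::complex})" by auto
  ultimately have "(\<lambda>w. 1 / w) \<circ> f \<in> A_matrix_class M S"
    using assms f unfolding holomorphically_closed_def by blast
  then show "(\<lambda>z. 1 / f z) \<in> A_matrix_class M S" by (simp add: o_def)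
qed

text \<open>Cauchy's estimates involve only \<open>fact j\<close> and a geometric factor, and the
  lower bound puts both below \<open>M p j\<close>; the same \<open>p\<close> serves every compact
  set.\<close>

lemma holomorphic_imp_H_matrix_class:
  assumes "open U" "g holomorphic_on U"
    and om: "p > 0" "0 < c" "0 < d" "\<And>j. c * d ^ j * fact j \<le> M p j"
  shows "g \<in> H_matrix_class M U"
  unfolding H_matrix_class_def
proof (intro CollectI conjI allI impI assms(2))
  fix K assume K: "compact K" "K \<subseteq> U"
  obtain A B where A: "A > 0" "B > 0" and b: "\<And>w l. w \<in> K \<Longrightarrow> norm ((deriv ^^ l) g w) \<le> A * B ^ l * fact l"
    using holomorphic_Cauchy_bounds_on_compact[OF K(1) assms(1) K(2) assms(2)] by metis
  have "ud_bounded_on K (B / d) (M p) g"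
    unfolding ud_bounded_on_def
  proof (rule bdd_aboveI[of _ "A / c"])
    fix x assume "x \<in> {norm ((deriv ^^ j) g z) / ((B / d) ^ j * M p j) |z j. z \<in> K}"
    then obtain z j where x: "x = norm ((deriv ^^ j) g z) / ((B / d) ^ j * M p j)" and z: "z \<in> K" by blast
    have Mp: "M p j > 0" by (rule less_le_trans[OF _ om(4)]) (use om in simp)
    have "norm ((deriv ^^ j) g z) \<le> A * B ^ j * fact j" by (rule b[OF z])
    also have "\<dots> = (A / c) * ((B / d) ^ j * (c * d ^ j * fact j))"
      using om by (simp add: power_divide)
    also have "\<dots> \<le> (A / c) * ((B / d) ^ j * M p j)"
      using A om by (intro mult_left_mono om(4)) auto
    finally show "x \<le> A / c"
      unfolding x using A om Mp by (simp add: pos_divide_le_eq)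
  qed
  then show "\<exists>p>0. \<exists>h>0. ud_bounded_on K h (M p) g" using om A by (intro exI[of _ p] conjI exI[of _ "B / d"]) auto
qed

lemma closed_under_composition_iff:
  assumes "p > 0" "0 < c" "0 < d" "\<And>j. c * d ^ j * fact j \<le> M p j"
  shows "closed_under_composition M S \<longleftrightarrow> holomorphically_closed M S"
proof
  assume "closed_under_composition M S"
  then show "holomorphically_closed M S"
    unfolding closed_under_composition_def holomorphically_closed_def
    using holomorphic_imp_H_matrix_class[where M = M, OF _ _ assms] by blast
next
  assume "holomorphically_closed M S"
  then show "closed_under_composition M S"
    unfolding closed_under_composition_def holomorphically_closed_def H_matrix_class_def by blast
qed

theorem theorem5p8:
  fixes M :: "real \<Rightarrow> nat \<Rightarrow> real" and \<alpha> :: real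
  assumes "weight_matrix M"
    and "0 < \<alpha>" and "\<alpha> \<le> 1"
    and "\<And>p. p > 0 \<Longrightarrow>
           filterlim (\<lambda>j. root j (gevrey_seq (1 - \<alpha>) j * M p j)) at_top sequentially"
  shows "(cond_rai (matrix_alpha \<alpha> M) \<longleftrightarrow> holomorphically_closed M (sector \<alpha>)) \<and>
         (cond_rai (matrix_alpha \<alpha> M) \<longleftrightarrow> inverse_closed M (sector \<alpha>)) \<and>
         (cond_Comega M \<and> cond_dc (matrix_alpha \<alpha> M) \<longrightarrow>
           (cond_rai (matrix_alpha \<alpha> M) \<longleftrightarrow> closed_under_composition M (sector \<alpha>)) \<and>
           (cond_rai (matrix_alpha \<alpha> M) \<longleftrightarrow> cond_FdB (matrix_alpha \<alpha> M)))"
proof -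
  note \<alpha> = assms(2,3) and lim = assms(4)
  let ?S = "sector \<alpha>" and ?Ma = "matrix_alpha \<alpha> M"
  define N where "N = (\<lambda>p i. gevrey_seq (1 - \<alpha>) i * M p i)"
  define K where "K = (\<lambda>p. log_convex_minorant (N p))"
  have Mpos: "M p j > 0" if "p > 0" for p j using assms(1) that by (simp add: weight_matrix_def)
  have Npos: "N p j > 0" if "p > 0" for p j using Mpos[OF that] gevrey_seq_pos by (simp add: N_def)
  have Nlim: "filterlim (\<lambda>j. root j (N p j)) at_top sequentially" if "p > 0" for p
    using lim[OF that] by (simp add: N_def)
  note props = log_convex_minorant_props[OF Npos Nlim]
  have Ma_eq: "?Ma = (\<lambda>p j. gevrey_seq (\<alpha> - 1) j * K p j)"
    by (simp add: fun_eq_iff matrix_alpha_def K_def N_def)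
  have wmA: "weight_matrix ?Ma" by (rule weight_matrix_matrix_alpha[OF assms(1) lim])
  have Mapos: "?Ma p j > 0" if "p > 0" for p j using wmA that by (simp add: weight_matrix_def)
  have K: "log_convex (K p)" "K p j > 0" "K p 0 = 1" if "p > 0" for p j
  proof -
    show "log_convex (K p)" "K p j > 0" using props(1,2)[OF that that] by (auto simp: K_def)
    have "?Ma p 0 = 1" using wmA that by (simp add: weight_matrix_def)
    then show "K p 0 = 1" by (simp add: Ma_eq gevrey_seq_def)
  qed
  have le: "?Ma p j \<le> M p j" if "p > 0" for p j
  proof -
    have "?Ma p j \<le> gevrey_seq (\<alpha> - 1) j * N p j"
      unfolding Ma_eq K_def using props(3)[OF that that] gevrey_seq_pos[of "\<alpha> - 1" j] by (intro mult_left_mono) auto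
    also have "\<dots> = M p j" using gevrey_seq_uminus[of "1 - \<alpha>" j] by (simp add: N_def flip: mult.assoc)
    finally show ?thesis .
  qed
  have reg: "\<exists>p>0. \<exists>C>0. \<exists>h>0. \<forall>j. \<forall>z\<in>?S. norm ((deriv ^^ j) f z) \<le> C * h ^ j * ?Ma p j"
    if "f \<in> A_matrix_class M ?S" for f
  proof -
    have iff: "f holomorphic_on ?S \<and> (\<exists>p>0. \<exists>C>0. \<exists>h>0. \<forall>j. \<forall>z\<in>?S. norm ((deriv ^^ j) f z) \<le> C * h ^ j * M p j)"
      using that by (simp add: A_matrix_class_iff[OF Mpos])
    then obtain p C h where p: "p > 0" "C > 0" "h > 0" and hol: "f holomorphic_on ?S"
      and f: "\<And>j z. z \<in> ?S \<Longrightarrow> norm ((deriv ^^ j) f z) \<le> C * h ^ j * M p j" by blast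
    from derivative_bounds_log_convex_minorant[OF \<alpha> Mpos[OF p(1)] lim[OF p(1)] hol p(2,3) f]
    show ?thesis using p(1) unfolding matrix_alpha_def by blast
  qed
  have ab: "cond_rai ?Ma \<Longrightarrow> holomorphically_closed M ?S"
    by (rule rai_imp_holomorphically_closed[OF open_sector[OF \<alpha>] Mpos Mapos le reg])
  have bc: "holomorphically_closed M ?S \<Longrightarrow> inverse_closed M ?S"
    by (rule holomorphically_closed_imp_inverse_closed)
  have multI: "cond_rai ?Ma" if "\<And>p. p > 0 \<Longrightarrow> \<exists>E>0. \<exists>q>0. \<forall>i\<ge>1. \<forall>j\<ge>1.
      check_seq (?Ma p) j ^ i \<le> E ^ (i * j) * check_seq (?Ma q) (i * j)"
    using that unfolding Ma_eq by (intro cond_raiI_multiples[OF \<alpha>]) (auto simp: K)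
  have ca: "cond_rai ?Ma" if "inverse_closed M ?S"
    using inverse_closed_imp_multiples[OF \<alpha> Mpos K le[unfolded Ma_eq] reg[unfolded Ma_eq] that]
    by (intro multI) (auto simp: Ma_eq)
  have abc: "cond_rai ?Ma \<longleftrightarrow> holomorphically_closed M ?S" "cond_rai ?Ma \<longleftrightarrow> inverse_closed M ?S"
    using ab bc ca by blast+
  have de: "(cond_rai ?Ma \<longleftrightarrow> closed_under_composition M ?S) \<and> (cond_rai ?Ma \<longleftrightarrow> cond_FdB ?Ma)"
    if Com: "cond_Comega M" and dc: "cond_dc ?Ma"
  proof
    obtain p c d where p: "p > 0" "0 < c" "c \<le> 1" "0 < d" "d \<le> 1" and om: "\<And>j. c * d ^ j * fact j \<le> M p j"
      using cond_ComegaD[OF assms(1) Com] by metis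
    show "cond_rai ?Ma \<longleftrightarrow> closed_under_composition M ?S"
      using abc(1) closed_under_composition_iff[where M = M, OF p(1,2,4) om] by simp
    \<comment> \<open>The analytic lower bound is known for \<open>M\<close>, but (FdB) speaks of
      \<open>?Ma\<close>, so it has to be carried over to the regularised matrix.\<close>
    have "c * (d / exp 1) ^ j * fact j \<le> ?Ma p j" for j
      by (rule Comega_matrix_alpha[where M = M, OF \<alpha> Mpos[OF p(1)] lim[OF p(1)] p(2,4) om])
    moreover have "0 < d / exp 1" "d / exp 1 \<le> 1"
      using p one_le_exp_iff[of "1::real"] by (auto simp: divide_le_eq_1 order_trans[of d 1])
    ultimately have "cond_FdB ?Ma \<Longrightarrow> cond_rai ?Ma"
      using FdB_imp_multiples[OF wmA _ p(1-3)] by (intro multI) blast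
    then show "cond_rai ?Ma \<longleftrightarrow> cond_FdB ?Ma"
      using rai_dc_imp_FdB[OF wmA _ dc] by blast
  qed
  show ?thesis using abc de by blast
qed

end
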